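(* Let $\mathcal V$ be a simple Euclidean Jordan algebra, let $F:\mathcal V\to\mathbb R$ be a strictly Schur-convex spectral function, and let $a,b\in\mathcal V$. Let $[b]=\{x\in\mathcal V:\lambda(x)=\lambda(b)\}$. (a) If $\bar x$ is a local minimizer of $F(x-a)$ for $x\in[b]$, then $a$ and $\bar x$ strongly operator commute. (b) If $\bar x$ is a local maximizer of $F(x-a)$ for $x\in[b]$, then $-a$ and $\bar x$ strongly operator commute. Moreover, if $\bar x$ is a local minimizer (resp. maximizer) of $F(x-a)$ for $x\in[b]$, then it is a global minimizer (resp. maximizer) of $F(x-a)$ for $x\in[b]$.
   Context: A Euclidean Jordan algebra (EJA) $\mathcal V$ is a finite-dimensional real inner product space with a commutative bilinear product $\circ$ satisfying the Jordan identity $(x\circ y)\circ(x\circ x)=x\circ(y\circ(x\circ x))$, having a unit $e$, and with $\langle x\circ y,z\rangle=\langle y,x\circ z\rangle$. It is simple if it is not a direct product of nonzero EJAs. A primitive idempotent is a nonzero $c$ with $c\circ c=c$ that is not a sum of two nonzero idempotents. A Jordan frame is a collection $\{e_1,\dots,e_n\}$ of primitive idempotents with $\sum_i e_i=e$ and $e_i\circ e_j=0$ for $i\ne j$; $n$ is the rank of $\mathcal V$. Every $x\in\mathcal V$ has a spectral decomposition $x=\sum_{i=1}^n\lambda_i(x)e_i$ for some Jordan frame, where $\lambda_1(x)\ge\dots\ge\lambda_n(x)$ are the (uniquely determined) eigenvalues of $x$; $\lambda(x)=(\lambda_1(x),\dots,\lambda_n(x))\in\mathbb R^n$. Two elements $a,b\in\mathcal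 V$ strongly operator commute if there is a single Jordan frame $\{e_1,\dots,e_n\}$ with $a=\sum_i\lambda_i(a)e_i$ and $b=\sum_i\lambda_i(b)e_i$. A function $F:\mathcal V\to\mathbb R$ is a spectral function if $F(x)=f(\lambda(x))$ for all $x$, for some permutation-invariant (symmetric) $f:\mathbb R^n\to\mathbb R$. For $u\in\mathbb R^n$, $u^\downarrow$ is the nonincreasing rearrangement of $u$. One writes $u\prec v$ if $\sum_{i=1}^k u_i^\downarrow\le\sum_{i=1}^k v_i^\downarrow$ for $k=1,\dots,n$, with equality for $k=n$. $f$ is strictly Schur-convex if $u\prec v$ implies $f(u)\le f(v)$, and $f(u)<f(v)$ whenever $u\prec v$ and $u^\downarrow\ne v^\downarrow$. A spectral function $F$ is strictly Schur-convex if its associated symmetric function $f$ is. Local minimizer/maximizer for $x\in[b]$ means that $\bar x\in[b]$ and that the optimality inequality holds for all $x\in[b]$ in some neighborhood of $\bar x$. *)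

theory Defs
  imports "HOL-Analysis.Analysis" "HOL-Library.Multiset"
begin

text \<open>The carrier \<open>S\<close> is a subspace of an ambient Euclidean space, so that the factors of a
  direct product are covered as well as the algebra itself, which has carrier \<open>UNIV\<close>.\<close>

locale euclidean_jordan_algebra =
  fixes S :: "'a::euclidean_space set"
    and jp :: "'a \<Rightarrow> 'a \<Rightarrow> 'a" (infixl \<open>\<bullet>\<^sub>J\<close> 70)
    and e :: 'a
  assumes subspace: "subspace S"
    and closed: "x \<in> S \<Longrightarrow> y \<in> S \<Longrightarrow> x \<bullet>\<^sub>J y \<in> S"
    and commute: "x \<in> S \<Longrightarrow> y \<in> S \<Longrightarrow> x \<bullet>\<^sub>J y = y \<bullet>\<^sub>J x"
    and add_left: "x \<in> S \<Longrightarrow> y \<in> S \<Longrightarrow> z \<in> S \<Longrightarrow> (x + y) \<bullet>\<^sub>J z = x \<bullet>\<^sub>J z + y \<bullet>\<^sub>J z"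
    and scale_left: "x \<in> S \<Longrightarrow> y \<in> S \<Longrightarrow> (c *\<^sub>R x) \<bullet>\<^sub>J y = c *\<^sub>R (x \<bullet>\<^sub>J y)"
    and jordan_identity: "x \<in> S \<Longrightarrow> y \<in> S \<Longrightarrow>
          (x \<bullet>\<^sub>J y) \<bullet>\<^sub>J (x \<bullet>\<^sub>J x) = x \<bullet>\<^sub>J (y \<bullet>\<^sub>J (x \<bullet>\<^sub>J x))"
    and unit_closed: "e \<in> S"
    and unit: "x \<in> S \<Longrightarrow> x \<bullet>\<^sub>J e = x"
    and inner_assoc: "x \<in> S \<Longrightarrow> y \<in> S \<Longrightarrow> z \<in> S \<Longrightarrow>
          inner (x \<bullet>\<^sub>J y) z = inner y (x \<bullet>\<^sub>J z)"

text \<open>A direct product is rendered internally.  The inner product of a direct product is the sum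
  of the inner products of its factors, so the factors are orthogonal; in particular they meet
  only in \<open>0\<close>.  The whole algebra is nonzero because \<open>'a\<close> is a \<open>euclidean_space\<close>.\<close>

definition simple_eja :: "('a::euclidean_space \<Rightarrow> 'a \<Rightarrow> 'a) \<Rightarrow> 'a \<Rightarrow> bool" where
  "simple_eja jp e \<longleftrightarrow> euclidean_jordan_algebra UNIV jp e \<and>
     \<not> (\<exists>A B eA eB.
          euclidean_jordan_algebra A jp eA \<and> euclidean_jordan_algebra B jp eB \<and>
          A \<noteq> {0} \<and> B \<noteq> {0} \<and>
          (\<forall>z. \<exists>x\<in>A. \<exists>y\<in>B. z = x + y) \<and>
          (\<forall>x\<in>A. \<forall>y\<in>B. jp x y = 0 \<and> inner x y = 0))"

definition idempotent :: "('a \<Rightarrow> 'a \<Rightarrow> 'a) \<Rightarrow> 'a \<Rightarrow> bool" where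
  "idempotent jp c \<longleftrightarrow> jp c c = c"

definition primitive_idempotent :: "('a::euclidean_space \<Rightarrow> 'a \<Rightarrow> 'a) \<Rightarrow> 'a \<Rightarrow> bool" where
  "primitive_idempotent jp c \<longleftrightarrow> c \<noteq> 0 \<and> idempotent jp c \<and>
     \<not> (\<exists>p q. p \<noteq> 0 \<and> q \<noteq> 0 \<and> idempotent jp p \<and> idempotent jp q \<and> c = p + q)"

text \<open>Frames are lists because spectral decompositions refer to an enumeration of the frame.\<close>

definition jordan_frame :: "('a::euclidean_space \<Rightarrow> 'a \<Rightarrow> 'a) \<Rightarrow> 'a \<Rightarrow> 'a list \<Rightarrow> bool" where
  "jordan_frame jp e es \<longleftrightarrow>
     (\<forall>i<length es. primitive_idempotent jp (es ! i)) \<and>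
     (\<Sum>i<length es. es ! i) = e \<and>
     (\<forall>i<length es. \<forall>j<length es. i \<noteq> j \<longrightarrow> jp (es ! i) (es ! j) = 0)"

definition eja_rank :: "('a::euclidean_space \<Rightarrow> 'a \<Rightarrow> 'a) \<Rightarrow> 'a \<Rightarrow> nat" where
  "eja_rank jp e = (THE n. \<exists>es. jordan_frame jp e es \<and> length es = n)"

definition frame_sum :: "real list \<Rightarrow> 'a::euclidean_space list \<Rightarrow> 'a" where
  "frame_sum ls es = (\<Sum>i<length es. ls ! i *\<^sub>R es ! i)"

text \<open>The vector \<open>\<lambda>(x)\<close>.  Vectors in \<open>\<real>\<^sup>n\<close>, where \<open>n\<close> is the rank, are lists of length \<open>n\<close>.\<close>

definition eigvals :: "('a::euclidean_space \<Rightarrow> 'a \<Rightarrow> 'a) \<Rightarrow> 'a \<Rightarrow> 'a \<Rightarrow> real list" where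
  "eigvals jp e x = (THE ls. sorted_wrt (\<ge>) ls \<and>
     (\<exists>es. jordan_frame jp e es \<and> length ls = length es \<and> x = frame_sum ls es))"

definition strongly_operator_commute ::
  "('a::euclidean_space \<Rightarrow> 'a \<Rightarrow> 'a) \<Rightarrow> 'a \<Rightarrow> 'a \<Rightarrow> 'a \<Rightarrow> bool" where
  "strongly_operator_commute jp e a b \<longleftrightarrow>
     (\<exists>es. jordan_frame jp e es \<and>
        a = frame_sum (eigvals jp e a) es \<and> b = frame_sum (eigvals jp e b) es)"

definition eigval_orbit :: "('a::euclidean_space \<Rightarrow> 'a \<Rightarrow> 'a) \<Rightarrow> 'a \<Rightarrow> 'a \<Rightarrow> 'a set" where
  "eigval_orbit jp e b = {x. eigvals jp e x = eigvals jp e b}"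

definition decreasing_rearr :: "real list \<Rightarrow> real list" where
  "decreasing_rearr u = rev (sort u)"

definition majorized_by :: "real list \<Rightarrow> real list \<Rightarrow> bool" where
  "majorized_by u v \<longleftrightarrow> length u = length v \<and>
     (\<forall>k\<in>{1..length u}.
        sum_list (take k (decreasing_rearr u)) \<le> sum_list (take k (decreasing_rearr v))) \<and>
     sum_list (decreasing_rearr u) = sum_list (decreasing_rearr v)"

definition symmetric_function :: "nat \<Rightarrow> (real list \<Rightarrow> real) \<Rightarrow> bool" where
  "symmetric_function n f \<longleftrightarrow>
     (\<forall>u v. length u = n \<and> length v = n \<and> mset u = mset v \<longrightarrow> f u = f v)"

definition strictly_schur_convex :: "nat \<Rightarrow> (real list \<Rightarrow> real) \<Rightarrow> bool" where
  "strictly_schur_convex n f \<longleftrightarrow>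
     (\<forall>u v. length u = n \<and> length v = n \<and> majorized_by u v \<longrightarrow>
        f u \<le> f v \<and> (decreasing_rearr u \<noteq> decreasing_rearr v \<longrightarrow> f u < f v))"

definition spectral_function_of ::
  "('a::euclidean_space \<Rightarrow> 'a \<Rightarrow> 'a) \<Rightarrow> 'a \<Rightarrow> (real list \<Rightarrow> real) \<Rightarrow> ('a \<Rightarrow> real) \<Rightarrow> bool" where
  "spectral_function_of jp e f F \<longleftrightarrow>
     symmetric_function (eja_rank jp e) f \<and> (\<forall>x. F x = f (eigvals jp e x))"

text \<open>The function \<open>f\<close> is determined by \<open>F\<close> on lists whose length is the rank, so the existential
  quantifier speaks about the symmetric function associated with \<open>F\<close>.\<close>

definition strictly_schur_convex_spectral ::
  "('a::euclidean_space \<Rightarrow> 'a \<Rightarrow> 'a) \<Rightarrow> 'a \<Rightarrow> ('a \<Rightarrow> real) \<Rightarrow> bool" where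
  "strictly_schur_convex_spectral jp e F \<longleftrightarrow>
     (\<exists>f. spectral_function_of jp e f F \<and> strictly_schur_convex (eja_rank jp e) f)"

definition global_minimizer :: "('a \<Rightarrow> real) \<Rightarrow> 'a set \<Rightarrow> 'a \<Rightarrow> bool" where
  "global_minimizer G X xb \<longleftrightarrow> xb \<in> X \<and> (\<forall>x\<in>X. G xb \<le> G x)"

definition global_maximizer :: "('a \<Rightarrow> real) \<Rightarrow> 'a set \<Rightarrow> 'a \<Rightarrow> bool" where
  "global_maximizer G X xb \<longleftrightarrow> xb \<in> X \<and> (\<forall>x\<in>X. G x \<le> G xb)"

definition local_minimizer :: "('a::topological_space \<Rightarrow> real) \<Rightarrow> 'a set \<Rightarrow> 'a \<Rightarrow> bool" where
  "local_minimizer G X xb \<longleftrightarrow>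
     xb \<in> X \<and> (\<exists>U. open U \<and> xb \<in> U \<and> (\<forall>x \<in> X \<inter> U. G xb \<le> G x))"

definition local_maximizer :: "('a::topological_space \<Rightarrow> real) \<Rightarrow> 'a set \<Rightarrow> 'a \<Rightarrow> bool" where
  "local_maximizer G X xb \<longleftrightarrow>
     xb \<in> X \<and> (\<exists>U. open U \<and> xb \<in> U \<and> (\<forall>x \<in> X \<inter> U. G x \<le> G xb))"

end

theory Submission
  imports Defs
begin

text \<open>
  Write \<open>y = x - a\<close> with \<open>x\<close> in the orbit \<open>[b]\<close>.  If \<open>a\<close> and \<open>x\<close> do not strongly operator commute, there
  are points \<open>x'\<close> of \<open>[b]\<close> arbitrarily close to \<open>x\<close> for which \<open>\<lambda>(x' - a)\<close> arises from \<open>\<lambda>(y)\<close> by moving two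
  entries strictly towards each other, so it is strictly majorized by \<open>\<lambda>(y)\<close>; symmetrically for \<open>-a\<close> and
  moving two entries apart.  Strict Schur convexity then excludes local extrema.

  To find \<open>x'\<close>, take a system \<open>G\<close> of orthogonal idempotents with sum \<open>e\<close>, of maximal size such that \<open>x\<close> and
  \<open>a\<close> are block diagonal with respect to \<open>G\<close>.  By maximality the elements \<open>A x - B a\<close>, with \<open>A\<close>, \<open>B\<close>
  derivations killing \<open>G\<close>, are all block diagonal elements orthogonal to \<open>G\<close>.  If \<open>y\<close> is not a combination
  of \<open>G\<close>, an open mapping theorem for \<open>exp A x - exp B a\<close> reaches every nearby target, in particular one
  that shifts two different eigenvalues of \<open>y\<close> in one block.  Otherwise \<open>x\<close> and \<open>a\<close> have a common Jordan
  frame, and a rotation in the span of \<open>e\<^sub>i\<close>, \<open>e\<^sub>j\<close> and an element of the Peirce space \<open>V\<^sub>i\<^sub>j\<close>, which is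
  nonzero by simplicity, works for any wrongly ordered pair of eigenvalues.

  For global optimality of minimizers, fix \<open>x\<close> in \<open>[b]\<close> and minimize the norm of \<open>x' - a\<close> over the compact set
  of \<open>x'\<close> in \<open>[b]\<close> with \<open>\<lambda>(x' - a) \<prec> \<lambda>(x - a)\<close>: the minimizer strongly operator commutes with \<open>a\<close>, and
  commuting pairs determine \<open>\<lambda>(x' - a)\<close>.  For maximizers one uses the subadditivity of partial sums of
  eigenvalues.
\<close>

section \<open>Jordan algebras and Peirce decompositions\<close>

text \<open>\<open>F\<close> need not be continuous, so no first-order condition is available: local
  optimality can only be contradicted by an explicit nearby comparison of eigenvalues. The squared
  norm of \<open>x - a\<close> stands in for \<open>F\<close>. Every move changes it strictly, which
  certifies that the eigenvalues really changed, and its continuity allows minimization over compact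
  sets.

  The obstacle is to control the eigenvalues of \<open>x' - a\<close> and not only those of
  \<open>x'\<close>. Moving \<open>x\<close> by \<open>exp A\<close> and \<open>a\<close> by
  \<open>exp B\<close> and then undoing \<open>exp B\<close> gives an orbit point \<open>x'\<close>
  for which \<open>x' - a\<close> has the eigenvalues of \<open>exp A x - exp B a\<close>. The
  first-order variations fill all block diagonal directions orthogonal to \<open>G\<close>: testing
  an orthogonal \<open>r\<close> against commutators of multiplication operators makes it compatible
  with \<open>x\<close> and \<open>a\<close>, so a spectral idempotent of \<open>r\<close> would
  refine \<open>G\<close>.

  Nonzero off-diagonal Peirce spaces also force all primitive idempotents to have one squared norm
  \<kappa>. The inner product is then \<kappa> times the trace form, and eigenvalue sums can be read
  off from inner products.\<close>

lemma inner_eqI: "(\<And>w. inner x w = inner y w) \<Longrightarrow> x = (y::'a::real_inner)"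
  by (metis vector_eq_rdot)

locale eja = euclidean_jordan_algebra UNIV jp e
  for jp :: "'a::euclidean_space \<Rightarrow> 'a \<Rightarrow> 'a" (infixl \<open>\<odot>\<close> 70) and e :: 'a
begin

lemma jcom: "x \<odot> y = y \<odot> x"
  by (rule commute) (rule UNIV_I)+

lemma bilinear_jp: "bilinear jp"
proof -
  have L: "linear (\<lambda>y. y \<odot> x)" for x
  proof (rule linearI)
    show "(u + v) \<odot> x = u \<odot> x + v \<odot> x" for u v by (rule add_left) (rule UNIV_I)+
    show "(r *\<^sub>R u) \<odot> x = r *\<^sub>R (u \<odot> x)" for r u by (rule scale_left) (rule UNIV_I)+
  qed
  have "(\<lambda>y. x \<odot> y) = (\<lambda>y. y \<odot> x)" for x
    by (rule ext) (rule jcom)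
  with L have R: "linear (\<lambda>y. x \<odot> y)" for x
    by metis
  show ?thesis
    unfolding bilinear_def using L R by blast
qed

lemmas jadd = bilinear_ladd[OF bilinear_jp] bilinear_radd[OF bilinear_jp]
lemmas jscale = bilinear_lmul[OF bilinear_jp] bilinear_rmul[OF bilinear_jp]
lemmas jminus = bilinear_lneg[OF bilinear_jp] bilinear_rneg[OF bilinear_jp]
lemmas jdiff = bilinear_lsub[OF bilinear_jp] bilinear_rsub[OF bilinear_jp]
lemmas jzero [simp] = bilinear_lzero[OF bilinear_jp] bilinear_rzero[OF bilinear_jp]
lemmas jlin = jadd jscale jminus jdiff jzero

lemma jlinear: "linear (\<lambda>y. x \<odot> y)"
  using bilinear_jp by (simp add: bilinear_def)

lemma jsum_right: "x \<odot> (\<Sum>i\<in>I. f i) = (\<Sum>i\<in>I. x \<odot> f i)"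
  by (rule linear_sum[OF jlinear])

lemma jsum_left: "(\<Sum>i\<in>I. f i) \<odot> x = (\<Sum>i\<in>I. f i \<odot> x)"
proof -
  have "sum f I \<odot> x = x \<odot> sum f I" by (rule jcom)
  also have "\<dots> = (\<Sum>i\<in>I. x \<odot> f i)" by (rule jsum_right)
  also have "\<dots> = (\<Sum>i\<in>I. f i \<odot> x)" by (rule sum.cong[OF refl]) (rule jcom)
  finally show ?thesis .
qed

lemma junit [simp]: "x \<odot> e = x" "e \<odot> x = x"
proof -
  show "x \<odot> e = x" by (rule unit) (rule UNIV_I)
  thus "e \<odot> x = x" by (subst jcom)
qed

lemma unit_nonzero: "e \<noteq> 0"
proof
  assume "e = 0"
  hence "z = 0" for z :: 'a using junit(1)[of z] by simp
  thus False using nonzero_Basis[OF SOME_Basis] by metis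
qed

lemma jassoc_inner: "inner (x \<odot> y) z = inner y (x \<odot> z)"
  by (rule inner_assoc) (rule UNIV_I)+

lemma jordan: "(x \<odot> y) \<odot> (x \<odot> x) = x \<odot> (y \<odot> (x \<odot> x))"
  by (rule jordan_identity) (rule UNIV_I)+

text \<open>The full polarization of the cubic Jordan identity. Testing the defect against a fixed
  \<open>v\<close> gives a real trilinear form \<open>T\<close>, which reduces the polarization to
  linear arithmetic.\<close>

lemma jordan_quartic:
  "(y \<odot> z) \<odot> (x \<odot> w) + (z \<odot> x) \<odot> (y \<odot> w) + (x \<odot> y) \<odot> (z \<odot> w)
   = x \<odot> ((y \<odot> z) \<odot> w) + y \<odot> ((z \<odot> x) \<odot> w) + z \<odot> ((x \<odot> y) \<odot> w)"
proof (rule inner_eqI)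
  fix v
  define T where "T = (\<lambda>x y z. inner ((x \<odot> y) \<odot> (z \<odot> w) - z \<odot> ((x \<odot> y) \<odot> w)) v)"
  have T0: "T x x x = 0" for x
    using jordan[of x w] by (simp add: T_def jcom)
  have Tadd: "T (a + b) c d = T a c d + T b c d" "T c (a + b) d = T c a d + T c b d"
    "T c d (a + b) = T c d a + T c d b" for a b c d
    by (simp_all add: T_def jadd inner_diff_left inner_add_left)
  have Tsym: "T a b c = T b a c" for a b c
    by (simp add: T_def jcom[of a b])
  \<comment> \<open>Inclusion and exclusion over \<open>x\<close>, \<open>y\<close>,
    \<open>z\<close> leaves six mixed terms; symmetry in the first two arguments pairs them into
    these three.\<close>
  have "T y z x + T z x y + T x y z = 0"
    using T0[of "x + y + z"] T0[of "x + y"] T0[of "y + z"] T0[of "x + z"] T0[of x] T0[of y] T0[of z]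
      Tsym[of z y x] Tsym[of x z y] Tsym[of y x z]
    unfolding Tadd by linarith
  thus "inner ((y \<odot> z) \<odot> (x \<odot> w) + (z \<odot> x) \<odot> (y \<odot> w) + (x \<odot> y) \<odot> (z \<odot> w)) v
   = inner (x \<odot> ((y \<odot> z) \<odot> w) + y \<odot> ((z \<odot> x) \<odot> w) + z \<odot> ((x \<odot> y) \<odot> w)) v"
    by (simp add: T_def inner_diff_left inner_add_left)
qed

text \<open>The left side of \<open>jordan_quartic\<close> is symmetric in all four arguments, so
  its right side survives exchanging \<open>x\<close> and \<open>w\<close>; this is the resulting
  equation solved for one term. It expresses multiplication by a triple product through
  multiplications by shorter ones.\<close>

lemma jordan_L2:
  "(x \<odot> (y \<odot> z)) \<odot> w = x \<odot> ((y \<odot> z) \<odot> w) + y \<odot> ((z \<odot> x) \<odot> w) + z \<odot> ((x \<odot> y) \<odot> w)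
     - y \<odot> (x \<odot> (z \<odot> w)) - z \<odot> (x \<odot> (y \<odot> w))"
proof -
  have "x \<odot> ((y \<odot> z) \<odot> w) + y \<odot> ((z \<odot> x) \<odot> w) + z \<odot> ((x \<odot> y) \<odot> w)
     = (y \<odot> z) \<odot> (x \<odot> w) + (z \<odot> x) \<odot> (y \<odot> w) + (x \<odot> y) \<odot> (z \<odot> w)"
    by (simp add: jordan_quartic)
  also have "\<dots> = (y \<odot> z) \<odot> (w \<odot> x) + (z \<odot> w) \<odot> (y \<odot> x) + (w \<odot> y) \<odot> (z \<odot> x)"
    by (simp add: jcom add.commute add.left_commute)
  also have "\<dots> = w \<odot> ((y \<odot> z) \<odot> x) + y \<odot> ((z \<odot> w) \<odot> x) + z \<odot> ((w \<odot> y) \<odot> x)"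
    by (rule jordan_quartic)
  finally show ?thesis
    by (simp add: jcom)
qed

text \<open>The commutator of two multiplication operators, known as an inner derivation.\<close>

definition inder :: "'a \<Rightarrow> 'a \<Rightarrow> 'a \<Rightarrow> 'a" where
  "inder u w z = u \<odot> (w \<odot> z) - w \<odot> (u \<odot> z)"

text \<open>Subtracting two instances of \<open>jordan_L2\<close> cancels everything that is
  symmetric in \<open>u\<close> and \<open>w\<close>.\<close>

lemma inder_derivation: "inder u w (y \<odot> z) = inder u w y \<odot> z + y \<odot> inder u w z"
proof -
  have "inder u w y \<odot> z = (u \<odot> (w \<odot> y)) \<odot> z - (w \<odot> (u \<odot> y)) \<odot> z"
    by (simp add: inder_def jlin)
  also have "\<dots> = u \<odot> (w \<odot> (y \<odot> z)) - w \<odot> (u \<odot> (y \<odot> z)) - (y \<odot> (u \<odot> (w \<odot> z)) - y \<odot> (w \<odot> (u \<odot> z)))"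
    unfolding jordan_L2[of u w y z] jordan_L2[of w u y z]
    by (simp add: jcom[of y u] jcom[of y w] jcom[of w u])
  also have "\<dots> = inder u w (y \<odot> z) - y \<odot> inder u w z"
    by (simp add: inder_def jlin)
  finally show ?thesis by simp
qed

lemma inder_linear: "linear (inder u w)"
  by (rule linearI) (simp_all add: inder_def jlin algebra_simps)

lemma inder_skew: "inner (inder u w y) z = - inner y (inder u w z)"
  by (simp add: inder_def inner_diff_left inner_diff_right jassoc_inner)

text \<open>Multiplication by an idempotent is annihilated by the polynomial t (2t - 1) (t - 1),
  whence the Peirce eigenvalues 0, 1/2 and 1.\<close>

lemma idem_cubic:
  assumes "c \<odot> c = c"
  shows "c \<odot> v = 3 *\<^sub>R (c \<odot> (c \<odot> v)) - 2 *\<^sub>R (c \<odot> (c \<odot> (c \<odot> v)))"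
proof -
  have "3 *\<^sub>R u = u + u + u" for u :: 'a
    by (rule inner_eqI) (simp add: inner_add_left)
  thus ?thesis
    using jordan_L2[of c c c v] assms by (simp add: scaleR_2 algebra_simps)
qed

section \<open>Peirce spaces of an idempotent\<close>

definition V1 :: "'a \<Rightarrow> 'a set" where "V1 c = {v. c \<odot> v = v}"
definition Vh :: "'a \<Rightarrow> 'a set" where "Vh c = {v. c \<odot> v = (1/2) *\<^sub>R v}"
definition V0 :: "'a \<Rightarrow> 'a set" where "V0 c = {v. c \<odot> v = 0}"

lemma peirce_obtain:
  assumes "c \<odot> c = c"
  obtains v1 vh v0 where "v = v1 + vh + v0" "v1 \<in> V1 c" "vh \<in> Vh c" "v0 \<in> V0 c"
proof -
  let ?a = "c \<odot> v" let ?b = "c \<odot> (c \<odot> v)" let ?d = "c \<odot> (c \<odot> (c \<odot> v))"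
  have d: "?d = (3/2) *\<^sub>R ?b - (1/2) *\<^sub>R ?a"
  proof -
    have "2 *\<^sub>R ?d = 3 *\<^sub>R ?b - ?a" using idem_cubic[OF assms, of v] by (simp add: algebra_simps)
    hence "(1/2) *\<^sub>R (2 *\<^sub>R ?d) = (1/2) *\<^sub>R (3 *\<^sub>R ?b - ?a)" by simp
    thus ?thesis by (simp add: algebra_simps)
  qed
  show thesis
  proof (rule that)
    \<comment> \<open>The summands are the Lagrange interpolation polynomials for the nodes 1, 1/2,
      0, evaluated at multiplication by \<open>c\<close>.\<close>
    show "v = (2 *\<^sub>R ?b - ?a) + (4 *\<^sub>R ?a - 4 *\<^sub>R ?b) + (v - 3 *\<^sub>R ?a + 2 *\<^sub>R ?b)"
      by (rule inner_eqI) (simp add: algebra_simps)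
    show "2 *\<^sub>R ?b - ?a \<in> V1 c"
      unfolding V1_def mem_Collect_eq jlin d by (rule inner_eqI) (simp add: algebra_simps)
    show "4 *\<^sub>R ?a - 4 *\<^sub>R ?b \<in> Vh c"
      unfolding Vh_def mem_Collect_eq jlin d by (rule inner_eqI) (simp add: algebra_simps)
    show "v - 3 *\<^sub>R ?a + 2 *\<^sub>R ?b \<in> V0 c"
      unfolding V0_def mem_Collect_eq jlin d by (rule inner_eqI) (simp add: algebra_simps)
  qed
qed

text \<open>For an eigenvector \<open>z\<close> with eigenvalue l, the quartic identity says that 2l
  - 1 times the commutator vanishes; it is informative except at l = 1/2.\<close>

lemma Lc_commute:
  assumes c: "c \<odot> c = c" and z: "z \<in> V1 c \<or> z \<in> V0 c"
  shows "c \<odot> (z \<odot> v) = z \<odot> (c \<odot> v)"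
proof -
  have "2 *\<^sub>R ((c \<odot> z) \<odot> (c \<odot> v)) + c \<odot> (z \<odot> v) = 2 *\<^sub>R (c \<odot> ((c \<odot> z) \<odot> v)) + z \<odot> (c \<odot> v)"
    using jordan_quartic[of c z c v] c by (simp add: jcom[of z c] scaleR_2 algebra_simps)
  with z show ?thesis
    by (auto simp: V1_def V0_def scaleR_2)
qed

lemma peirce_orth:
  assumes "c \<odot> x = l *\<^sub>R x" "c \<odot> y = m *\<^sub>R y" "l \<noteq> m"
  shows "inner x y = 0"
proof -
  have "l * inner x y = m * inner x y"
    using jassoc_inner[of c x y] assms by simp
  with assms(3) show ?thesis by simp
qed

lemma peirce_orths:
  assumes "v1 \<in> V1 c" "vh \<in> Vh c" "v0 \<in> V0 c"
  shows "inner v1 vh = 0" "inner v1 v0 = 0" "inner vh v0 = 0"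
  using peirce_orth[of c v1 1 vh "1/2"] peirce_orth[of c v1 1 v0 0] peirce_orth[of c vh "1/2" v0 0] assms
  by (auto simp: V1_def Vh_def V0_def)

lemma peirce_1_0: 
  assumes "c \<odot> c = c" "x \<in> V1 c" "y \<in> V0 c" shows "x \<odot> y = 0"
  using Lc_commute[of c x y] Lc_commute[of c y x] assms by (simp add: V1_def V0_def jcom)

lemma peirce_1_1: 
  assumes "c \<odot> c = c" "x \<in> V1 c" "y \<in> V1 c" shows "x \<odot> y \<in> V1 c"
  using Lc_commute[of c x y] assms by (simp add: V1_def)

lemma peirce_0_0: 
  assumes "c \<odot> c = c" "x \<in> V0 c" "y \<in> V0 c" shows "x \<odot> y \<in> V0 c"
  using Lc_commute[of c x y] assms by (simp add: V0_def)

lemma peirce_10_h: 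
  assumes "c \<odot> c = c" "x \<in> V1 c \<or> x \<in> V0 c" "y \<in> Vh c" shows "x \<odot> y \<in> Vh c"
  using Lc_commute[of c x y] assms by (simp add: Vh_def jlin)

text \<open>In the quartic identity with two copies of \<open>c\<close> the quarter terms cancel.
  The conclusion has the form that defines \<open>W\<close>, without naming the components in
  \<open>V1 c\<close> and \<open>V0 c\<close>.\<close>

lemma peirce_h_h:
  assumes c: "c \<odot> c = c" and "x \<in> Vh c" "y \<in> Vh c"
  shows "c \<odot> (c \<odot> (x \<odot> y)) = c \<odot> (x \<odot> y)"
proof -
  have "(x \<odot> y) \<odot> c + (1/4) *\<^sub>R (y \<odot> x) + (1/4) *\<^sub>R (x \<odot> y) 
      = c \<odot> ((x \<odot> y) \<odot> c) + (1/4) *\<^sub>R (x \<odot> y) + (1/4) *\<^sub>R (y \<odot> x)"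
    using jordan_quartic[of x y c c] assms by (simp add: Vh_def jcom[of y c] jcom[of x c] jlin)
  thus ?thesis by (simp add: jcom)
qed

text \<open>By orthogonality the form is the squared norm of the component in \<open>V1 c\<close>
  plus half that of the component in \<open>Vh c\<close>.\<close>

lemma idem_psd:
  assumes c: "c \<odot> c = c"
  shows "inner (c \<odot> v) v \<ge> 0" "inner (c \<odot> v) v = 0 \<Longrightarrow> c \<odot> v = 0"
proof -
  obtain v1 vh v0 where v: "v = v1 + vh + v0" "v1 \<in> V1 c" "vh \<in> Vh c" "v0 \<in> V0 c"
    using peirce_obtain[OF c, of v] .
  have cv: "c \<odot> v = v1 + (1/2) *\<^sub>R vh"
    using v by (simp add: jlin V1_def Vh_def V0_def)
  have eq: "inner (c \<odot> v) v = inner v1 v1 + (1/2) * inner vh vh"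
    unfolding cv using peirce_orths[OF v(2-4)] v(1)
    by (simp add: inner_add_left inner_add_right inner_commute)
  show "inner (c \<odot> v) v \<ge> 0" unfolding eq by simp
  assume "inner (c \<odot> v) v = 0"
  hence "inner v1 v1 = 0 \<and> inner vh vh = 0"
    unfolding eq using inner_ge_zero[of v1] inner_ge_zero[of vh] by linarith
  thus "c \<odot> v = 0" unfolding cv by simp
qed

lemma idem_inner:
  assumes "p \<odot> p = p" "q \<odot> q = q"
  shows "inner p q \<ge> 0" "inner p q = 0 \<Longrightarrow> p \<odot> q = 0"
  using idem_psd[of p q] assms jassoc_inner[of p q q] jassoc_inner[of q p q]
  by (auto simp: inner_commute jcom)

lemma idem_orth_inner:
  assumes "p \<odot> p = p" "p \<odot> q = 0"
  shows "inner p q = 0"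
  using jassoc_inner[of p p q] assms by simp

end

section \<open>Spectral decomposition\<close>

lemma quadratic_le_zero_imp:
  fixes b k :: real
  assumes "\<And>t. 2 * t * b + t\<^sup>2 * k \<le> 0"
  shows "b = 0"
proof (rule ccontr)
  assume b: "b \<noteq> 0"
  define m where "m = \<bar>k\<bar> + 1"
  have m: "m > 0" "2 * m + k > 0" by (auto simp: m_def)
  have "2 * (b / m) * b + (b / m)\<^sup>2 * k = b\<^sup>2 * (2 * m + k) / m\<^sup>2"
    using m by (simp add: field_simps power2_eq_square)
  also have "\<dots> > 0" using b m by simp
  finally show False using assms[of "b / m"] by simp
qed

text \<open>Maximization of the Rayleigh quotient on the unit sphere of \<open>S\<close>.\<close>

lemma symmetric_has_eigenvector:
  fixes f :: "'a::euclidean_space \<Rightarrow> 'a"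
  assumes S: "subspace S" and d: "d \<in> S" "d \<noteq> 0" and lin: "linear f"
    and inv: "\<And>y. y \<in> S \<Longrightarrow> f y \<in> S"
    and sym: "\<And>y z. inner (f y) z = inner y (f z)"
  obtains y \<mu> where "y \<in> S" "y \<noteq> 0" "f y = \<mu> *\<^sub>R y"
proof -
  define K where "K = S \<inter> sphere 0 1"
  have "compact K" unfolding K_def
    using closed_subspace[OF S] by (simp add: closed_Int_compact)
  moreover have "(1 / norm d) *\<^sub>R d \<in> K"
    using d S by (simp add: K_def subspace_scale)
  moreover have "continuous_on K (\<lambda>y. inner (f y) y)"
    by (intro continuous_on_inner continuous_on_id linear_continuous_on)
      (use lin linear_conv_bounded_linear in blast)
  ultimately obtain y where y: "y \<in> K" and max: "\<And>z. z \<in> K \<Longrightarrow> inner (f z) z \<le> inner (f y) y"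
    using continuous_attains_sup[of K "\<lambda>y. inner (f y) y"] by blast
  define \<mu> where "\<mu> = inner (f y) y"
  have yS: "y \<in> S" and ny: "norm y = 1" using y by (auto simp: K_def)
  have ub: "inner (f z) z \<le> \<mu> * (norm z)\<^sup>2" if z: "z \<in> S" for z
  proof (cases "z = 0")
    case True
    then show ?thesis using linear_0[OF lin] by simp
  next
    case False
    have "inner (f ((1 / norm z) *\<^sub>R z)) ((1 / norm z) *\<^sub>R z) \<le> \<mu>"
      unfolding \<mu>_def using z False S by (intro max) (simp add: K_def subspace_scale)
    then show ?thesis using False
      by (simp add: linear_scale[OF lin] field_simps power2_eq_square)
  qed
  \<comment> \<open>The residual of the eigenvalue equation is also the direction of variation: the
    first-order coefficient is then \<open>inner w w\<close>.\<close>
  define w where "w = f y - \<mu> *\<^sub>R y"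
  have wS: "w \<in> S" unfolding w_def using inv[OF yS] yS S by (simp add: subspace_diff subspace_scale)
  have "2 * t * inner w w + t\<^sup>2 * (inner (f w) w - \<mu> * (norm w)\<^sup>2) \<le> 0" for t
  proof -
    have "inner (f (y + t *\<^sub>R w)) (y + t *\<^sub>R w) \<le> \<mu> * (norm (y + t *\<^sub>R w))\<^sup>2"
      by (rule ub) (use yS wS S in \<open>simp add: subspace_add subspace_scale\<close>)
    moreover have "inner (f (y + t *\<^sub>R w)) (y + t *\<^sub>R w) = \<mu> + 2 * t * inner (f y) w + t\<^sup>2 * inner (f w) w"
      using sym[of w y] by (simp add: linear_add[OF lin] linear_scale[OF lin] \<mu>_def inner_add_left
          inner_add_right inner_commute[of w "f y"] power2_eq_square algebra_simps)
    moreover have "(norm (y + t *\<^sub>R w))\<^sup>2 = 1 + 2 * t * inner y w + t\<^sup>2 * (norm w)\<^sup>2"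
    proof -
      have "inner y y = 1" using ny by (simp add: norm_eq_1)
      then show ?thesis
        unfolding power2_norm_eq_inner
        by (simp add: inner_add_left inner_add_right inner_commute[of w y] power2_eq_square algebra_simps)
    qed
    ultimately have le: "\<mu> + 2 * t * inner (f y) w + t\<^sup>2 * inner (f w) w
        \<le> \<mu> * (1 + 2 * t * inner y w + t\<^sup>2 * (norm w)\<^sup>2)" by simp
    have ww: "inner w w = inner (f y) w - \<mu> * inner y w"
      unfolding inner_scaleR_left[symmetric] inner_diff_left[symmetric] w_def ..
    show ?thesis unfolding ww using le by (simp add: algebra_simps)
  qed
  from quadratic_le_zero_imp[OF this] have "w = 0" by simp
  hence "f y = \<mu> *\<^sub>R y" unfolding w_def by (rule eq_iff_diff_eq_0[THEN iffD2])
  moreover have "y \<noteq> 0" using ny by auto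
  ultimately show thesis using that yS by blast
qed

context eja
begin

text \<open>The sum is a parameter so that a subdivision of a single member is again such a
  system.\<close>

definition osys :: "'a set \<Rightarrow> 'a \<Rightarrow> bool" where
  "osys G s \<longleftrightarrow> finite G \<and> (\<forall>g\<in>G. g \<noteq> 0 \<and> g \<odot> g = g) \<and>
     (\<forall>g\<in>G. \<forall>h\<in>G. g \<noteq> h \<longrightarrow> g \<odot> h = 0) \<and> \<Sum>G = s"

lemma osys_mult:
  assumes "osys G s" "h \<in> G" shows "s \<odot> h = h" "h \<odot> s = h"
proof -
  have "s \<odot> h = (\<Sum>g\<in>G. g \<odot> h)" using assms by (auto simp: osys_def jsum_left)
  also have "\<dots> = (\<Sum>g\<in>G. if g = h then h else 0)"
    using assms by (intro sum.cong) (auto simp: osys_def)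
  also have "\<dots> = h" using assms by (simp add: osys_def)
  finally show "s \<odot> h = h" .
  thus "h \<odot> s = h" using jcom[of h s] by simp
qed

lemma osys_idem: 
  assumes "osys G s" shows "s \<odot> s = s"
proof -
  have "s \<odot> s = s \<odot> \<Sum>G" using assms by (simp add: osys_def)
  also have "\<dots> = (\<Sum>h\<in>G. s \<odot> h)" by (rule jsum_right)
  also have "\<dots> = \<Sum>G" using osys_mult[OF assms] by simp
  finally show ?thesis using assms by (simp add: osys_def)
qed

text \<open>Distinct members are orthogonal nonzero vectors. The bound permits the later choices of
  systems of maximal cardinality.\<close>

lemma osys_card:
  assumes "osys G s" shows "card G \<le> DIM('a)"
proof -
  have "pairwise orthogonal G"
    unfolding pairwise_def orthogonal_def
    using assms idem_orth_inner by (metis osys_def)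
  hence "independent G"
    using assms by (intro pairwise_orthogonal_independent) (auto simp: osys_def)
  thus ?thesis by (rule independent_bound[THEN conjunct2])
qed

lemma idem_trans:
  assumes "h \<odot> h = h" "g \<odot> h = h" "h \<odot> c = c"
  shows "g \<odot> c = c"
proof -
  have "g - h \<in> V0 h" using assms jcom[of h g] by (simp add: V0_def jlin)
  hence "c \<odot> (g - h) = 0" using peirce_1_0[of h c "g - h"] assms by (simp add: V1_def)
  hence "(g - h) \<odot> c = 0" using jcom[of c "g - h"] by simp
  thus ?thesis using assms by (simp add: jlin)
qed

text \<open>Members of \<open>C\<close> lie in \<open>V1 h\<close>, the other members of
  \<open>G\<close> in \<open>V0 h\<close>, and these spaces annihilate each other.\<close>

lemma osys_replace:
  assumes G: "osys G s" and h: "h \<in> G" and C: "osys C h"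
  shows "osys ((G - {h}) \<union> C) s" "card ((G - {h}) \<union> C) + 1 = card G + card C"
    "(G - {h}) \<inter> C = {}"
proof -
  have hh: "h \<odot> h = h" using G h by (simp add: osys_def)
  have cz: "g \<odot> c = 0" "c \<odot> g = 0" if "g \<in> G" "g \<noteq> h" "c \<in> C" for g c
  proof -
    have "g \<in> V0 h" using G h that by (auto simp: osys_def V0_def)
    moreover have "c \<in> V1 h" using osys_mult[OF C] that by (simp add: V1_def)
    ultimately show "c \<odot> g = 0" using peirce_1_0[OF hh] by blast
    thus "g \<odot> c = 0" using jcom[of g c] by simp
  qed
  show dis: "(G - {h}) \<inter> C = {}"
    using cz G by (auto simp: osys_def) metis
  have fin: "finite G" "finite C" using G C by (auto simp: osys_def)
  have "\<Sum>((G - {h}) \<union> C) = \<Sum>(G - {h}) + h"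
    using fin dis C by (subst sum.union_disjoint) (auto simp: osys_def)
  also have "\<dots> = s" using fin h G by (simp add: osys_def sum.remove[of G h] add.commute)
  finally show "osys ((G - {h}) \<union> C) s"
    using G C cz by (auto simp: osys_def)
  show "card ((G - {h}) \<union> C) + 1 = card G + card C"
    using fin dis h by (simp add: card_Un_disjoint card_Diff_singleton) (metis Suc_pred card_gt_0_iff empty_iff)
qed

lemma osys_split:
  assumes "p \<odot> p = p" "q \<odot> q = q" "p \<noteq> 0" "q \<noteq> 0" "c \<odot> c = c" "c = p + q"
  shows "osys {p, q} c" "p \<noteq> q"
proof -
  have "p \<odot> q + q \<odot> p = 0" using assms by (simp add: jlin add.commute)
  hence "2 *\<^sub>R (p \<odot> q) = 0" using jcom[of p q] by (simp add: scaleR_2)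
  hence "p \<odot> q = 0" "q \<odot> p = 0" using jcom[of p q] by simp_all
  moreover from this show "p \<noteq> q" using assms by auto
  ultimately show "osys {p, q} c" using assms by (simp add: osys_def)
qed

section \<open>The associative subalgebra generated by one element\<close>

context
  fixes g v :: 'a
  assumes gg: "g \<odot> g = g" and v: "g \<odot> v = v"
begin

text \<open>Powers of \<open>v\<close> within \<open>V1 g\<close>, whose unit is \<open>g\<close>;
  hence the zeroth power is \<open>g\<close> and not \<open>e\<close>.\<close>

definition jpow :: "nat \<Rightarrow> 'a" where "jpow n = ((\<lambda>w. v \<odot> w) ^^ n) g"

lemma jpow_simps: "jpow 0 = g" "jpow (Suc n) = v \<odot> jpow n"
  by (simp_all add: jpow_def)

lemma jpow_1: "jpow (Suc 0) = v"
  unfolding jpow_simps jcom[of v g] by (rule v)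

lemma jpow_V1: "g \<odot> jpow n = jpow n"
proof (induction n)
  case 0 show ?case by (simp add: jpow_simps gg)
next
  case (Suc n)
  then show ?case using peirce_1_1[OF gg, of v "jpow n"] v by (simp add: V1_def jpow_simps)
qed

text \<open>Two-step induction: \<open>jordan_L2\<close> expresses multiplication by a power through
  multiplications by \<open>v\<close>, \<open>v \<odot> v\<close> and the two preceding powers, all
  of which commute with multiplication by \<open>v\<close>.\<close>

lemma jpow_commute: "v \<odot> (jpow n \<odot> w) = jpow n \<odot> (v \<odot> w)"
proof (induction n arbitrary: w rule: less_induct)
  case (less n)
  consider "n = 0" | "n = 1" | k where "n = Suc (Suc k)"
    by (metis One_nat_def old.nat.exhaust)
  then show ?case
  proof cases
    case 1
    then show ?thesis using Lc_commute[OF gg, of v w] v by (simp add: V1_def jpow_simps)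
  next
    case 2
    then show ?thesis by (simp add: jpow_1)
  next
    case 3
    define p q s where "p = jpow k" and "q = jpow (Suc k)" and "s = v \<odot> v"
    have p: "v \<odot> (p \<odot> w) = p \<odot> (v \<odot> w)" and q: "v \<odot> (q \<odot> w) = q \<odot> (v \<odot> w)" for w
      using less[of k] less[of "Suc k"] 3 by (simp_all add: p_def q_def)
    have s: "v \<odot> (s \<odot> w) = s \<odot> (v \<odot> w)" for w
      using jordan[of v w] jcom[of w s] jcom[of "v \<odot> w" s] by (simp add: s_def)
    have e: "jpow n \<odot> w = v \<odot> (q \<odot> w) + p \<odot> (s \<odot> w) + v \<odot> (q \<odot> w) - p \<odot> (v \<odot> (v \<odot> w)) - v \<odot> (v \<odot> (p \<odot> w))" for w
      using jordan_L2[of v p v w] jcom[of p v] 3 by (simp add: jpow_simps p_def q_def s_def)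
    show ?thesis unfolding e jlin p q s by simp
  qed
qed

definition jpow_span where "jpow_span = span (range jpow)"

lemma jpow_span_subspace: "subspace jpow_span" by (simp add: jpow_span_def)

lemma jpow_span_g: "g \<in> jpow_span" unfolding jpow_span_def using jpow_simps(1) by (metis rangeI span_base)

lemma jpow_span_commute: "u \<in> jpow_span \<Longrightarrow> v \<odot> (u \<odot> w) = u \<odot> (v \<odot> w)"
  unfolding jpow_span_def
  by (induction rule: span_induct_alt) (auto simp: jlin jpow_commute)

lemma jpow_span_unit: "u \<in> jpow_span \<Longrightarrow> g \<odot> u = u"
  unfolding jpow_span_def
  by (induction rule: span_induct_alt) (auto simp: jlin jpow_V1)

lemma jpow_span_v: "u \<in> jpow_span \<Longrightarrow> v \<odot> u \<in> jpow_span"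
  unfolding jpow_span_def
proof (induction rule: span_induct_alt)
  case base show ?case by (simp add: span_zero)
next
  case (step c x y)
  then obtain n where "x = jpow n" by auto
  hence "v \<odot> x \<in> span (range jpow)" by (metis jpow_simps(2) rangeI span_base)
  with step show ?case by (simp add: jlin span_add span_scale)
qed

lemma jpow_Suc_mult: "u \<in> jpow_span \<Longrightarrow> jpow (Suc n) \<odot> u = v \<odot> (jpow n \<odot> u)"
proof -
  have *: "jpow m \<odot> jpow k = jpow (m + k)" for m k
  proof (induction k)
    case 0 show ?case using jpow_V1[of m] jcom[of g "jpow m"] by (simp add: jpow_simps)
  next
    case (Suc k)
    then show ?case using jpow_commute[of m "jpow k"] by (simp add: jpow_simps)
  qed
  assume "u \<in> jpow_span"
  then show ?thesis unfolding jpow_span_def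
  proof (induction rule: span_induct_alt)
    case base show ?case by simp
  next
    case (step c x y)
    then obtain k where "x = jpow k" by auto
    with step show ?case by (simp add: jlin *) (simp add: jpow_simps)
  qed
qed

text \<open>Powers of \<open>v\<close> act on \<open>y\<close> by powers of \<mu>. With
  \<open>u = y\<close> this says that \<open>y\<close> squares to a multiple of itself and can be
  rescaled to an idempotent.\<close>

lemma jpow_span_eigen:
  assumes y: "y \<in> jpow_span" "v \<odot> y = \<mu> *\<^sub>R y" and u: "u \<in> jpow_span"
  shows "\<exists>r. u \<odot> y = r *\<^sub>R y"
proof -
  have *: "jpow n \<odot> y = \<mu> ^ n *\<^sub>R y" for n
    by (induction n) (use y jpow_span_unit in \<open>simp_all add: jpow_simps(1) jpow_Suc_mult jlin\<close>)
  show ?thesis using u unfolding jpow_span_def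
  proof (induction rule: span_induct_alt)
    case base show ?case by (intro exI[of _ 0]) simp
  next
    case (step c x w)
    then obtain k r where "x = jpow k" "w \<odot> y = r *\<^sub>R y" by auto
    hence "(c *\<^sub>R x + w) \<odot> y = (c * \<mu> ^ k + r) *\<^sub>R y"
      by (simp add: jlin * scaleR_add_left)
    then show ?case by blast
  qed
qed

text \<open>A maximal family of orthogonal eigen-idempotents in the generated subalgebra exhausts
  \<open>g\<close>: on a nonzero remainder \<open>d\<close>, multiplication by \<open>v\<close>
  still has an eigenvector, which rescales to a further idempotent.\<close>

lemma local_spectral:
  obtains C \<mu> where "osys C g" "\<And>c. c \<in> C \<Longrightarrow> v \<odot> c = \<mu> c *\<^sub>R c"
proof -
  define P where "P = (\<lambda>C. osys C (\<Sum>C) \<and> C \<subseteq> jpow_span \<and> (\<forall>c\<in>C. \<exists>\<mu>. v \<odot> c = \<mu> *\<^sub>R c))"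
  have "P {}" by (simp add: P_def osys_def)
  moreover have "\<forall>C. P C \<longrightarrow> card C < Suc DIM('a)"
    using osys_card by (auto simp: P_def less_Suc_eq_le)
  ultimately obtain C where C: "P C" and max: "\<And>D. P D \<Longrightarrow> card D \<le> card C"
    using ex_has_greatest_nat[of P "{}" card "Suc DIM('a)"] by blast
  define d where "d = g - \<Sum>C"
  have CU: "C \<subseteq> jpow_span" and os: "osys C (\<Sum>C)" and finC: "finite C" using C by (auto simp: P_def osys_def)
  have gC: "g \<odot> \<Sum>C = \<Sum>C" "\<Sum>C \<odot> g = \<Sum>C"
  proof -
    show "g \<odot> \<Sum>C = \<Sum>C" unfolding jsum_right using jpow_span_unit CU by (intro sum.cong) auto
    thus "\<Sum>C \<odot> g = \<Sum>C" using jcom[of g "\<Sum>C"] by simp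
  qed
  have dd: "d \<odot> d = d" using gC gg osys_idem[OF os] by (simp add: d_def jlin)
  have dU: "d \<in> jpow_span" unfolding d_def using CU jpow_span_subspace jpow_span_g
    by (intro subspace_diff subspace_sum) auto
  have cd: "d \<odot> c = 0" if "c \<in> C" for c
    using jpow_span_unit[of c] osys_mult[OF os that] that CU by (auto simp: d_def jlin)
  have "d = 0"
  proof (rule ccontr)
    assume d0: "d \<noteq> 0"
    define S where "S = {y \<in> jpow_span. d \<odot> y = y}"
    have "subspace S"
      unfolding S_def using jpow_span_subspace by (auto simp: subspace_def jlin)
    moreover have "d \<in> S" using dU dd by (simp add: S_def)
    moreover have "v \<odot> y \<in> S" if "y \<in> S" for y
      using that jpow_span_v jpow_span_commute[OF dU, of y] by (auto simp: S_def)
    ultimately obtain y \<mu> where y: "y \<in> S" "y \<noteq> 0" "v \<odot> y = \<mu> *\<^sub>R y"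
      using symmetric_has_eigenvector[of S d "\<lambda>y. v \<odot> y"] d0 jlinear jassoc_inner by metis
    have yU: "y \<in> jpow_span" and dy: "d \<odot> y = y" using y by (auto simp: S_def)
    obtain r where r: "y \<odot> y = r *\<^sub>R y" using jpow_span_eigen[OF yU y(3) yU] by blast
    \<comment> \<open>Pairing \<open>y \<odot> y\<close> with \<open>e\<close> gives the squared
      norm of \<open>y\<close>, so \<open>y\<close> cannot square to zero.\<close>
    have "r \<noteq> 0"
    proof
      assume "r = 0"
      hence "inner (y \<odot> y) e = 0" using r by simp
      hence "inner y y = 0" using jassoc_inner[of y y e] by simp
      thus False using y by simp
    qed
    define c where "c = (1 / r) *\<^sub>R y"
    have c: "c \<odot> c = c" "c \<noteq> 0" "c \<in> jpow_span" "v \<odot> c = \<mu> *\<^sub>R c" "d \<odot> c = c"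
      using \<open>r \<noteq> 0\<close> r y yU dy jpow_span_subspace by (auto simp: c_def jlin subspace_scale)
    have cz: "c \<odot> b = 0" "b \<odot> c = 0" if "b \<in> C" for b
    proof -
      show "c \<odot> b = 0" using peirce_1_0[OF dd, of c b] c cd[OF that] by (simp add: V1_def V0_def)
      thus "b \<odot> c = 0" using jcom[of b c] by simp
    qed
    hence "c \<notin> C" using c by metis
    have "P (insert c C)"
      using C c cz by (auto simp: P_def osys_def)
    with max[of "insert c C"] \<open>c \<notin> C\<close> finC show False by simp
  qed
  hence "osys C g" using os by (simp add: d_def)
  moreover obtain \<mu> where "\<And>c. c \<in> C \<Longrightarrow> v \<odot> c = \<mu> c *\<^sub>R c"
    using C unfolding P_def by metis
  ultimately show thesis using that by blast
qed

end

text \<open>The elements whose Peirce component for the eigenvalue \<open>1/2\<close> vanishes for every \<open>g \<in> G\<close>.\<close>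

definition W :: "'a set \<Rightarrow> 'a set" where
  "W G = {x. \<forall>g\<in>G. g \<odot> (g \<odot> x) = g \<odot> x}"

lemma W_peirce_eq:
  assumes gg: "g \<odot> g = g"
  shows "g \<odot> (g \<odot> x) = g \<odot> x \<longleftrightarrow> (\<exists>x1\<in>V1 g. \<exists>x0\<in>V0 g. x = x1 + x0)"
proof
  assume "g \<odot> (g \<odot> x) = g \<odot> x"
  hence "g \<odot> x \<in> V1 g" "x - g \<odot> x \<in> V0 g" by (auto simp: V1_def V0_def jlin)
  thus "\<exists>x1\<in>V1 g. \<exists>x0\<in>V0 g. x = x1 + x0" by (metis add.commute diff_add_cancel)
next
  assume "\<exists>x1\<in>V1 g. \<exists>x0\<in>V0 g. x = x1 + x0"
  thus "g \<odot> (g \<odot> x) = g \<odot> x" by (auto simp: V1_def V0_def jlin)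
qed

text \<open>The rest \<open>x - h \<odot> x\<close> lies in \<open>V0 h\<close> and annihilates
  \<open>V1 h\<close>.\<close>

lemma W_restrict:
  assumes hh: "h \<odot> h = h" and x: "h \<odot> (h \<odot> x) = h \<odot> x" and c: "h \<odot> c = c"
  shows "x \<odot> c = (h \<odot> x) \<odot> c"
proof -
  have "c \<odot> (x - h \<odot> x) = 0"
    using peirce_1_0[OF hh, of c "x - h \<odot> x"] x c by (simp add: V1_def V0_def jlin)
  thus ?thesis using jcom[of c x] jcom[of c "h \<odot> x"] by (simp add: jlin)
qed

text \<open>\<open>G\<close> is refined as far as possible while \<open>x\<close> stays block
  diagonal. No member of the result splits into eigenvectors of \<open>x\<close>, so
  \<open>local_spectral\<close> is trivial on each member; since \<open>x\<close> is then a scalar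
  there, any decomposition of a member would be such a splitting, whence primitivity.\<close>

theorem refine_diag:
  assumes G: "osys G e" and x: "x \<in> W G"
  obtains H \<xi> where "osys H e" "\<And>h. h \<in> H \<Longrightarrow> primitive_idempotent jp h"
    "\<And>h. h \<in> H \<Longrightarrow> x \<odot> h = \<xi> h *\<^sub>R h" "\<And>h. h \<in> H \<Longrightarrow> \<exists>g\<in>G. g \<odot> h = h"
proof -
  define P where "P = (\<lambda>H. osys H e \<and> x \<in> W H \<and> (\<forall>h\<in>H. \<exists>g\<in>G. g \<odot> h = h))"
  have "P G" using G x by (auto simp: P_def osys_def)
  moreover have "\<forall>C. P C \<longrightarrow> card C < Suc DIM('a)"
    using osys_card by (auto simp: P_def less_Suc_eq_le)
  ultimately obtain H where H: "P H" and max: "\<And>D. P D \<Longrightarrow> card D \<le> card H"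
    using ex_has_greatest_nat[of P G card "Suc DIM('a)"] by blast
  have oH: "osys H e" using H by (simp add: P_def)
  have key: "card C \<le> 1" if h: "h \<in> H" and C: "osys C h" and xc: "\<And>c. c \<in> C \<Longrightarrow> x \<odot> c = \<mu> c *\<^sub>R c"
    for h C and \<mu> :: "'a \<Rightarrow> real"
  proof -
    have hh: "h \<odot> h = h" using oH h by (simp add: osys_def)
    have "P ((H - {h}) \<union> C)"
      unfolding P_def
    proof (intro conjI ballI)
      show "osys ((H - {h}) \<union> C) e" by (rule osys_replace[OF oH h C])
      show "x \<in> W ((H - {h}) \<union> C)"
        unfolding W_def
      proof (intro CollectI ballI)
        fix c assume "c \<in> (H - {h}) \<union> C"
        thus "c \<odot> (c \<odot> x) = c \<odot> x"
        proof
          assume "c \<in> H - {h}" thus ?thesis using H by (simp add: P_def W_def)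
        next
          assume c: "c \<in> C"
          hence "c \<odot> x = \<mu> c *\<^sub>R c" "c \<odot> c = c" using xc[OF c] jcom[of c x] C by (auto simp: osys_def)
          thus ?thesis by (simp add: jlin)
        qed
      qed
    next
      fix c assume "c \<in> (H - {h}) \<union> C"
      thus "\<exists>g\<in>G. g \<odot> c = c"
      proof
        assume "c \<in> H - {h}" thus ?thesis using H by (simp add: P_def)
      next
        assume c: "c \<in> C"
        obtain g where "g \<in> G" "g \<odot> h = h" using H h by (auto simp: P_def)
        thus ?thesis using idem_trans[OF hh, of g c] osys_mult[OF C c] by blast
      qed
    qed
    from max[OF this] osys_replace(2)[OF oH h C] show ?thesis by linarith
  qed
  have diag: "\<exists>\<mu>. x \<odot> h = \<mu> *\<^sub>R h" if h: "h \<in> H" for h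
  proof -
    have hh: "h \<odot> h = h" "h \<noteq> 0" using oH h by (auto simp: osys_def)
    have xW: "h \<odot> (h \<odot> x) = h \<odot> x" using H h by (simp add: P_def W_def)
    obtain C \<mu> where C: "osys C h" "\<And>c. c \<in> C \<Longrightarrow> (h \<odot> x) \<odot> c = \<mu> c *\<^sub>R c"
      using local_spectral[OF hh(1) xW] by blast
    have xc: "x \<odot> c = \<mu> c *\<^sub>R c" if "c \<in> C" for c
      using W_restrict[OF hh(1) xW, of c] C(2)[OF that] osys_mult[OF C(1) that] by simp
    have "card C \<le> 1" by (rule key[OF h C(1) xc])
    moreover have "C \<noteq> {}" "finite C" using C(1) hh by (auto simp: osys_def)
    ultimately have "card C = 1" by (simp add: card_gt_0_iff le_antisym Suc_leI)
    then obtain c where "C = {c}" by (auto simp: card_1_singleton_iff)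
    with C(1) xc show ?thesis by (auto simp: osys_def)
  qed
  then obtain \<xi> where \<xi>: "\<And>h. h \<in> H \<Longrightarrow> x \<odot> h = \<xi> h *\<^sub>R h" by metis
  have "primitive_idempotent jp h" if h: "h \<in> H" for h
  proof -
    have hh: "h \<odot> h = h" "h \<noteq> 0" using oH h by (auto simp: osys_def)
    have hx: "h \<odot> x = \<xi> h *\<^sub>R h" using \<xi>[OF h] jcom[of h x] by simp
    have False if pq: "p \<noteq> 0" "q \<noteq> 0" "p \<odot> p = p" "q \<odot> q = q" "h = p + q" for p q
    proof -
      have os: "osys {p, q} h" and "p \<noteq> q" using osys_split[of p q h] pq hh by auto
      have "x \<odot> c = \<xi> h *\<^sub>R c" if "c \<in> {p, q}" for c
        using W_restrict[OF hh(1), of x c] osys_mult[OF os that] hx hh by (simp add: jlin)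
      from key[OF h os this] \<open>p \<noteq> q\<close> show False by simp
    qed
    thus ?thesis using hh unfolding primitive_idempotent_def idempotent_def by blast
  qed
  with that[OF oH _ \<xi>] H show thesis by (auto simp: P_def)
qed

lemma spectral_decomposition:
  obtains H \<xi> where "osys H e" "\<And>h. h \<in> H \<Longrightarrow> primitive_idempotent jp h"
    "\<And>h. h \<in> H \<Longrightarrow> x \<odot> h = \<xi> h *\<^sub>R h"
proof -
  have "osys {e} e" "x \<in> W {e}" using unit_nonzero by (auto simp: osys_def W_def)
  thus thesis using refine_diag that by metis
qed

text \<open>The spectral idempotents of \<open>v\<close> under \<open>c\<close> sum to
  \<open>c\<close>, and primitivity leaves room for only one.\<close>

lemma primitive_V1:
  assumes c: "primitive_idempotent jp c" and v: "c \<odot> v = v"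
  obtains r where "v = r *\<^sub>R c"
proof -
  have cc: "c \<odot> c = c" "c \<noteq> 0" using c by (auto simp: primitive_idempotent_def idempotent_def)
  obtain C \<mu> where C: "osys C c" "\<And>d. d \<in> C \<Longrightarrow> v \<odot> d = \<mu> d *\<^sub>R d"
    using local_spectral[OF cc(1) v] by blast
  have fin: "finite C" using C by (simp add: osys_def)
  have "C \<noteq> {}" using C cc by (auto simp: osys_def)
  then obtain p where p: "p \<in> C" by blast
  define q where "q = \<Sum>(C - {p})"
  have cpq: "c = p + q" using C(1) p fin by (simp add: osys_def q_def sum.remove[of C p])
  have pp: "p \<odot> p = p" "p \<noteq> 0" using C(1) p by (auto simp: osys_def)
  have "c \<odot> p = p" "p \<odot> c = p" using osys_mult[OF C(1) p] by auto
  hence "p \<odot> q = 0" "q \<odot> p = 0" using cpq pp by (auto simp: jlin)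
  hence "q \<odot> q = q" using cc(1) pp cpq by (simp add: jlin)
  hence "q = 0" using c cpq pp unfolding primitive_idempotent_def idempotent_def by blast
  hence "c = p" using cpq by simp
  hence "v \<odot> c = \<mu> c *\<^sub>R c" using C(2)[OF p] by simp
  thus thesis using that[of "\<mu> c"] v jcom[of c v] by simp
qed

end

section \<open>Frames in simple algebras\<close>

locale simple_euclidean_jordan = eja +
  assumes simple: "simple_eja jp e"
begin

text \<open>Jordan frames as sets; an enumeration matters only once eigenvalues are listed in order.
  See \<open>jordan_frame_iff\<close>.\<close>

definition frame :: "'a set \<Rightarrow> bool" where
  "frame H \<longleftrightarrow> osys H e \<and> (\<forall>h\<in>H. primitive_idempotent jp h)"

lemma primD:
  assumes "primitive_idempotent jp c" shows "c \<odot> c = c" "c \<noteq> 0"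
  using assms by (auto simp: primitive_idempotent_def idempotent_def)

lemma frameD:
  assumes "frame H"
  shows "finite H" "osys H e" "\<And>h. h \<in> H \<Longrightarrow> primitive_idempotent jp h"
    "\<And>h. h \<in> H \<Longrightarrow> h \<odot> h = h" "\<And>h. h \<in> H \<Longrightarrow> h \<noteq> 0"
    "\<And>g h. g \<in> H \<Longrightarrow> h \<in> H \<Longrightarrow> g \<noteq> h \<Longrightarrow> g \<odot> h = 0" "\<Sum>H = e"
  using assms by (auto simp: frame_def osys_def)

lemma osys_subset: "osys G s \<Longrightarrow> I \<subseteq> G \<Longrightarrow> osys I (\<Sum>I)"
  using finite_subset[of I G] unfolding osys_def by blast

section \<open>Off-diagonal Peirce spaces and simplicity\<close>

lemma Vij_other:
  assumes H: "osys H s" and ijk: "i \<in> H" "j \<in> H" "k \<in> H" "i \<noteq> j" "k \<noteq> i" "k \<noteq> j"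
    and u: "u \<in> Vh i" "u \<in> Vh j"
  shows "k \<odot> u = 0" "u \<odot> k = 0"
proof -
  have *: "i \<odot> j = 0" "j \<odot> i = 0" "i \<odot> k = 0" "j \<odot> k = 0" "i \<odot> i = i" "j \<odot> j = j"
    using H ijk by (auto simp: osys_def)
  have "(i + j) \<odot> (i + j) = i + j" using * by (simp add: jlin)
  moreover have "u \<in> V1 (i + j)" using u by (simp add: V1_def Vh_def jlin flip: scaleR_add_left)
  moreover have "k \<in> V0 (i + j)" using * by (simp add: V0_def jlin)
  ultimately show "u \<odot> k = 0" by (rule peirce_1_0)
  thus "k \<odot> u = 0" using jcom[of k u] by simp
qed

text \<open>By primitivity the diagonal components of \<open>u \<odot> u\<close> are multiples of
  \<open>i\<close> and \<open>j\<close>. The Jordan identity makes the two coefficients agree, and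
  pairing with \<open>i\<close> and \<open>j\<close> then equates their norms.\<close>

lemma Vij_square:
  assumes i: "primitive_idempotent jp i" and j: "primitive_idempotent jp j" and ij: "i \<odot> j = 0"
    and u: "u \<in> Vh i" "u \<in> Vh j" "u \<noteq> 0"
  obtains \<alpha> where "\<alpha> > 0" "u \<odot> u = \<alpha> *\<^sub>R (i + j)" "inner i i = inner j j" "2 * \<alpha> * inner i i = inner u u"
proof -
  have ii: "i \<odot> i = i" "i \<noteq> 0" and jj: "j \<odot> j = j" "j \<noteq> 0" using primD[OF i] primD[OF j] by auto
  have ji: "j \<odot> i = 0" using ij jcom[of i j] by simp
  define s where "s = u \<odot> u"
  have iu: "i \<odot> u = (1/2) *\<^sub>R u" and ju: "j \<odot> u = (1/2) *\<^sub>R u" using u by (auto simp: Vh_def)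
  obtain \<alpha> where \<alpha>: "i \<odot> s = \<alpha> *\<^sub>R i"
    using primitive_V1[OF i, of "i \<odot> s"] peirce_h_h[OF ii(1) u(1) u(1)] unfolding s_def by blast
  obtain \<beta> where \<beta>: "j \<odot> s = \<beta> *\<^sub>R j"
    using primitive_V1[OF j, of "j \<odot> s"] peirce_h_h[OF jj(1) u(2) u(2)] unfolding s_def by blast
  have p: "(i + j) \<odot> (i + j) = i + j" using ii jj ij ji by (simp add: jlin)
  have "u \<in> V1 (i + j)" using iu ju by (simp add: V1_def jlin flip: scaleR_add_left)
  hence "s \<in> V1 (i + j)" unfolding s_def using peirce_1_1[OF p] by blast
  hence s: "s = \<alpha> *\<^sub>R i + \<beta> *\<^sub>R j" using \<alpha> \<beta> by (simp add: V1_def jlin)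
  have "\<alpha> * inner i i = inner (i \<odot> s) i" using \<alpha> by simp
  also have "\<dots> = inner s i" using jassoc_inner[of i s i] ii by simp
  also have "\<dots> = inner u (u \<odot> i)" unfolding s_def by (rule jassoc_inner)
  finally have a2: "2 * \<alpha> * inner i i = inner u u" using iu jcom[of u i] by simp
  have "\<beta> * inner j j = inner (j \<odot> s) j" using \<beta> by simp
  also have "\<dots> = inner s j" using jassoc_inner[of j s j] jj by simp
  also have "\<dots> = inner u (u \<odot> j)" unfolding s_def by (rule jassoc_inner)
  finally have b2: "2 * \<beta> * inner j j = inner u u" using ju jcom[of u j] by simp
  have "\<alpha> > 0"
  proof (rule ccontr)
    assume "\<not> \<alpha> > 0"
    hence "\<alpha> * inner i i \<le> 0" by (simp add: mult_nonpos_nonneg)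
    with a2 have "inner u u \<le> 0" by simp
    with inner_gt_zero_iff[THEN iffD2, OF u(3)] show False by linarith
  qed
  \<comment> \<open>Since \<open>u \<odot> s\<close> is a multiple of \<open>u\<close>, comparing
    \<open>s \<odot> s\<close> with \<open>u \<odot> (u \<odot> s)\<close> in the \<open>i\<close>
    coordinate yields \<alpha> = \<beta>.\<close>
  have "u \<odot> s = ((\<alpha> + \<beta>) / 2) *\<^sub>R u"
    using iu ju jcom[of u i] jcom[of u j] by (simp add: s jlin flip: scaleR_add_left)
  hence "s \<odot> s = ((\<alpha> + \<beta>) / 2) *\<^sub>R s"
    using jordan[of u u] by (simp add: s_def jlin)
  hence "i \<odot> (s \<odot> s) = ((\<alpha> + \<beta>) / 2) *\<^sub>R (i \<odot> s)" by (simp add: jlin)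
  moreover have "i \<odot> (s \<odot> s) = \<alpha>\<^sup>2 *\<^sub>R i"
    unfolding s using ii jj ij ji by (simp add: jlin power2_eq_square)
  ultimately have "\<alpha>\<^sup>2 = ((\<alpha> + \<beta>) / 2) * \<alpha>" using \<alpha> ii by simp
  hence "\<alpha> = \<beta>" using \<open>\<alpha> > 0\<close> by (simp add: power2_eq_square)
  have "2 * \<alpha> * inner i i = 2 * \<alpha> * inner j j" using a2 b2 \<open>\<alpha> = \<beta>\<close> by simp
  hence "inner i i = inner j j" using \<open>\<alpha> > 0\<close> by simp
  thus thesis
    using that[of \<alpha>] \<open>\<alpha> > 0\<close> a2 s \<open>\<alpha> = \<beta>\<close> by (simp add: s_def scaleR_add_right)
qed

text \<open>The quartic identity gives
  \<open>u \<odot> (u \<odot> v) = (\<alpha> / 4) *\<^sub>R v\<close> with positive \<alpha>, so the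
  product cannot vanish.\<close>

lemma Vij_trans:
  assumes H: "frame H" and ijk: "i \<in> H" "j \<in> H" "k \<in> H" "i \<noteq> j" "i \<noteq> k" "j \<noteq> k"
    and u: "u \<in> Vh i" "u \<in> Vh j" "u \<noteq> 0" and v: "v \<in> Vh j" "v \<in> Vh k" "v \<noteq> 0"
  shows "u \<odot> v \<in> Vh i" "u \<odot> v \<in> Vh k" "u \<odot> v \<noteq> 0"
proof -
  note F = frameD[OF H]
  have vi: "i \<odot> v = 0" using Vij_other[OF F(2), of j k i v] ijk v by auto
  have uk: "k \<odot> u = 0" using Vij_other[OF F(2), of i j k u] ijk u by auto
  show wi: "u \<odot> v \<in> Vh i"
    using peirce_10_h[OF F(4), of i v u] ijk u vi jcom[of u v] by (simp add: V0_def)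
  show wk: "u \<odot> v \<in> Vh k"
    using peirce_10_h[OF F(4), of k u v] ijk v uk by (simp add: V0_def)
  have wj: "(u \<odot> v) \<odot> j = 0" using Vij_other[OF F(2), of i k j "u \<odot> v"] ijk wi wk by auto
  obtain \<alpha> where \<alpha>: "\<alpha> > 0" "u \<odot> u = \<alpha> *\<^sub>R (i + j)"
    using Vij_square[OF F(3) F(3) F(6), of i j u] ijk u by metis
  have ju: "u \<odot> j = (1/2) *\<^sub>R u" "v \<odot> j = (1/2) *\<^sub>R v" "j \<odot> v = (1/2) *\<^sub>R v"
    using u v jcom[of j u] jcom[of j v] by (auto simp: Vh_def)
  have u2v: "(u \<odot> u) \<odot> v = (\<alpha>/2) *\<^sub>R v" using \<alpha> vi ju by (simp add: jlin)
  have u2j: "v \<odot> ((u \<odot> u) \<odot> j) = (\<alpha>/2) *\<^sub>R v" 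
    using \<alpha> F(6)[of i j] F(4)[of j] ijk ju by (simp add: jlin)
  have "(u \<odot> v) \<odot> (u \<odot> j) + (v \<odot> u) \<odot> (u \<odot> j) + (u \<odot> u) \<odot> (v \<odot> j)
      = u \<odot> ((u \<odot> v) \<odot> j) + u \<odot> ((v \<odot> u) \<odot> j) + v \<odot> ((u \<odot> u) \<odot> j)"
    by (rule jordan_quartic)
  hence eq: "u \<odot> (u \<odot> v) + (\<alpha>/4) *\<^sub>R v = (\<alpha>/2) *\<^sub>R v"
    using wj ju u2v u2j jcom[of v u] jcom[of "u \<odot> v" u]
    by (simp add: jlin flip: scaleR_add_left)
  show "u \<odot> v \<noteq> 0"
  proof
    assume "u \<odot> v = 0"
    with eq have "(\<alpha>/4) *\<^sub>R v = (\<alpha>/2) *\<^sub>R v" by simp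
    with v(3) \<alpha>(1) show False by simp
  qed
qed

lemma LiLj_Vh:
  assumes ii: "i \<odot> i = i" and ij: "i \<odot> j = 0"
  shows "i \<odot> (j \<odot> v) \<in> Vh i"
proof -
  obtain v1 vh v0 where v: "v = v1 + vh + v0" "v1 \<in> V1 i" "vh \<in> Vh i" "v0 \<in> V0 i"
    using peirce_obtain[OF ii, of v] .
  have j: "j \<in> V0 i" using ij by (simp add: V0_def)
  have "j \<odot> v1 = 0" using peirce_1_0[OF ii v(2) j] jcom[of j v1] by simp
  moreover have "j \<odot> vh \<in> Vh i" using peirce_10_h[OF ii _ v(3), of j] j by blast
  moreover have "j \<odot> v0 \<in> V0 i" using peirce_0_0[OF ii j v(4)] .
  ultimately show ?thesis unfolding v(1) by (simp add: Vh_def V0_def jlin)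
qed

text \<open>On \<open>Vh p\<close> both \<open>p\<close> and \<open>e - p\<close> act as one half,
  so their composite is a quarter of the identity; expanded over \<open>I\<close> and
  \<open>J\<close>, each of its terms lands in \<open>Vh i \<inter> Vh j\<close>.\<close>

lemma Vh_sum_of_idems:
  assumes I: "osys I p" and J: "osys J (e - p)" and v: "v \<in> Vh p"
    and 0: "\<And>i j. i \<in> I \<Longrightarrow> j \<in> J \<Longrightarrow> Vh i \<inter> Vh j \<subseteq> {0}"
    and IJ: "\<And>i j. i \<in> I \<Longrightarrow> j \<in> J \<Longrightarrow> i \<odot> j = 0"
  shows "v = 0"
proof -
  have z: "i \<odot> (j \<odot> v) = 0" if "i \<in> I" "j \<in> J" for i j
  proof -
    have ii: "i \<odot> i = i" "j \<odot> j = j" using I J that by (auto simp: osys_def)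
    have ij: "i \<odot> j = 0" "j \<odot> i = 0" using IJ[OF that] jcom[of i j] by auto
    have "i \<odot> (j \<odot> v) = j \<odot> (i \<odot> v)"
      using Lc_commute[OF ii(1), of j v] ij by (simp add: V0_def)
    with LiLj_Vh[of i j v] LiLj_Vh[of j i v] ii ij 0[OF that] show ?thesis by auto
  qed
  have "p \<odot> ((e - p) \<odot> v) = (1/4) *\<^sub>R v" 
    using v by (simp add: Vh_def jlin scaleR_diff_right[symmetric] flip: scaleR_left_diff_distrib)
  moreover have "p \<odot> ((e - p) \<odot> v) = 0"
  proof -
    have "p \<odot> ((e - p) \<odot> v) = (\<Sum>i\<in>I. i) \<odot> ((\<Sum>j\<in>J. j) \<odot> v)"
      using I J by (simp add: osys_def)
    also have "\<dots> = (\<Sum>i\<in>I. \<Sum>j\<in>J. i \<odot> (j \<odot> v))"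
      unfolding jsum_left jsum_right by (rule sum.swap)
    also have "\<dots> = 0" using z by simp
    finally show ?thesis .
  qed
  ultimately show ?thesis by simp
qed

text \<open>Without a half space the algebra is the orthogonal product of \<open>V1 p\<close>, with
  unit \<open>p\<close>, and \<open>V0 p\<close>, with unit \<open>e - p\<close>. Simplicity is
  invoked at this point.\<close>

lemma peirce_direct_product:
  assumes pp: "p \<odot> p = p" and h: "Vh p \<subseteq> {0}"
  shows "p = 0 \<or> p = e"
proof (rule ccontr)
  assume ne: "\<not> (p = 0 \<or> p = e)"
  have A: "euclidean_jordan_algebra (V1 p) jp p"
  proof unfold_locales
    show "subspace (V1 p)" by (auto simp: subspace_def V1_def jlin)
    show "x \<odot> y \<in> V1 p" if "x \<in> V1 p" "y \<in> V1 p" for x y using peirce_1_1[OF pp that] .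
    show "p \<in> V1 p" using pp by (simp add: V1_def)
    show "x \<odot> p = x" if "x \<in> V1 p" for x using that jcom[of x p] by (simp add: V1_def)
  qed (use jcom jordan jassoc_inner in \<open>simp_all add: jlin\<close>)
  have B: "euclidean_jordan_algebra (V0 p) jp (e - p)"
  proof unfold_locales
    show "subspace (V0 p)" by (auto simp: subspace_def V0_def jlin)
    show "x \<odot> y \<in> V0 p" if "x \<in> V0 p" "y \<in> V0 p" for x y using peirce_0_0[OF pp that] .
    show "e - p \<in> V0 p" using pp by (simp add: V0_def jlin)
    show "x \<odot> (e - p) = x" if "x \<in> V0 p" for x using that jcom[of x p] by (simp add: V0_def jlin)
  qed (use jcom jordan jassoc_inner in \<open>simp_all add: jlin\<close>)
  have p1: "p \<in> V1 p" and p0: "e - p \<in> V0 p" using pp by (simp_all add: V1_def V0_def jlin)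
  have "V1 p \<noteq> {0}" using p1 ne by blast
  moreover have "V0 p \<noteq> {0}" using p0 ne singletonD[of "e - p" 0] eq_iff_diff_eq_0[of e p] by metis
  moreover have "\<exists>x\<in>V1 p. \<exists>y\<in>V0 p. z = x + y" for z
  proof -
    obtain v1 vh v0 where v: "z = v1 + vh + v0" "v1 \<in> V1 p" "vh \<in> Vh p" "v0 \<in> V0 p"
      using peirce_obtain[OF pp, of z] .
    have "vh = 0" using v(3) h by blast
    hence "z = v1 + v0" using v(1) by simp
    thus ?thesis using v by blast
  qed
  moreover have "x \<odot> y = 0 \<and> inner x y = 0" if "x \<in> V1 p" "y \<in> V0 p" for x y
    using peirce_1_0[OF pp that] peirce_orths(2)[OF that(1) _ that(2), of 0] by (simp add: Vh_def)
  ultimately show False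
    using simple A B unfolding simple_eja_def by blast
qed

text \<open>Being linked by a nonzero off-diagonal element is transitive by
  \<open>Vij_trans\<close>. The sum of the class of \<open>i\<close> has trivial half space, hence
  is \<open>0\<close> or \<open>e\<close>, and neither is possible if \<open>j\<close> lies outside
  the class.\<close>

lemma Vij_nonzero:
  assumes H: "frame H" and ij: "i \<in> H" "j \<in> H" "i \<noteq> j"
  obtains u where "u \<in> Vh i" "u \<in> Vh j" "u \<noteq> 0"
proof -
  note F = frameD[OF H]
  define R where "R = (\<lambda>i j. \<exists>u. u \<in> Vh i \<and> u \<in> Vh j \<and> u \<noteq> 0)"
  have tr: "R a c" if "a \<in> H" "b \<in> H" "c \<in> H" "a \<noteq> b" "a \<noteq> c" "b \<noteq> c" "R a b" "R b c" for a b c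
    using Vij_trans[OF H that(1-6)] that(7,8) unfolding R_def by blast
  have "R i j"
  proof (rule ccontr)
    assume nR: "\<not> R i j"
    define I where "I = {a\<in>H. a = i \<or> R i a}"
    define p where "p = \<Sum>I"
    have IH: "I \<subseteq> H" "finite I" using F(1) by (auto simp: I_def)
    have oI: "osys I p" unfolding p_def using osys_subset[OF F(2) IH(1)] .
    have "\<Sum>(H - I) = e - p" using F(1,7) IH by (simp add: sum_diff p_def)
    hence oJ: "osys (H - I) (e - p)" using osys_subset[OF F(2), of "H - I"] by simp
    have nR': "\<not> R a b" if "a \<in> I" "b \<in> H - I" for a b
      using that tr[of i a b] ij(1) by (auto simp: I_def)
    have "Vh p \<subseteq> {0}"
      using Vh_sum_of_idems[OF oI oJ] nR' F(6) IH by (fastforce simp: R_def)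
    hence "p = 0 \<or> p = e" using peirce_direct_product osys_idem[OF oI] by blast
    moreover have "i \<in> I" "j \<in> H - I" using ij nR by (auto simp: I_def)
    ultimately show False
      using osys_mult(1)[OF oI, of i] osys_mult(1)[OF oJ, of j] F(5)[of i] F(5)[of j] ij by auto
  qed
  thus thesis using that by (auto simp: R_def)
qed

text \<open>The components of \<open>d\<close> in \<open>V1 c\<close> and of \<open>c\<close> in
  \<open>V1 d\<close> are \<open>t *\<^sub>R c\<close> and \<open>s *\<^sub>R d\<close>. Pairing
  them with \<open>c\<close> and \<open>d\<close> respectively gives \<open>inner c d\<close> both
  times, and pairing the second with \<open>c\<close> forces \<open>s = t\<close>.\<close>

lemma prim_norm_nonorth:
  assumes c: "primitive_idempotent jp c" and d: "primitive_idempotent jp d" and cd: "inner c d \<noteq> 0"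
  shows "inner c c = inner d d"
proof -
  note cc = primD[OF c] and dd = primD[OF d]
  obtain d1 dh d0 where v: "d = d1 + dh + d0" "d1 \<in> V1 c" "dh \<in> Vh c" "d0 \<in> V0 c"
    using peirce_obtain[OF cc(1), of d] .
  obtain t where t: "d1 = t *\<^sub>R c" using primitive_V1[OF c, of d1] v by (auto simp: V1_def)
  have orth: "inner c dh = 0" "inner c d0 = 0" "inner dh d0 = 0"
    using peirce_orths[OF _ v(3,4), of c] cc by (auto simp: V1_def)
  define N where "N = inner c c"
  have tN: "inner d c = t * N"
    unfolding inner_commute[of d c] using orth by (simp add: v(1) t N_def inner_add_right)
  have dh: "inner d dh = inner dh dh"
    using orth inner_commute[of d0 dh] by (simp add: v(1) t inner_add_left)
  have dc: "d \<odot> c = t *\<^sub>R c + (1/2) *\<^sub>R dh"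
    using v cc jcom[of d c] by (simp add: t jlin Vh_def V0_def)
  have "inner d c = inner (d \<odot> d) c" using dd by simp
  also have "\<dots> = inner d (d \<odot> c)" by (rule jassoc_inner)
  also have "\<dots> = t * (t * N) + (1/2) * inner dh dh"
    unfolding dc inner_add_right using dh tN by simp
  finally have hN: "inner dh dh = 2 * (t * N - t * (t * N))" using tN by simp
  \<comment> \<open>The projection of \<open>c\<close> to \<open>V1 d\<close>, as in the first
    summand of \<open>peirce_obtain\<close>.\<close>
  have "d \<odot> (2 *\<^sub>R (d \<odot> (d \<odot> c)) - d \<odot> c) = 2 *\<^sub>R (d \<odot> (d \<odot> c)) - d \<odot> c"
  proof (rule inner_eqI)
    fix w
    show "inner (d \<odot> (2 *\<^sub>R (d \<odot> (d \<odot> c)) - d \<odot> c)) w = inner (2 *\<^sub>R (d \<odot> (d \<odot> c)) - d \<odot> c) w"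
      using arg_cong[OF idem_cubic[OF dd(1), of c], of "\<lambda>z. inner z w"]
      by (simp add: jlin inner_diff_left)
  qed
  then obtain s where s: "2 *\<^sub>R (d \<odot> (d \<odot> c)) - d \<odot> c = s *\<^sub>R d"
    using primitive_V1[OF d] by blast
  have "inner (s *\<^sub>R d) d = inner c d"
    unfolding s[symmetric] using jassoc_inner[of d "d \<odot> c" d] jassoc_inner[of d c d] dd
    by (simp add: inner_diff_left)
  hence sN: "s * inner d d = t * N" using tN by (simp add: inner_commute)
  have "s * (t * N) = inner (2 *\<^sub>R (d \<odot> (d \<odot> c)) - d \<odot> c) c" unfolding s using tN by simp
  also have "\<dots> = 2 * inner (d \<odot> c) (d \<odot> c) - inner (d \<odot> c) c"
    using jassoc_inner[of d "d \<odot> c" c] by (simp add: inner_diff_left)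
  also have "\<dots> = t * (t * N)"
    unfolding dc using orth hN by (simp add: inner_add_left inner_add_right inner_commute[of dh c] N_def algebra_simps)
  finally have "s * (t * N) = t * (t * N)" .
  moreover have "t * N \<noteq> 0" using cd tN by (simp add: inner_commute)
  ultimately show ?thesis using sN by (auto simp: N_def)
qed

text \<open>The squared norm shared by all primitive idempotents, independent of the choice by
  \<open>prim_norm\<close>; \<open>inner x e / \<kappa>\<close> is the trace of
  \<open>x\<close>.\<close>

definition \<kappa> :: real where
  "\<kappa> = (let c = SOME c. primitive_idempotent jp c in inner c c)"

lemma frame_exists: obtains H where "frame H"
proof (rule spectral_decomposition[of 0])
  fix H and \<xi> :: "'a \<Rightarrow> real"
  assume "osys H e" "\<And>h. h \<in> H \<Longrightarrow> primitive_idempotent jp h"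
  hence "frame H" unfolding frame_def by (intro conjI ballI)
  thus thesis by (rule that)
qed

text \<open>A primitive idempotent cannot be orthogonal to a whole frame, because the frame sums to
  \<open>e\<close>; members of one frame have equal norms because they are linked.\<close>

lemma prim_norm:
  assumes "primitive_idempotent jp c" shows "inner c c = \<kappa>"
proof -
  obtain H where H: "frame H" by (rule frame_exists)
  note F = frameD[OF H]
  have HH: "inner g g = inner h h" if gh: "g \<in> H" "h \<in> H" for g h
  proof (cases "g = h")
    case False
    then obtain u where "u \<in> Vh g" "u \<in> Vh h" "u \<noteq> 0" using Vij_nonzero[OF H gh False] by blast
    with Vij_square[OF F(3) F(3) F(6), of g h u] gh False show ?thesis by metis
  qed simp
  have ex: "\<exists>h\<in>H. inner c c = inner h h" if c: "primitive_idempotent jp c" for c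
  proof (rule ccontr)
    assume "\<not> ?thesis"
    hence "inner c h = 0" if "h \<in> H" for h using prim_norm_nonorth[OF c F(3)] that by blast
    hence "inner c (\<Sum>H) = 0" by (simp add: inner_sum_right)
    hence "inner c c = 0" using F(7) primD[OF c] jassoc_inner[of c c e] by simp
    thus False using primD[OF c] by simp
  qed
  let ?s = "SOME c. primitive_idempotent jp c"
  have "primitive_idempotent jp ?s"
    by (rule someI[where P = "primitive_idempotent jp", OF assms])
  then obtain g where g: "g \<in> H" "inner ?s ?s = inner g g" using ex by blast
  obtain h where h: "h \<in> H" "inner c c = inner h h" using ex[OF assms] by blast
  have "\<kappa> = inner ?s ?s" by (simp only: \<kappa>_def Let_def)
  thus ?thesis using g h HH[OF g(1) h(1)] by metis
qed

lemma kappa_pos: "\<kappa> > 0"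
proof -
  obtain H where H: "frame H" by (rule frame_exists)
  note F = frameD[OF H]
  from unit_nonzero F(7) obtain h where "h \<in> H" by (metis ex_in_conv sum.empty)
  with F(5)[of h] prim_norm[OF F(3)[of h]] show ?thesis by (metis inner_gt_zero_iff)
qed

lemma idem_inner_e: "c \<odot> c = c \<Longrightarrow> inner c e = inner c c"
  using jassoc_inner[of c c e] by simp

lemma frame_card: 
  assumes "frame H" shows "real (card H) * \<kappa> = inner e e"
proof -
  note F = frameD[OF assms]
  have "inner e e = inner (\<Sum>H) e" using F by simp
  also have "\<dots> = (\<Sum>h\<in>H. \<kappa>)"
    unfolding inner_sum_left using idem_inner_e F(4) prim_norm[OF F(3)] by (intro sum.cong) auto
  finally show ?thesis by simp
qed

lemma idem_norm_ge:
  assumes p: "p \<odot> p = p" "p \<noteq> 0" shows "inner p p \<ge> \<kappa>"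
proof -
  obtain H \<xi> where o: "osys H e" "\<And>h. h \<in> H \<Longrightarrow> primitive_idempotent jp h" and 
    \<xi>: "\<And>h. h \<in> H \<Longrightarrow> p \<odot> h = \<xi> h *\<^sub>R h"
    by (rule spectral_decomposition[of p]) (rule that)
  hence H: "frame H" by (simp add: frame_def)
  note F = frameD[OF H]
  have pe: "p = (\<Sum>h\<in>H. p \<odot> h)" using F(7) jsum_right[of p "\<lambda>h. h" H] by simp
  with p(2) have "\<not> (\<forall>h\<in>H. p \<odot> h = 0)" by (metis sum.neutral)
  then obtain h where h: "h \<in> H" "\<xi> h \<noteq> 0" using \<xi> by fastforce
  have 1: "inner p h = \<xi> h * \<kappa>"
    using jassoc_inner[of p h h] jassoc_inner[of h p h] \<xi>[OF h(1)] jcom[of p h] F(4)[OF h(1)] prim_norm[OF F(3)[OF h(1)]]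
    by simp
  have "inner p h = \<xi> h * inner p h"
    using jassoc_inner[of p p h] p \<xi>[OF h(1)] by simp
  hence "\<xi> h = 1" using 1 h kappa_pos by simp
  hence "\<kappa> = inner p h" using 1 by simp
  also have "\<dots> \<le> (\<Sum>g\<in>H. inner p g)"
    using h F(1) idem_inner(1)[OF p(1) F(4)] by (intro member_le_sum) auto
  also have "\<dots> = inner p p"
    using idem_inner_e[OF p(1)] F(7) by (simp flip: inner_sum_right)
  finally show ?thesis .
qed

text \<open>Two nonzero orthogonal idempotents together have squared norm at least
  \<open>2 * \<kappa>\<close>. Primitivity thus becomes a metric condition, easy to verify for
  rotated or transported idempotents.\<close>

lemma prim_iff: "primitive_idempotent jp c \<longleftrightarrow> c \<odot> c = c \<and> inner c c = \<kappa>"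
proof
  assume "primitive_idempotent jp c"
  thus "c \<odot> c = c \<and> inner c c = \<kappa>" using primD prim_norm by blast
next
  assume c: "c \<odot> c = c \<and> inner c c = \<kappa>"
  have False if pq: "p \<noteq> 0" "q \<noteq> 0" "p \<odot> p = p" "q \<odot> q = q" "c = p + q" for p q
  proof -
    have "osys {p, q} c" "p \<noteq> q" using osys_split[of p q c] pq c by auto
    hence "inner p q = 0" using idem_orth_inner[of p q] by (auto simp: osys_def)
    hence "inner c c = inner p p + inner q q" using pq by (simp add: inner_add_left inner_add_right inner_commute)
    with idem_norm_ge[of p] idem_norm_ge[of q] pq c kappa_pos show False by simp
  qed
  moreover have "c \<noteq> 0" using c kappa_pos by auto
  ultimately show "primitive_idempotent jp c"
    using c unfolding primitive_idempotent_def idempotent_def by blast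
qed

end

section \<open>Eigenvalues and majorization\<close>

lemma weighted_sum_le_top:
  fixes l w :: "nat \<Rightarrow> real"
  assumes dec: "\<And>i j. i \<le> j \<Longrightarrow> j < n \<Longrightarrow> l j \<le> l i" and w: "\<And>i. i < n \<Longrightarrow> 0 \<le> w i \<and> w i \<le> 1"
    and sw: "(\<Sum>i<n. w i) = real k" and k: "k \<le> n"
  shows "(\<Sum>i<n. l i * w i) \<le> (\<Sum>i<k. l i)"
proof (cases "k = 0")
  case True
  have "w i = 0" if "i < n" for i
    using sum_nonneg_eq_0_iff[of "{..<n}" w] w sw True that by auto
  then show ?thesis using True by simp
next
  case False
  \<comment> \<open>The last of the \<open>k\<close> largest values is the threshold. After
    subtracting it, the optimal weights are 1 on the first \<open>k\<close> indices and 0 beyond;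
    the subtraction is harmless as the weights sum to \<open>k\<close>.\<close>
  define c where "c = l (k - 1)"
  have "(\<Sum>i<n. (l i - c) * w i) \<le> (\<Sum>i<n. if i < k then l i - c else 0)"
  proof (rule sum_mono)
    fix i assume i: "i \<in> {..<n}"
    show "(l i - c) * w i \<le> (if i < k then l i - c else 0)"
    proof (cases "i < k")
      case True
      then have "l i - c \<ge> 0" using dec[of i "k - 1"] False k by (simp add: c_def)
      then show ?thesis using True w[of i] i by (simp add: mult_left_le)
    next
      case F: False
      then have "l i - c \<le> 0" using dec[of "k - 1" i] i by (simp add: c_def)
      then show ?thesis using F w[of i] i by (simp add: mult_nonpos_nonneg)
    qed
  qed
  also have "\<dots> = (\<Sum>i<k. l i - c)"
    using k by (intro sum.mono_neutral_cong_right) auto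
  finally show ?thesis
    using sw by (simp add: left_diff_distrib sum_subtractf flip: sum_distrib_left)
qed

lemma sorted_desc_eq:
  fixes xs ys :: "real list"
  assumes "sorted_wrt (\<ge>) xs" "sorted_wrt (\<ge>) ys" "mset xs = mset ys" shows "xs = ys"
proof -
  have "sorted (rev xs)" "sorted (rev ys)" using assms by (simp_all add: sorted_wrt_rev)
  hence "rev xs = rev ys" using assms(3) by (metis mset_rev properties_for_sort)
  thus ?thesis by simp
qed

context simple_euclidean_jordan
begin

lemma jordan_frame_iff: "jordan_frame jp e es \<longleftrightarrow> distinct es \<and> frame (set es)"
proof
  assume J: "jordan_frame jp e es"
  have p: "primitive_idempotent jp (es ! i)" if "i < length es" for i
    using J that by (simp add: jordan_frame_def)
  have o: "es ! i \<odot> es ! j = 0" if "i < length es" "j < length es" "i \<noteq> j" for i j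
    using J that by (simp add: jordan_frame_def)
  have d: "distinct es"
    unfolding distinct_conv_nth
  proof (intro allI impI notI)
    fix i j assume ij: "i < length es" "j < length es" "i \<noteq> j" "es ! i = es ! j"
    from o[OF ij(1,2,3)] ij(4) primD[OF p[OF ij(1)]] show False by simp
  qed
  have "(\<Sum>i<length es. es ! i) = \<Sum>(set es)"
    by (rule sum.reindex_bij_betw[OF bij_betw_nth[OF d]]) auto
  hence s: "\<Sum>(set es) = e" using J by (simp add: jordan_frame_def)
  have "frame (set es)"
    unfolding frame_def osys_def
  proof (intro conjI ballI impI)
    show "finite (set es)" by simp
    show "\<Sum>(set es) = e" by (rule s)
  next
    fix h assume "h \<in> set es"
    then obtain i where i: "i < length es" "h = es ! i" by (auto simp: in_set_conv_nth)
    show "primitive_idempotent jp h" using p i by simp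
    thus "h \<noteq> 0" "h \<odot> h = h" using primD by blast+
  next
    fix g h assume "g \<in> set es" "h \<in> set es" "g \<noteq> h"
    thus "g \<odot> h = 0" using o by (auto simp: in_set_conv_nth)
  qed
  with d show "distinct es \<and> frame (set es)" by blast
next
  assume df: "distinct es \<and> frame (set es)"
  hence d: "distinct es" and f: "frame (set es)" by auto
  note F = frameD[OF f]
  have "(\<Sum>i<length es. es ! i) = \<Sum>(set es)"
    by (rule sum.reindex_bij_betw[OF bij_betw_nth[OF d]]) auto
  thus "jordan_frame jp e es"
    unfolding jordan_frame_def using F d by (auto simp: nth_eq_iff_index_eq)
qed

text \<open>A spectral decomposition indexed by the frame itself, which postpones all questions of
  ordering.\<close>

definition diag :: "'a \<Rightarrow> 'a set \<Rightarrow> ('a \<Rightarrow> real) \<Rightarrow> bool" where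
  "diag x H \<xi> \<longleftrightarrow> frame H \<and> (\<forall>h\<in>H. x \<odot> h = \<xi> h *\<^sub>R h)"

lemma diag_sum: "diag x H \<xi> \<Longrightarrow> x = (\<Sum>h\<in>H. \<xi> h *\<^sub>R h)"
  using frameD(7)[of H] jsum_right[of x "\<lambda>h. h" H] by (simp add: diag_def)

lemma frame_sum_mult:
  assumes "frame H" "h \<in> H"
  shows "(\<Sum>g\<in>H. \<xi> g *\<^sub>R g) \<odot> h = \<xi> h *\<^sub>R h"
proof -
  note F = frameD[OF assms(1)]
  have "(\<Sum>g\<in>H. \<xi> g *\<^sub>R g) \<odot> h = (\<Sum>g\<in>H. if g = h then \<xi> h *\<^sub>R h else 0)"
    unfolding jsum_left using F(4,6) assms(2) by (intro sum.cong) (auto simp: jlin)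
  thus ?thesis using F(1) assms(2) by simp
qed

lemma diagI: "frame H \<Longrightarrow> diag (\<Sum>g\<in>H. \<xi> g *\<^sub>R g) H \<xi>"
  using frame_sum_mult by (simp add: diag_def)

lemma diag_exists: obtains H \<xi> where "diag x H \<xi>"
proof (rule spectral_decomposition[of x])
  fix H and \<xi> :: "'a \<Rightarrow> real"
  assume "osys H e" "\<And>h. h \<in> H \<Longrightarrow> primitive_idempotent jp h" "\<And>h. h \<in> H \<Longrightarrow> x \<odot> h = \<xi> h *\<^sub>R h"
  hence "diag x H \<xi>" unfolding diag_def frame_def by blast
  thus thesis by (rule that)
qed

lemma frame_inner_e: "frame H \<Longrightarrow> h \<in> H \<Longrightarrow> inner h e = \<kappa>"
  using idem_inner_e[of h] prim_norm[of h] frameD(3,4)[of H h] by simp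

lemma frame_inner: "frame H \<Longrightarrow> g \<in> H \<Longrightarrow> h \<in> H \<Longrightarrow> inner g h = (if g = h then \<kappa> else 0)"
  using idem_orth_inner[of g h] prim_norm[of h] frameD(3,4,6)[of H] by simp

lemma diag_inner:
  assumes x: "diag x H \<xi>" and h: "h \<in> H"
  shows "inner x h = \<xi> h * \<kappa>"
proof -
  have "inner x h = inner (x \<odot> h) e" using jassoc_inner[of x h e] by (simp add: inner_commute)
  thus ?thesis using x h frame_inner_e[of H h] by (simp add: diag_def)
qed

text \<open>Eigenvectors for different eigenvalues are orthogonal, so the trace of the
  \<open>r\<close>-part of either frame is the same double sum of inner products.\<close>

lemma diag_card_eq:
  assumes x: "diag x H \<xi>" "diag x G \<eta>"
  shows "card {h\<in>H. \<xi> h = r} = card {g\<in>G. \<eta> g = r}"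
proof -
  have *: "real (card {h\<in>H. \<xi> h = r}) * \<kappa> = (\<Sum>h | h \<in> H \<and> \<xi> h = r. \<Sum>g | g \<in> G \<and> \<eta> g = r. inner h g)"
    if x: "diag x H \<xi>" "diag x G \<eta>" for H G and \<xi> \<eta> :: "'a \<Rightarrow> real"
  proof -
    have f: "frame H" "frame G" using x by (auto simp: diag_def)
    have z: "inner h g = 0" if "h \<in> H" "\<xi> h = r" "g \<in> G" "\<eta> g \<noteq> r" for h g
    proof -
      have "inner (x \<odot> h) g = inner h (x \<odot> g)" by (rule jassoc_inner)
      with x that show ?thesis by (simp add: diag_def)
    qed
    have "inner h e = (\<Sum>g | g \<in> G \<and> \<eta> g = r. inner h g)" if "h \<in> H" "\<xi> h = r" for h
    proof -
      have "inner h e = inner h (\<Sum>G)" using frameD(7)[OF f(2)] by simp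
      also have "\<dots> = (\<Sum>g\<in>G. inner h g)" by (simp add: inner_sum_right)
      also have "\<dots> = (\<Sum>g | g \<in> G \<and> \<eta> g = r. inner h g)"
        using frameD(1)[OF f(2)] z[OF that] by (intro sum.mono_neutral_right) auto
      finally show ?thesis .
    qed
    hence "(\<Sum>h | h \<in> H \<and> \<xi> h = r. inner h e) = (\<Sum>h | h \<in> H \<and> \<xi> h = r. \<Sum>g | g \<in> G \<and> \<eta> g = r. inner h g)"
      by (intro sum.cong) auto
    moreover have "(\<Sum>h | h \<in> H \<and> \<xi> h = r. inner h e) = (\<Sum>h | h \<in> H \<and> \<xi> h = r. \<kappa>)"
      using frame_inner_e[OF f(1)] by (intro sum.cong) auto
    ultimately show ?thesis by simp
  qed
  have "real (card {h\<in>H. \<xi> h = r}) * \<kappa> = real (card {g\<in>G. \<eta> g = r}) * \<kappa>"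
    unfolding *[OF x] *[OF x(2) x(1)]
    by (subst sum.swap) (simp add: inner_commute)
  thus ?thesis using kappa_pos by simp
qed

lemma diag_mset_unique:
  assumes x: "diag x H \<xi>" "diag x G \<eta>"
  shows "image_mset \<xi> (mset_set H) = image_mset \<eta> (mset_set G)"
proof (rule multiset_eqI)
  fix r
  have *: "count (image_mset \<xi> (mset_set H)) r = card {h\<in>H. \<xi> h = r}" if "finite H" for H and \<xi> :: "'a \<Rightarrow> real"
  proof -
    have "\<xi> -` {r} \<inter> H = {h\<in>H. \<xi> h = r}" by auto
    thus ?thesis using that by (simp add: count_image_mset)
  qed
  have "finite H" "finite G" using x frameD(1) by (auto simp: diag_def)
  thus "count (image_mset \<xi> (mset_set H)) r = count (image_mset \<eta> (mset_set G)) r"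
    using diag_card_eq[OF x, of r] * by simp
qed

lemma sorted_enumeration:
  assumes "finite H"
  obtains es where "distinct es" "set es = H" "sorted_wrt (\<lambda>a b. key a \<ge> (key b :: real)) es"
proof -
  obtain xs where xs: "set xs = H" "distinct xs" using finite_distinct_list[OF assms] by blast
  have "sorted (map key (sort_key key xs))" by simp
  hence "sorted_wrt (\<lambda>a b. key b \<ge> key a) (sort_key key xs)" by (simp add: sorted_map)
  hence "sorted_wrt (\<lambda>a b. key a \<ge> key b) (rev (sort_key key xs))" by (simp add: sorted_wrt_rev)
  thus thesis using that[of "rev (sort_key key xs)"] xs by simp
qed

lemma frame_sum_map: "distinct es \<Longrightarrow> frame_sum (map \<xi> es) es = (\<Sum>h\<in>set es. \<xi> h *\<^sub>R h)"
  unfolding frame_sum_def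
  by (subst sum.reindex_bij_betw[OF bij_betw_nth[of es "{..<length es}"], symmetric]) auto

lemma list_function:
  assumes "distinct es" "length ls = length es"
  obtains \<xi> where "ls = map \<xi> es"
proof
  show "ls = map (\<lambda>h. the (map_of (zip es ls) h)) es"
    using assms by (intro nth_equalityI) (simp_all add: map_of_zip_nth)
qed

lemma eigvals_eqI:
  assumes "jordan_frame jp e es" "length ls = length es" "sorted_wrt (\<ge>) ls" "x = frame_sum ls es"
  shows "eigvals jp e x = ls"
  unfolding eigvals_def
proof (rule the_equality)
  show "sorted_wrt (\<ge>) ls \<and> (\<exists>es. jordan_frame jp e es \<and> length ls = length es \<and> x = frame_sum ls es)"
    using assms by blast
next
  fix ms assume m: "sorted_wrt (\<ge>) ms \<and> (\<exists>es. jordan_frame jp e es \<and> length ms = length es \<and> x = frame_sum ms es)"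
  then obtain fs where fs: "jordan_frame jp e fs" "length ms = length fs" "x = frame_sum ms fs" by blast
  have *: "\<exists>\<xi>. diag x (set es) \<xi> \<and> ls = map \<xi> es"
    if J: "jordan_frame jp e es" "length ls = length es" "x = frame_sum ls es" for es ls
  proof -
    have d: "distinct es" "frame (set es)" using J jordan_frame_iff by auto
    obtain \<xi> where "ls = map \<xi> es" by (rule list_function[OF d(1) J(2)])
    with J d frame_sum_map[OF d(1), of \<xi>] diagI[OF d(2), of \<xi>] show ?thesis by auto
  qed
  obtain \<xi> where \<xi>: "diag x (set es) \<xi>" "ls = map \<xi> es" using *[OF assms(1,2,4)] by blast
  obtain \<eta> where \<eta>: "diag x (set fs) \<eta>" "ms = map \<eta> fs" using *[OF fs] by blast
  have "mset ls = mset ms"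
    using diag_mset_unique[OF \<xi>(1) \<eta>(1)] \<xi>(2) \<eta>(2) assms(1) fs(1)
    by (simp add: jordan_frame_iff mset_set_set)
  thus "ms = ls" using sorted_desc_eq m assms(3) by metis
qed

lemma eigvals_diag:
  assumes x: "diag x H \<xi>" and es: "distinct es" "set es = H" "sorted_wrt (\<lambda>a b. \<xi> a \<ge> \<xi> b) es"
  shows "eigvals jp e x = map \<xi> es"
proof (rule eigvals_eqI)
  show "jordan_frame jp e es" using es x by (simp add: jordan_frame_iff diag_def)
  show "sorted_wrt (\<ge>) (map \<xi> es)" using es(3) by (simp add: sorted_wrt_map)
  show "x = frame_sum (map \<xi> es) es" using frame_sum_map[OF es(1), of \<xi>] diag_sum[OF x] es(2) by simp
qed simp

lemma diag_enumeration:
  assumes x: "diag x H \<xi>"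
  obtains es where "distinct es" "set es = H" "eigvals jp e x = map \<xi> es"
proof -
  have "finite H" using x frameD(1) by (auto simp: diag_def)
  then obtain es where "distinct es" "set es = H" "sorted_wrt (\<lambda>a b. \<xi> a \<ge> \<xi> b) es"
    by (rule sorted_enumeration)
  thus thesis using that eigvals_diag[OF x] by blast
qed

lemma eigvals_mset:
  assumes x: "diag x H \<xi>" shows "mset (eigvals jp e x) = image_mset \<xi> (mset_set H)"
proof -
  obtain es where "distinct es" "set es = H" "eigvals jp e x = map \<xi> es" by (rule diag_enumeration[OF x])
  thus ?thesis by (simp add: mset_set_set[symmetric])
qed

lemma eigvals_sorted: "sorted_wrt (\<ge>) (eigvals jp e x)"
proof -
  obtain H \<xi> where x: "diag x H \<xi>" by (rule diag_exists)
  have "finite H" using x frameD(1) by (auto simp: diag_def)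
  then obtain es where es: "distinct es" "set es = H" "sorted_wrt (\<lambda>a b. \<xi> a \<ge> \<xi> b) es"
    by (rule sorted_enumeration)
  show ?thesis using eigvals_diag[OF x es] es(3) by (simp add: sorted_wrt_map)
qed

lemma eigvals_cong_mset:
  assumes "mset (eigvals jp e x) = mset (eigvals jp e y)" shows "eigvals jp e x = eigvals jp e y"
  using sorted_desc_eq[OF eigvals_sorted eigvals_sorted assms] .

section \<open>Rank, partial sums of eigenvalues and majorization\<close>

abbreviation rk :: nat where "rk \<equiv> eja_rank jp e"

lemma rank_card: 
  assumes "frame H" shows "card H = rk"
  unfolding eja_rank_def
proof (rule the_equality[symmetric])
  obtain es where "set es = H" "distinct es" using finite_distinct_list frameD(1)[OF assms] by blast
  with assms show "\<exists>es. jordan_frame jp e es \<and> length es = card H"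
    by (intro exI[of _ es]) (auto simp: jordan_frame_iff distinct_card)
next
  fix n assume "\<exists>es. jordan_frame jp e es \<and> length es = n"
  then obtain es where es: "distinct es" "frame (set es)" "length es = n" by (auto simp: jordan_frame_iff)
  have "real (card (set es)) * \<kappa> = real (card H) * \<kappa>" using frame_card[OF es(2)] frame_card[OF assms] by simp
  hence "card (set es) = card H" using kappa_pos by simp
  thus "n = card H" using es distinct_card by metis
qed

lemma eigvals_length: "length (eigvals jp e x) = rk"
proof -
  obtain H \<xi> where x: "diag x H \<xi>" by (rule diag_exists)
  hence "size (mset (eigvals jp e x)) = card H" by (simp add: eigvals_mset)
  thus ?thesis using rank_card[of H] x by (simp add: diag_def)
qed

definition eigsum :: "nat \<Rightarrow> 'a \<Rightarrow> real" where "eigsum k x = sum_list (take k (eigvals jp e x))"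

text \<open>Ky Fan's principle. In an eigenframe \<open>inner x p / \<kappa>\<close> is a weighted
  sum of eigenvalues; the weights lie between 0 and 1 because \<open>p\<close> and
  \<open>e - p\<close> are both idempotent, and they sum to \<open>k\<close>.\<close>

lemma Fan:
  assumes p: "p \<odot> p = p" "inner p p = real k * \<kappa>" and k: "k \<le> rk"
  shows "inner x p \<le> \<kappa> * eigsum k x"
proof -
  obtain H \<xi> where x: "diag x H \<xi>" by (rule diag_exists)
  obtain es where es: "distinct es" "set es = H" "eigvals jp e x = map \<xi> es" by (rule diag_enumeration[OF x])
  have f: "frame H" using x by (simp add: diag_def)
  have len: "length es = rk" using es rank_card[OF f] distinct_card by metis
  let ?l = "\<lambda>i. \<xi> (es ! i)" and ?w = "\<lambda>i. inner (es ! i) p / \<kappa>"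
  have bij: "bij_betw ((!) es) {..<rk} H" using bij_betw_nth[OF es(1)] es(2) len by simp
  have q: "(e - p) \<odot> (e - p) = e - p" using p by (simp add: jlin)
  have "(\<Sum>i<rk. ?l i * ?w i) \<le> (\<Sum>i<k. ?l i)"
  proof (rule weighted_sum_le_top)
    fix i j assume "i \<le> j" "j < rk"
    thus "?l j \<le> ?l i"
      using eigvals_sorted[of x] es(3) len by (cases "i = j") (auto simp: sorted_wrt_iff_nth_less)
  next
    fix i assume "i < rk"
    hence h: "es ! i \<in> H" using es(2) len nth_mem by metis
    have "inner (es ! i) p \<ge> 0" "inner (es ! i) (e - p) \<ge> 0"
      using idem_inner(1)[OF frameD(4)[OF f h]] p q by auto
    thus "0 \<le> ?w i \<and> ?w i \<le> 1"
      using frame_inner_e[OF f h] kappa_pos by (simp add: inner_diff_right)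
  next
    have "(\<Sum>i<rk. inner (es ! i) p) = (\<Sum>h\<in>H. inner h p)"
      by (rule sum.reindex_bij_betw[OF bij])
    also have "\<dots> = inner e p" using frameD(7)[OF f] by (simp flip: inner_sum_left)
    also have "\<dots> = real k * \<kappa>" using idem_inner_e[OF p(1)] p(2) by (simp add: inner_commute)
    finally show "(\<Sum>i<rk. ?w i) = real k" using kappa_pos by (simp flip: sum_divide_distrib)
  qed (rule k)
  moreover have "(\<Sum>i<rk. ?l i * ?w i) = inner x p / \<kappa>"
  proof -
    have "(\<Sum>i<rk. ?l i * ?w i) = (\<Sum>h\<in>H. \<xi> h * (inner h p / \<kappa>))"
      by (rule sum.reindex_bij_betw[OF bij])
    also have "\<dots> = inner (\<Sum>h\<in>H. \<xi> h *\<^sub>R h) p / \<kappa>" 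
      by (simp add: inner_sum_left sum_divide_distrib)
    finally show ?thesis using diag_sum[OF x] by simp
  qed
  moreover have "eigsum k x = (\<Sum>i<k. ?l i)"
    unfolding eigsum_def es(3) using k len by (simp add: sum_list_sum_nth atLeast0LessThan take_map)
  ultimately have "inner x p / \<kappa> \<le> eigsum k x" by simp
  thus ?thesis using kappa_pos by (simp add: pos_divide_le_eq mult.commute)
qed

lemma eigsum_ge:
  assumes x: "diag x H \<xi>" and P: "P \<subseteq> H"
  shows "(\<Sum>h\<in>P. \<xi> h) \<le> eigsum (card P) x"
proof -
  have f: "frame H" using x by (simp add: diag_def)
  note F = frameD[OF f]
  have oP: "osys P (\<Sum>P)" using osys_subset[OF F(2) P] .
  have "inner (\<Sum>P) (\<Sum>P) = inner (\<Sum>P) e" using idem_inner_e[OF osys_idem[OF oP]] by simp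
  also have "\<dots> = real (card P) * \<kappa>"
    using frame_inner_e[OF f] P by (simp add: inner_sum_left subset_iff)
  finally have "inner x (\<Sum>P) \<le> \<kappa> * eigsum (card P) x"
    using Fan[OF osys_idem[OF oP]] card_mono[OF F(1) P] rank_card[OF f] by simp
  moreover have "inner x (\<Sum>P) = (\<Sum>h\<in>P. \<xi> h * \<kappa>)"
    unfolding inner_sum_right using diag_inner[OF x] P by (intro sum.cong) auto
  ultimately show ?thesis using kappa_pos by (simp flip: sum_distrib_right)
qed

lemma eigsum_attained:
  assumes x: "diag x H \<xi>" and k: "k \<le> rk"
  obtains P where "P \<subseteq> H" "card P = k" "eigsum k x = (\<Sum>h\<in>P. \<xi> h)"
proof -
  obtain es where es: "distinct es" "set es = H" "eigvals jp e x = map \<xi> es" by (rule diag_enumeration[OF x])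
  have f: "frame H" using x by (simp add: diag_def)
  have len: "length es = rk" using es rank_card[OF f] distinct_card by metis
  show thesis
  proof (rule that[of "set (take k es)"])
    show "set (take k es) \<subseteq> H" using es set_take_subset by metis
    show "card (set (take k es)) = k" using es k len by (simp add: distinct_card)
    show "eigsum k x = sum \<xi> (set (take k es))"
      unfolding eigsum_def es(3) using es(1) by (simp add: take_map sum_list_distinct_conv_sum_set)
  qed
qed

text \<open>Majorization through functions that are continuous in the element; the condition with
  \<open>e\<close> is equality of the full sums, by \<open>eigsum_rk\<close>.\<close>

definition maj :: "'a \<Rightarrow> 'a \<Rightarrow> bool" where
  "maj z y \<longleftrightarrow> (\<forall>k\<le>rk. eigsum k z \<le> eigsum k y) \<and> inner z e = inner y e"

lemma eigsum_rk: "\<kappa> * eigsum rk x = inner x e"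
proof -
  obtain H \<xi> where x: "diag x H \<xi>" by (rule diag_exists)
  have f: "frame H" using x by (simp add: diag_def)
  obtain P where P: "P \<subseteq> H" "card P = rk" "eigsum rk x = (\<Sum>h\<in>P. \<xi> h)" using eigsum_attained[OF x order_refl] .
  hence "P = H" using card_subset_eq[OF frameD(1)[OF f]] rank_card[OF f] by simp
  moreover have "inner x e = (\<Sum>h\<in>H. \<xi> h * \<kappa>)"
    unfolding diag_sum[OF x] inner_sum_left using frame_inner_e[OF f] by simp
  ultimately show ?thesis using P(3) by (simp add: sum_distrib_left mult.commute)
qed

lemma eigvals_norm: 
  assumes "eigvals jp e x = eigvals jp e y" shows "inner x x = inner y y"
proof -
  have *: "inner x x = \<kappa> * sum_list (map (\<lambda>r. r\<^sup>2) (eigvals jp e x))" for x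
  proof -
    obtain H \<xi> where x: "diag x H \<xi>" by (rule diag_exists)
    obtain es where es: "distinct es" "set es = H" "eigvals jp e x = map \<xi> es" by (rule diag_enumeration[OF x])
    have "inner x x = (\<Sum>h\<in>H. \<xi> h * inner h x)" 
      by (subst (1) diag_sum[OF x]) (simp add: inner_sum_left)
    also have "\<dots> = (\<Sum>h\<in>H. \<xi> h * (\<xi> h * \<kappa>))"
      using diag_inner[OF x] by (simp add: inner_commute)
    also have "\<dots> = \<kappa> * (\<Sum>h\<in>H. (\<xi> h)\<^sup>2)" by (simp add: sum_distrib_left power2_eq_square mult_ac)
    also have "\<dots> = \<kappa> * sum_list (map (\<lambda>r. r\<^sup>2) (eigvals jp e x))"
      using es by (simp add: sum_list_distinct_conv_sum_set o_def)
    finally show ?thesis .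
  qed
  show ?thesis unfolding *[of x] *[of y] assms ..
qed

lemma decreasing_rearr_eigvals: "decreasing_rearr (eigvals jp e x) = eigvals jp e x"
  unfolding decreasing_rearr_def
proof (rule sorted_desc_eq)
  show "sorted_wrt (\<ge>) (rev (sort (eigvals jp e x)))" by (simp add: sorted_wrt_rev)
qed (auto simp: eigvals_sorted)

lemma maj_majorized: "maj z y \<Longrightarrow> majorized_by (eigvals jp e z) (eigvals jp e y)"
proof -
  assume m: "maj z y"
  have "\<kappa> * eigsum rk z = \<kappa> * eigsum rk y" unfolding eigsum_rk using m by (simp add: maj_def)
  hence "eigsum rk z = eigsum rk y" using kappa_pos by simp
  hence "sum_list (eigvals jp e z) = sum_list (eigvals jp e y)"
    using eigvals_length by (simp add: eigsum_def)
  thus ?thesis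
    using m unfolding majorized_by_def decreasing_rearr_eigvals by (auto simp: maj_def eigvals_length eigsum_def)
qed

text \<open>With equal sum and no larger gap, neither new entry exceeds the larger old one. A
  maximizing set for \<open>z\<close> becomes a set of equal size for \<open>y\<close>: that larger
  entry replaces a single new one, and both old entries replace both new ones.\<close>

lemma T_transform_maj:
  assumes y: "diag y H \<xi>" and z: "diag z G \<zeta>"
    and HR: "H = insert i (insert j R)" "i \<notin> R" "j \<notin> R" "i \<noteq> j"
    and GR: "G = insert i' (insert j' R)" "i' \<notin> R" "j' \<notin> R" "i' \<noteq> j'"
    and R: "\<And>h. h \<in> R \<Longrightarrow> \<zeta> h = \<xi> h"
    and s: "\<zeta> i' + \<zeta> j' = \<xi> i + \<xi> j" and gap: "\<bar>\<zeta> i' - \<zeta> j'\<bar> \<le> \<bar>\<xi> i - \<xi> j\<bar>"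
  shows "maj z y"
  unfolding maj_def
proof (intro conjI allI impI)
  have fR: "finite R" using y HR frameD(1)[of H] by (auto simp: diag_def)
  have le: "\<zeta> i' \<le> max (\<xi> i) (\<xi> j)" "\<zeta> j' \<le> max (\<xi> i) (\<xi> j)" using s gap by (auto simp: abs_if max_def split: if_splits)
  obtain m where m: "m = i \<or> m = j" "\<xi> m = max (\<xi> i) (\<xi> j)" by (metis max_def)
  fix k assume k: "k \<le> rk"
  obtain P where P: "P \<subseteq> G" "card P = k" "eigsum k z = (\<Sum>h\<in>P. \<zeta> h)" using eigsum_attained[OF z k] .
  define Q where "Q = P \<inter> R"
  have fQ: "finite Q" and QR: "Q \<subseteq> R" using fR by (auto simp: Q_def)
  have sQ: "(\<Sum>h\<in>Q. \<zeta> h) = (\<Sum>h\<in>Q. \<xi> h)" using R by (intro sum.cong) (auto simp: Q_def)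
  have nin: "i \<notin> Q" "j \<notin> Q" "i' \<notin> Q" "j' \<notin> Q" "m \<notin> Q" using HR GR m by (auto simp: Q_def)
  have mQ: "insert m Q \<subseteq> H" "card (insert m Q) = Suc (card Q)"
    "(\<Sum>h\<in>insert m Q. \<xi> h) = \<xi> m + (\<Sum>h\<in>Q. \<xi> h)"
    using m(1) QR HR(1) nin(5) fQ by auto
  consider "P = Q" | "P = insert i' Q" | "P = insert j' Q" | "P = insert i' (insert j' Q)"
    using P(1) GR(1) unfolding Q_def by blast
  then have "\<exists>P'. P' \<subseteq> H \<and> card P' = k \<and> (\<Sum>h\<in>P. \<zeta> h) \<le> (\<Sum>h\<in>P'. \<xi> h)"
  proof cases
    case 1
    have "Q \<subseteq> H" using QR HR(1) by blast
    moreover have "card Q = k" using 1 P(2) by (rule subst)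
    moreover have "(\<Sum>h\<in>P. \<zeta> h) = (\<Sum>h\<in>Q. \<xi> h)" using 1 sQ by simp
    ultimately show ?thesis by (metis order_refl)
  next
    case 2
    have "(\<Sum>h\<in>P. \<zeta> h) = \<zeta> i' + (\<Sum>h\<in>Q. \<xi> h)" "card P = Suc (card Q)"
      unfolding 2 using fQ nin(3) sQ by simp_all
    with mQ le(1) m(2) P(2) show ?thesis by (intro exI[of _ "insert m Q"]) simp
  next
    case 3
    have "(\<Sum>h\<in>P. \<zeta> h) = \<zeta> j' + (\<Sum>h\<in>Q. \<xi> h)" "card P = Suc (card Q)"
      unfolding 3 using fQ nin(4) sQ by simp_all
    with mQ le(2) m(2) P(2) show ?thesis by (intro exI[of _ "insert m Q"]) simp
  next
    case 4
    have "(\<Sum>h\<in>P. \<zeta> h) = \<zeta> i' + \<zeta> j' + (\<Sum>h\<in>Q. \<xi> h)" "card P = Suc (Suc (card Q))"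
      unfolding 4 using fQ nin(3,4) sQ GR(4) by simp_all
    moreover have "(\<Sum>h\<in>insert i (insert j Q). \<xi> h) = \<xi> i + \<xi> j + (\<Sum>h\<in>Q. \<xi> h)"
      "card (insert i (insert j Q)) = Suc (Suc (card Q))" "insert i (insert j Q) \<subseteq> H"
      using fQ nin(1,2) HR(1,4) QR by auto
    ultimately show ?thesis using s P(2) by (intro exI[of _ "insert i (insert j Q)"]) simp
  qed
  then show "eigsum k z \<le> eigsum k y" using eigsum_ge[OF y] P(3) order_trans by metis
next
  have fR: "finite R" using y HR frameD(1)[of H] by (auto simp: diag_def)
  have *: "inner x e = (\<Sum>h\<in>H. \<xi> h) * \<kappa>" if x: "diag x H \<xi>" for x H \<xi>
    unfolding diag_sum[OF x] inner_sum_left using frame_inner_e[of H] x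
    by (simp add: diag_def sum_distrib_right)
  have "(\<Sum>h\<in>R. \<zeta> h) = (\<Sum>h\<in>R. \<xi> h)" using R by simp
  thus "inner z e = inner y e"
    unfolding *[OF y] *[OF z] using HR GR fR s by simp
qed

text \<open>The leading idempotent of the sum is a test element in \<open>Fan\<close> for both
  summands.\<close>

lemma eigsum_subadd:
  assumes k: "k \<le> rk" shows "eigsum k (x + y) \<le> eigsum k x + eigsum k y"
proof -
  obtain H \<xi> where d: "diag (x + y) H \<xi>" by (rule diag_exists)
  have f: "frame H" using d by (simp add: diag_def)
  note F = frameD[OF f]
  obtain P where P: "P \<subseteq> H" "card P = k" "eigsum k (x + y) = (\<Sum>h\<in>P. \<xi> h)" using eigsum_attained[OF d k] .
  have oP: "osys P (\<Sum>P)" using osys_subset[OF F(2) P(1)] .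
  note pp = osys_idem[OF oP]
  have ip: "inner (\<Sum>P) (\<Sum>P) = real k * \<kappa>"
    unfolding idem_inner_e[OF pp, symmetric]
    using frame_inner_e[OF f] P by (simp add: inner_sum_left subset_iff)
  have "\<kappa> * eigsum k (x + y) = inner (x + y) (\<Sum>P)"
    unfolding P(3) inner_sum_right sum_distrib_left
    using diag_inner[OF d] P(1) by (intro sum.cong) (auto simp: mult.commute)
  also have "\<dots> \<le> \<kappa> * eigsum k x + \<kappa> * eigsum k y"
    using Fan[OF pp ip k, of x] Fan[OF pp ip k, of y] by (simp add: inner_add_left)
  finally have "\<kappa> * eigsum k (x + y) \<le> \<kappa> * (eigsum k x + eigsum k y)" by (simp add: algebra_simps)
  thus ?thesis using kappa_pos by simp
qed

lemma eigsum_bound: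
  assumes k: "k \<le> rk" shows "\<bar>eigsum k x\<bar> \<le> real k / sqrt \<kappa> * norm x"
proof -
  obtain H \<xi> where d: "diag x H \<xi>" by (rule diag_exists)
  have f: "frame H" using d by (simp add: diag_def)
  obtain P where P: "P \<subseteq> H" "card P = k" "eigsum k x = (\<Sum>h\<in>P. \<xi> h)" using eigsum_attained[OF d k] .
  have "\<bar>\<xi> h\<bar> \<le> norm x / sqrt \<kappa>" if h: "h \<in> P" for h
  proof -
    have nh: "norm h = sqrt \<kappa>" using frame_inner[OF f, of h h] P h by (auto simp: norm_eq_sqrt_inner)
    have "inner x h = \<xi> h * \<kappa>" using diag_inner[OF d] P h by blast
    hence le: "\<bar>\<xi> h\<bar> * \<kappa> \<le> norm x * sqrt \<kappa>"
      using Cauchy_Schwarz_ineq2[of x h] nh kappa_pos by (simp add: abs_mult)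
    have "(\<bar>\<xi> h\<bar> * sqrt \<kappa>) * sqrt \<kappa> = \<bar>\<xi> h\<bar> * \<kappa>"
      using kappa_pos by (simp add: mult.assoc)
    with le have "(\<bar>\<xi> h\<bar> * sqrt \<kappa>) * sqrt \<kappa> \<le> norm x * sqrt \<kappa>" by metis
    hence "\<bar>\<xi> h\<bar> * sqrt \<kappa> \<le> norm x"
      by (rule mult_right_le_imp_le) (simp add: kappa_pos)
    thus ?thesis using kappa_pos by (simp add: pos_le_divide_eq)
  qed
  hence "\<bar>eigsum k x\<bar> \<le> (\<Sum>h\<in>P. norm x / sqrt \<kappa>)"
    unfolding P(3) by (intro order_trans[OF sum_abs] sum_mono)
  thus ?thesis using P(2) by simp
qed

lemma eigsum_continuous:
  assumes k: "k \<le> rk" shows "continuous_on UNIV (eigsum k)"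
proof -
  define C where "C = real k / sqrt \<kappa>"
  have d: "eigsum k x - eigsum k y \<le> C * norm (x - y)" for x y
    using eigsum_subadd[OF k, of y "x - y"] eigsum_bound[OF k, of "x - y"] by (simp add: C_def)
  have "\<bar>eigsum k x - eigsum k y\<bar> \<le> C * norm (x - y)" for x y
    using d[of x y] d[of y x] by (simp add: norm_minus_commute abs_le_iff)
  hence "C-lipschitz_on UNIV (eigsum k)"
    using kappa_pos by (intro lipschitz_onI) (simp_all add: dist_norm C_def)
  thus ?thesis by (rule lipschitz_on_continuous_on)
qed

lemma eigvals_eigsum_eq:
  assumes "\<And>k. k \<le> rk \<Longrightarrow> eigsum k x = eigsum k y" shows "eigvals jp e x = eigvals jp e y"
proof (rule nth_equalityI)
  show "length (eigvals jp e x) = length (eigvals jp e y)" by (simp add: eigvals_length)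
  fix i assume "i < length (eigvals jp e x)"
  hence i: "i < rk" by (simp add: eigvals_length)
  have *: "eigvals jp e x ! i = eigsum (Suc i) x - eigsum i x" for x
    using i by (simp add: eigsum_def take_Suc_conv_app_nth eigvals_length)
  show "eigvals jp e x ! i = eigvals jp e y ! i" unfolding * using assms i by simp
qed

lemma closed_orbit: "closed (eigval_orbit jp e b)"
proof -
  have "eigval_orbit jp e b = (\<Inter>k\<in>{..rk}. {x. eigsum k x = eigsum k b})"
    unfolding eigval_orbit_def using eigvals_eigsum_eq[of _ b] by (auto simp: eigsum_def)
  moreover have "closed {x. eigsum k x = eigsum k b}" if "k \<le> rk" for k
    using eigsum_continuous[OF that] by (intro closed_Collect_eq) auto
  ultimately show ?thesis by auto
qed

lemma closed_maj: "closed {x. maj (x - a) y}"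
proof -
  have eq: "{x. maj (x - a) y} = (\<Inter>k\<in>{..rk}. {x. eigsum k (x - a) \<le> eigsum k y}) \<inter> {x. inner (x - a) e = inner y e}"
    by (auto simp: maj_def)
  have c: "closed {x. eigsum k (x - a) \<le> eigsum k y}" if "k \<le> rk" for k
  proof (intro closed_Collect_le continuous_on_const)
    show "continuous_on UNIV (\<lambda>x. eigsum k (x - a))"
      by (rule continuous_on_compose2[OF eigsum_continuous[OF that]]) (auto intro!: continuous_intros)
  qed
  show ?thesis unfolding eq
    by (intro closed_Int closed_INT ballI c closed_Collect_eq continuous_intros) simp
qed

end

section \<open>Rotations of a frame\<close>

context simple_euclidean_jordan
begin

lemma Vij_normalized:
  assumes H: "frame H" and ij: "i \<in> H" "j \<in> H" "i \<noteq> j"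
  obtains u where "u \<in> Vh i" "u \<in> Vh j" "u \<odot> u = i + j"
proof -
  note F = frameD[OF H]
  obtain u where u: "u \<in> Vh i" "u \<in> Vh j" "u \<noteq> 0" by (rule Vij_nonzero[OF H ij])
  obtain \<alpha> where \<alpha>: "\<alpha> > 0" "u \<odot> u = \<alpha> *\<^sub>R (i + j)"
    by (rule Vij_square[OF F(3)[OF ij(1)] F(3)[OF ij(2)] F(6)[OF ij] u])
  show thesis
  proof (rule that[of "(1 / sqrt \<alpha>) *\<^sub>R u"])
    show "(1 / sqrt \<alpha>) *\<^sub>R u \<in> Vh i" "(1 / sqrt \<alpha>) *\<^sub>R u \<in> Vh j"
      using u by (simp_all add: Vh_def jlin)
    have "(1 / sqrt \<alpha>) * ((1 / sqrt \<alpha>) * \<alpha>) = 1" using \<alpha>(1) by (simp add: field_simps)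
    thus "(1 / sqrt \<alpha>) *\<^sub>R u \<odot> (1 / sqrt \<alpha>) *\<^sub>R u = i + j"
      using \<alpha> by (simp add: jlin)
  qed
qed

lemma Vij_inner:
  assumes H: "frame H" and ij: "i \<in> H" "j \<in> H" "i \<noteq> j" and u: "u \<in> Vh i" "u \<in> Vh j" and g: "g \<in> H"
  shows "inner u g = 0"
proof -
  note F = frameD[OF H]
  have "\<exists>l. l \<noteq> 1 \<and> g \<odot> u = l *\<^sub>R u"
  proof (cases "g = i \<or> g = j")
    case True thus ?thesis using u by (intro exI[of _ "1/2"]) (auto simp: Vh_def)
  next
    case False
    hence "g \<odot> u = 0" using Vij_other(1)[OF F(2) ij(1,2) g ij(3) _ _ u] by blast
    thus ?thesis by (intro exI[of _ 0]) simp
  qed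
  thus ?thesis using peirce_orth[of g u _ g 1] F(4)[OF g] by auto
qed

text \<open>\<open>i - j\<close> and \<open>u\<close> both square to \<open>i + j\<close> and have
  product 0, like a diagonal reflection and the coordinate flip among symmetric 2 by 2 matrices. So
  each unit combination \<open>k\<close> squares to \<open>i + j\<close>, and the halves of
  \<open>i + j + k\<close> and \<open>i + j - k\<close> are orthogonal idempotents.\<close>

lemma frame_rotation:
  assumes H: "frame H" and ij: "i \<in> H" "j \<in> H" "i \<noteq> j"
    and u: "u \<in> Vh i" "u \<in> Vh j" "u \<odot> u = i + j" and CS: "C\<^sup>2 + S\<^sup>2 = (1::real)"
  defines "R \<equiv> H - {i, j}"
  obtains c c' where "frame (insert c (insert c' R))" "c \<notin> R" "c' \<notin> R" "c \<noteq> c'"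
    "\<And>p q. p *\<^sub>R c + q *\<^sub>R c' = ((p + q) / 2) *\<^sub>R (i + j) + ((p - q) / 2) *\<^sub>R (C *\<^sub>R (i - j) + S *\<^sub>R u)"
proof -
  note F = frameD[OF H]
  have ii: "i \<odot> i = i" "j \<odot> j = j" "i \<odot> j = 0" "j \<odot> i = 0" using F ij by auto
  have iu: "i \<odot> u = (1/2) *\<^sub>R u" "u \<odot> i = (1/2) *\<^sub>R u" "j \<odot> u = (1/2) *\<^sub>R u" "u \<odot> j = (1/2) *\<^sub>R u"
    using u jcom[of u i] jcom[of u j] by (simp_all add: Vh_def)
  define f h where "f = i + j" and "h = i - j"
  define k where "k = C *\<^sub>R h + S *\<^sub>R u"
  have ff: "f \<odot> f = f" and hh: "h \<odot> h = f" and fh: "f \<odot> h = h" "h \<odot> f = h" 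
    using ii by (simp_all add: f_def h_def jlin)
  have fu: "f \<odot> u = u" "u \<odot> f = u" using iu by (simp_all add: f_def jlin flip: scaleR_add_left)
  have hu: "h \<odot> u = 0" "u \<odot> h = 0" using iu by (simp_all add: h_def jlin)
  have uu: "u \<odot> u = f" using u by (simp add: f_def)
  have kk: "k \<odot> k = f"
  proof -
    have "k \<odot> k = (C * C) *\<^sub>R f + (S * S) *\<^sub>R f" by (simp add: k_def jlin hh hu uu)
    also have "\<dots> = f" using CS by (simp add: power2_eq_square flip: scaleR_add_left)
    finally show ?thesis .
  qed
  have fk: "f \<odot> k = k" "k \<odot> f = k" by (simp_all add: k_def jlin fh fu)
  define c c' where "c = (1/2) *\<^sub>R (f + k)" and "c' = (1/2) *\<^sub>R (f - k)"
  have cc: "c \<odot> c = c"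
  proof -
    have "c \<odot> c = (1/4) *\<^sub>R (f + k) + (1/4) *\<^sub>R (f + k)" by (simp add: c_def jlin ff kk fk algebra_simps)
    thus ?thesis by (simp add: c_def flip: scaleR_add_left)
  qed
  have cc': "c' \<odot> c' = c'"
  proof -
    have "c' \<odot> c' = (1/4) *\<^sub>R (f - k) + (1/4) *\<^sub>R (f - k)" by (simp add: c'_def jlin ff kk fk algebra_simps)
    thus ?thesis by (simp add: c'_def flip: scaleR_add_left)
  qed
  have fk0: "(f + k) \<odot> (f - k) = 0" "(f - k) \<odot> (f + k) = 0" by (simp_all add: jlin ff kk fk)
  have o: "c \<odot> c' = 0" "c' \<odot> c = 0"
    by (simp_all add: c_def c'_def jscale fk0)
  have sum: "c + c' = f" by (simp add: c_def c'_def algebra_simps flip: scaleR_add_left)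
  have "inner u e = 0" using Vij_inner[OF H ij u(1,2)] F(7) by (metis inner_sum_right sum.neutral)
  moreover have "inner h e = 0" using frame_inner_e[OF H] ij by (simp add: h_def inner_diff_left)
  ultimately have ke: "inner k e = 0" by (simp add: k_def inner_add_left)
  have fe: "inner f e = 2 * \<kappa>" using frame_inner_e[OF H] ij by (simp add: f_def inner_add_left)
  have prim: "primitive_idempotent jp c" "primitive_idempotent jp c'"
    using cc cc' ke fe idem_inner_e[OF cc] idem_inner_e[OF cc']
    by (simp_all add: prim_iff) (simp_all add: c_def c'_def inner_add_left inner_diff_left)
  have Rz: "g \<odot> c = 0 \<and> g \<odot> c' = 0 \<and> c \<odot> g = 0 \<and> c' \<odot> g = 0" if g: "g \<in> R" for g
  proof -
    have g': "g \<in> H" "g \<noteq> i" "g \<noteq> j" using g by (auto simp: R_def)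
    have "g \<odot> u = 0" using Vij_other(1)[OF F(2) ij(1,2) g'(1) ij(3) g'(2,3) u(1,2)] .
    moreover have "g \<odot> i = 0" "g \<odot> j = 0" using F(6) g' ij by auto
    ultimately have "g \<odot> c = 0" "g \<odot> c' = 0" by (simp_all add: c_def c'_def f_def k_def h_def jlin)
    thus ?thesis using jcom[of c g] jcom[of c' g] by simp
  qed
  have cR: "c \<notin> R" "c' \<notin> R" using Rz cc cc' primD(2)[OF prim(1)] primD(2)[OF prim(2)] by metis+
  have ne: "c \<noteq> c'" using o cc primD(2)[OF prim(1)] by metis
  have "\<Sum>H = i + (j + \<Sum>R)"
    using F(1) ij unfolding R_def by (simp add: sum.remove[of H i] sum.remove[of "H - {i}" j] Diff_insert2[symmetric])
  hence "c + (c' + \<Sum>R) = e" using F(7) sum by (simp add: f_def add.assoc[symmetric])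
  hence s: "\<Sum>(insert c (insert c' R)) = e" using F(1) cR ne by (simp add: R_def)
  have fr: "frame (insert c (insert c' R))"
    unfolding frame_def osys_def
  proof (intro conjI ballI impI)
    show "finite (insert c (insert c' R))" using F(1) by (simp add: R_def)
    show "\<Sum>(insert c (insert c' R)) = e" by (rule s)
  next
    fix g assume "g \<in> insert c (insert c' R)"
    thus "primitive_idempotent jp g" using prim F(3) by (auto simp: R_def)
    thus "g \<noteq> 0" "g \<odot> g = g" using primD by blast+
  next
    fix g g' assume "g \<in> insert c (insert c' R)" "g' \<in> insert c (insert c' R)" "g \<noteq> g'"
    thus "g \<odot> g' = 0" using o Rz F(6)[of g g'] by (auto simp: R_def)
  qed
  have "p *\<^sub>R c + q *\<^sub>R c' = ((p + q) / 2) *\<^sub>R (i + j) + ((p - q) / 2) *\<^sub>R (C *\<^sub>R (i - j) + S *\<^sub>R u)" for p q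
  proof -
    have "p *\<^sub>R c + q *\<^sub>R c' = ((p + q) / 2) *\<^sub>R f + ((p - q) / 2) *\<^sub>R k"
      by (rule inner_eqI) (simp add: c_def c'_def inner_add_left inner_diff_left field_simps)
    thus ?thesis by (simp add: f_def k_def h_def)
  qed
  from that[OF fr cR ne this] show thesis .
qed

lemma rotation_diag:
  assumes H: "frame H" and ij: "i \<in> H" "j \<in> H" "i \<noteq> j"
    and u: "u \<in> Vh i" "u \<in> Vh j" "u \<odot> u = i + j" and CS: "C\<^sup>2 + S\<^sup>2 = (1::real)"
  obtains c c' \<zeta> where "c \<notin> H - {i, j}" "c' \<notin> H - {i, j}" "c \<noteq> c'" "\<zeta> c = p" "\<zeta> c' = q"
    "\<And>g. g \<in> H - {i, j} \<Longrightarrow> \<zeta> g = \<eta> g"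
    "diag ((\<Sum>g\<in>H-{i,j}. \<eta> g *\<^sub>R g) + ((p + q) / 2) *\<^sub>R (i + j) + ((p - q) / 2) *\<^sub>R (C *\<^sub>R (i - j) + S *\<^sub>R u))
      (insert c (insert c' (H - {i, j}))) \<zeta>"
proof -
  define R where "R = H - {i, j}"
  obtain c c' where c: "frame (insert c (insert c' R))" "c \<notin> R" "c' \<notin> R" "c \<noteq> c'"
    "\<And>p q. p *\<^sub>R c + q *\<^sub>R c' = ((p + q) / 2) *\<^sub>R (i + j) + ((p - q) / 2) *\<^sub>R (C *\<^sub>R (i - j) + S *\<^sub>R u)"
    using frame_rotation[OF H ij u CS] unfolding R_def by blast
  define \<zeta> where "\<zeta> = \<eta>(c := p, c' := q)"
  have z: "\<zeta> c = p" "\<zeta> c' = q" "\<And>g. g \<in> R \<Longrightarrow> \<zeta> g = \<eta> g" using c by (auto simp: \<zeta>_def)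
  have fin: "finite R" using frameD(1)[OF H] by (simp add: R_def)
  have "(\<Sum>g\<in>insert c (insert c' R). \<zeta> g *\<^sub>R g) = p *\<^sub>R c + q *\<^sub>R c' + (\<Sum>g\<in>R. \<zeta> g *\<^sub>R g)"
    using fin c z by simp
  also have "\<dots> = (\<Sum>g\<in>R. \<eta> g *\<^sub>R g) + ((p + q) / 2) *\<^sub>R (i + j) + ((p - q) / 2) *\<^sub>R (C *\<^sub>R (i - j) + S *\<^sub>R u)"
    unfolding c(5) using z(3) by (simp add: add.commute)
  finally show thesis
    using that[of c c' \<zeta>] c z diagI[OF c(1), of \<zeta>] by (simp add: R_def)
qed

text \<open>Rotating the eigenframe of \<open>x\<close> keeps its eigenvalues. With \<open>A\<close>
  and \<open>B\<close> the gaps of \<open>x\<close> and \<open>a\<close>, the squared norm of the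
  difference changes by \<open>A * B * (1 - C) * \<kappa>\<close> and its squared gap by
  \<open>2 * A * B * (1 - C)\<close>, so the sign of \<open>A * B\<close> decides both.\<close>

lemma rotation_perturbation:
  assumes x: "diag x H \<xi>" and a: "diag a H \<alpha>" and ij: "i \<in> H" "j \<in> H"
    and \<delta>: "(\<xi> i - \<xi> j) * (\<alpha> i - \<alpha> j) \<noteq> 0" and \<epsilon>: "\<epsilon> > 0"
  obtains x' where "eigvals jp e x' = eigvals jp e x" "dist x' x < \<epsilon>"
    "(\<xi> i - \<xi> j) * (\<alpha> i - \<alpha> j) < 0 \<Longrightarrow>
       maj (x' - a) (x - a) \<and> inner (x' - a) (x' - a) < inner (x - a) (x - a)"
    "(\<xi> i - \<xi> j) * (\<alpha> i - \<alpha> j) > 0 \<Longrightarrow>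
       maj (x - a) (x' - a) \<and> inner (x - a) (x - a) < inner (x' - a) (x' - a)"
proof -
  have ne: "i \<noteq> j" using \<delta> by auto
  have H: "frame H" using x by (simp add: diag_def)
  note F = frameD[OF H]
  obtain u where u: "u \<in> Vh i" "u \<in> Vh j" "u \<odot> u = i + j" by (rule Vij_normalized[OF H ij ne])
  define R where "R = H - {i, j}"
  have HR: "H = insert i (insert j R)" "i \<notin> R" "j \<notin> R" using ij by (auto simp: R_def)
  have fR: "finite R" using F(1) by (simp add: R_def)
  define A B where "A = \<xi> i - \<xi> j" and "B = \<alpha> i - \<alpha> j"
  define f h where "f = i + j" and "h = i - j"
  have split: "(\<Sum>g\<in>H. \<eta> g *\<^sub>R g) = (\<Sum>g\<in>R. \<eta> g *\<^sub>R g) + ((\<eta> i + \<eta> j) / 2) *\<^sub>R f + ((\<eta> i - \<eta> j) / 2) *\<^sub>R h" for \<eta>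
  proof -
    have "(\<Sum>g\<in>H. \<eta> g *\<^sub>R g) = \<eta> i *\<^sub>R i + \<eta> j *\<^sub>R j + (\<Sum>g\<in>R. \<eta> g *\<^sub>R g)"
      using fR HR(2,3) ne by (subst HR(1)) (simp add: add.assoc)
    moreover have "\<eta> i *\<^sub>R i + \<eta> j *\<^sub>R j = ((\<eta> i + \<eta> j) / 2) *\<^sub>R f + ((\<eta> i - \<eta> j) / 2) *\<^sub>R h"
      by (rule inner_eqI) (simp add: f_def h_def inner_add_left inner_diff_left field_simps)
    ultimately show ?thesis by (simp add: add.commute add.left_commute)
  qed
  note xs = diag_sum[OF x, unfolded split] and as = diag_sum[OF a, unfolded split]
  have y: "diag (x - a) H (\<lambda>g. \<xi> g - \<alpha> g)"
    using x a by (simp add: diag_def jlin scaleR_diff_left)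
  have ua: "inner u a = 0"
    by (subst diag_sum[OF a]) (simp add: inner_sum_right Vij_inner[OF H ij ne u(1,2)])
  have ha: "inner h a = B * \<kappa>"
    using diag_inner[OF a ij(1)] diag_inner[OF a ij(2)]
    by (simp add: h_def B_def inner_commute[of _ a] inner_diff_right left_diff_distrib)
  have "((\<lambda>t. norm ((A / 2) *\<^sub>R ((cos t - 1) *\<^sub>R h + sin t *\<^sub>R u))) \<longlongrightarrow>
      norm ((A / 2) *\<^sub>R ((cos 0 - 1) *\<^sub>R h + sin 0 *\<^sub>R u))) (at (0::real))"
    by (intro tendsto_intros)
  hence "\<forall>\<^sub>F t in at (0::real). norm ((A / 2) *\<^sub>R ((cos t - 1) *\<^sub>R h + sin t *\<^sub>R u)) < \<epsilon>"
    using \<epsilon> order_tendstoD(2) by fastforce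
  then obtain d where d: "d > 0" "\<And>t. t \<noteq> 0 \<Longrightarrow> \<bar>t\<bar> < d \<Longrightarrow> norm ((A / 2) *\<^sub>R ((cos t - 1) *\<^sub>R h + sin t *\<^sub>R u)) < \<epsilon>"
    unfolding eventually_at by (auto simp: dist_real_def)
  \<comment> \<open>A nonzero angle below \<pi>, so that its cosine is strictly less than 1.\<close>
  define t where "t = min (d / 2) 1"
  have t: "t > 0" "t < d" "t \<le> 1" using d(1) by (auto simp: t_def)
  define C S where "C = cos t" and "S = sin t"
  have CS: "C\<^sup>2 + S\<^sup>2 = 1" by (simp add: C_def S_def)
  have C1: "C < 1"
  proof -
    have "cos t < cos 0" using t pi_gt3 by (intro cos_monotone_0_pi) auto
    thus ?thesis by (simp add: C_def)
  qed
  obtain c c' \<zeta> where c: "c \<notin> R" "c' \<notin> R" "c \<noteq> c'" "\<zeta> c = \<xi> i" "\<zeta> c' = \<xi> j" "\<And>g. g \<in> R \<Longrightarrow> \<zeta> g = \<xi> g"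
    "diag ((\<Sum>g\<in>R. \<xi> g *\<^sub>R g) + ((\<xi> i + \<xi> j) / 2) *\<^sub>R (i + j) + ((\<xi> i - \<xi> j) / 2) *\<^sub>R (C *\<^sub>R (i - j) + S *\<^sub>R u))
      (insert c (insert c' R)) \<zeta>"
    unfolding R_def by (rule rotation_diag[OF H ij ne u CS, of "\<xi> i" "\<xi> j" \<xi>]) (rule that[unfolded R_def])
  define x' where "x' = (\<Sum>g\<in>R. \<xi> g *\<^sub>R g) + ((\<xi> i + \<xi> j) / 2) *\<^sub>R (i + j) + ((\<xi> i - \<xi> j) / 2) *\<^sub>R (C *\<^sub>R (i - j) + S *\<^sub>R u)"
  have x'd: "diag x' (insert c (insert c' R)) \<zeta>" using c(7) by (simp add: x'_def)
  have "image_mset \<zeta> (mset_set R) = image_mset \<xi> (mset_set R)"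
    using c(6) fR by (intro image_mset_cong) simp
  hence "mset (eigvals jp e x') = mset (eigvals jp e x)"
    unfolding eigvals_mset[OF x'd] eigvals_mset[OF x] using fR HR(2,3) ne c(1-5)
    by (subst HR(1)) simp
  hence ev: "eigvals jp e x' = eigvals jp e x" by (rule eigvals_cong_mset)
  have diff: "x' - x = (A / 2) *\<^sub>R ((C - 1) *\<^sub>R h + S *\<^sub>R u)"
    by (subst xs, rule inner_eqI) (simp add: x'_def A_def f_def h_def inner_add_left inner_diff_left algebra_simps)
  have dist: "dist x' x < \<epsilon>"
    unfolding dist_norm diff C_def S_def using d(2)[of t] t by simp
  have "inner (x' - x) a = (A / 2) * ((C - 1) * (B * \<kappa>))"
    unfolding diff using ua ha by (simp add: inner_add_left)
  moreover have "inner x' x' = inner x x" by (rule eigvals_norm[OF ev])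
  ultimately have nrm: "inner (x' - a) (x' - a) - inner (x - a) (x - a) = A * B * ((1 - C) * \<kappa>)"
    by (simp add: inner_diff_left inner_diff_right inner_commute[of a x'] inner_commute[of a x] algebra_simps)
  \<comment> \<open>Up to the factor 1/2, \<open>x' - a\<close> has coordinates
    \<open>A * C - B\<close> and \<open>A * S\<close> along \<open>h\<close> and \<open>u\<close>;
    \<rho> is their length and hence the new eigenvalue gap.\<close>
  define \<rho> where "\<rho> = sqrt ((A * C - B)\<^sup>2 + (A * S)\<^sup>2)"
  have \<rho>2: "\<rho>\<^sup>2 = (A - B)\<^sup>2 + 2 * (A * B) * (1 - C)"
  proof -
    have "\<rho>\<^sup>2 = A\<^sup>2 * (C\<^sup>2 + S\<^sup>2) - 2 * A * B * C + B\<^sup>2"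
      by (simp add: \<rho>_def) (simp add: power2_eq_square algebra_simps)
    thus ?thesis unfolding CS by (simp add: power2_eq_square algebra_simps)
  qed
  \<comment> \<open>The direction of that coordinate vector; when \<rho> = 0 any direction will
    do.\<close>
  obtain C' S' where CS': "C'\<^sup>2 + S'\<^sup>2 = 1" "\<rho> * C' = A * C - B" "\<rho> * S' = A * S"
  proof (cases "\<rho> = 0")
    case True
    hence "A * C - B = 0 \<and> A * S = 0" by (simp add: \<rho>_def sum_power2_eq_zero_iff)
    thus thesis using that[of 1 0] True by simp
  next
    case False
    have "((A * C - B) / \<rho>)\<^sup>2 + (A * S / \<rho>)\<^sup>2 = ((A * C - B)\<^sup>2 + (A * S)\<^sup>2) / \<rho>\<^sup>2"
      by (simp add: power_divide add_divide_distrib)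
    also have "\<dots> = 1" using False by (simp add: \<rho>_def)
    finally show thesis using that[of "(A * C - B) / \<rho>" "A * S / \<rho>"] False by simp
  qed
  define m where "m = (\<xi> i - \<alpha> i + (\<xi> j - \<alpha> j)) / 2"
  obtain b b' \<omega> where b: "b \<notin> R" "b' \<notin> R" "b \<noteq> b'" "\<omega> b = m + \<rho> / 2" "\<omega> b' = m - \<rho> / 2" "\<And>g. g \<in> R \<Longrightarrow> \<omega> g = \<xi> g - \<alpha> g"
    "diag ((\<Sum>g\<in>R. (\<xi> g - \<alpha> g) *\<^sub>R g) + ((m + \<rho> / 2 + (m - \<rho> / 2)) / 2) *\<^sub>R (i + j)
        + ((m + \<rho> / 2 - (m - \<rho> / 2)) / 2) *\<^sub>R (C' *\<^sub>R (i - j) + S' *\<^sub>R u))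
      (insert b (insert b' R)) \<omega>"
    unfolding R_def by (rule rotation_diag[OF H ij ne u CS'(1), of "m + \<rho> / 2" "m - \<rho> / 2" "\<lambda>g. \<xi> g - \<alpha> g"]) (rule that[unfolded R_def])
  have "x' - a = (\<Sum>g\<in>R. (\<xi> g - \<alpha> g) *\<^sub>R g) + m *\<^sub>R f + (\<rho> / 2) *\<^sub>R (C' *\<^sub>R h + S' *\<^sub>R u)"
  proof -
    have "(\<rho> / 2) *\<^sub>R (C' *\<^sub>R h + S' *\<^sub>R u) = ((\<rho> * C') / 2) *\<^sub>R h + ((\<rho> * S') / 2) *\<^sub>R u"
      by (simp add: scaleR_add_right)
    also have "\<dots> = ((A * C - B) / 2) *\<^sub>R h + ((A * S) / 2) *\<^sub>R u" unfolding CS' ..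
    finally have eq: "(\<rho> / 2) *\<^sub>R (C' *\<^sub>R h + S' *\<^sub>R u) = ((A * C - B) / 2) *\<^sub>R h + ((A * S) / 2) *\<^sub>R u" .
    show ?thesis unfolding eq
      by (subst as, rule inner_eqI) (simp add: x'_def m_def A_def B_def f_def h_def scaleR_diff_left
          sum_subtractf inner_add_left inner_diff_left inner_sum_left field_simps)
  qed
  hence z: "diag (x' - a) (insert b (insert b' R)) \<omega>" using b(7) by (simp add: f_def h_def)
  have gy: "(\<xi> i - \<alpha> i) - (\<xi> j - \<alpha> j) = A - B" by (simp add: A_def B_def)
  have gz: "\<omega> b - \<omega> b' = \<rho>" by (simp add: b)
  have sm: "\<omega> b + \<omega> b' = (\<xi> i - \<alpha> i) + (\<xi> j - \<alpha> j)" by (simp add: b m_def)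
  show thesis
  proof (rule that[OF ev dist])
    assume "(\<xi> i - \<xi> j) * (\<alpha> i - \<alpha> j) < 0"
    hence AB: "A * B < 0" by (simp add: A_def B_def)
    have "A * B * (1 - C) \<le> 0" using AB C1 by (simp add: mult_nonpos_nonneg)
    hence "\<rho>\<^sup>2 \<le> (A - B)\<^sup>2" using \<rho>2 by simp
    hence gap: "\<bar>\<omega> b - \<omega> b'\<bar> \<le> \<bar>(\<xi> i - \<alpha> i) - (\<xi> j - \<alpha> j)\<bar>" unfolding gy gz by (simp add: abs_le_square_iff)
    have "maj (x' - a) (x - a)"
      by (rule T_transform_maj[OF y z HR ne refl b(1-3) _ sm gap]) (simp add: b(6))
    moreover have "A * B * ((1 - C) * \<kappa>) < 0" using AB C1 kappa_pos by (simp add: mult_neg_pos)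
    ultimately show "maj (x' - a) (x - a) \<and> inner (x' - a) (x' - a) < inner (x - a) (x - a)"
      using nrm by linarith
  next
    assume "(\<xi> i - \<xi> j) * (\<alpha> i - \<alpha> j) > 0"
    hence AB: "A * B > 0" by (simp add: A_def B_def)
    have "A * B * (1 - C) \<ge> 0" using AB C1 by simp
    hence "(A - B)\<^sup>2 \<le> \<rho>\<^sup>2" using \<rho>2 by simp
    hence gap: "\<bar>(\<xi> i - \<alpha> i) - (\<xi> j - \<alpha> j)\<bar> \<le> \<bar>\<omega> b - \<omega> b'\<bar>" unfolding gy gz by (simp add: abs_le_square_iff)
    have "maj (x - a) (x' - a)"
      by (rule T_transform_maj[OF z y refl b(1-3) HR ne _ sm[symmetric] gap]) (simp add: b(6))
    moreover have "A * B * ((1 - C) * \<kappa>) > 0" using AB C1 kappa_pos by simp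
    ultimately show "maj (x - a) (x' - a) \<and> inner (x - a) (x - a) < inner (x' - a) (x' - a)"
      using nrm by linarith
  qed
qed

text \<open>By \<open>mono\<close> no pair is ordered oppositely by \<xi> and \<alpha>, so sorting
  by their sum sorts both at once.\<close>

lemma strongly_operator_commuteI:
  assumes a: "diag a H \<alpha>" and x: "diag x H \<xi>"
    and mono: "\<And>i j. i \<in> H \<Longrightarrow> j \<in> H \<Longrightarrow> (\<xi> i - \<xi> j) * (\<alpha> i - \<alpha> j) \<ge> 0"
  shows "strongly_operator_commute jp e a x"
proof -
  have f: "frame H" using x by (simp add: diag_def)
  obtain es where es: "distinct es" "set es = H" "sorted_wrt (\<lambda>g h. \<xi> g + \<alpha> g \<ge> \<xi> h + \<alpha> h) es"
    by (rule sorted_enumeration[OF frameD(1)[OF f]])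
  have mono': "\<xi> g \<ge> \<xi> h \<and> \<alpha> g \<ge> \<alpha> h" if gh: "g \<in> H" "h \<in> H" "\<xi> g + \<alpha> g \<ge> \<xi> h + \<alpha> h" for g h
  proof -
    have "\<not> (\<xi> g - \<xi> h < 0 \<and> \<alpha> g - \<alpha> h > 0)" "\<not> (\<xi> g - \<xi> h > 0 \<and> \<alpha> g - \<alpha> h < 0)"
      using mono[OF gh(1,2)] mult_neg_pos[of "\<xi> g - \<xi> h" "\<alpha> g - \<alpha> h"] mult_pos_neg[of "\<xi> g - \<xi> h" "\<alpha> g - \<alpha> h"]
      by auto
    with gh(3) show ?thesis by auto
  qed
  have "sorted_wrt (\<lambda>g h. \<xi> g \<ge> \<xi> h) es" "sorted_wrt (\<lambda>g h. \<alpha> g \<ge> \<alpha> h) es"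
    using mono' es(2) by (auto intro: sorted_wrt_mono_rel[OF _ es(3)])
  hence ev: "eigvals jp e x = map \<xi> es" "eigvals jp e a = map \<alpha> es"
    using eigvals_diag[OF x es(1,2)] eigvals_diag[OF a es(1,2)] by auto
  show ?thesis
    unfolding strongly_operator_commute_def ev
  proof (intro exI[of _ es] conjI)
    show "jordan_frame jp e es" using es f by (simp add: jordan_frame_iff)
    show "a = frame_sum (map \<alpha> es) es" using frame_sum_map[OF es(1), of \<alpha>] diag_sum[OF a] es(2) by simp
    show "x = frame_sum (map \<xi> es) es" using frame_sum_map[OF es(1), of \<xi>] diag_sum[OF x] es(2) by simp
  qed
qed

lemma strongly_operator_commuteD:
  assumes "strongly_operator_commute jp e a x"
  obtains es where "jordan_frame jp e es" "length es = rk"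
    "a = frame_sum (eigvals jp e a) es" "x = frame_sum (eigvals jp e x) es"
proof -
  obtain es where es: "jordan_frame jp e es"
    "a = frame_sum (eigvals jp e a) es" "x = frame_sum (eigvals jp e x) es"
    using assms unfolding strongly_operator_commute_def by blast
  moreover have "length es = rk"
    using es(1) rank_card[of "set es"] by (simp add: jordan_frame_iff distinct_card)
  ultimately show thesis using that by blast
qed

end

section \<open>Exponentials of skew maps\<close>

text \<open>Defined vector by vector, so that convergence concerns only series of vectors.\<close>

definition lexp :: "('a::euclidean_space \<Rightarrow> 'a) \<Rightarrow> 'a \<Rightarrow> 'a" where
  "lexp A v = (\<Sum>n. (1 / fact n) *\<^sub>R (A ^^ n) v)"

lemma funpow_norm_bound:
  fixes A :: "'a::real_normed_vector \<Rightarrow> 'a"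
  assumes "\<And>v. norm (A v) \<le> K * norm v" "K \<ge> 0"
  shows "norm ((A ^^ n) v) \<le> K ^ n * norm v"
proof (induction n)
  case (Suc n)
  have "norm ((A ^^ Suc n) v) \<le> K * norm ((A ^^ n) v)" using assms(1) by simp
  also have "\<dots> \<le> K * (K ^ n * norm v)" by (rule mult_left_mono[OF Suc assms(2)])
  finally show ?case by (simp add: mult_ac)
qed simp

lemma exp_sums_real: "(\<lambda>n. K ^ n / fact n * c) sums (exp K * (c::real))"
  using sums_mult2[OF exp_converges[of K], of c] by (simp add: field_simps)

lemma lexp_term_bound:
  fixes A :: "'a::euclidean_space \<Rightarrow> 'a"
  assumes "\<And>v. norm (A v) \<le> K * norm v" "K \<ge> 0"
  shows "norm ((1 / fact n) *\<^sub>R (A ^^ n) v) \<le> K ^ n / fact n * norm v"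
  using funpow_norm_bound[OF assms, of n v] by (simp add: divide_right_mono)

lemma linear_bound:
  fixes A :: "'a::euclidean_space \<Rightarrow> 'a"
  assumes "linear A" obtains K where "K \<ge> 0" "\<And>v. norm (A v) \<le> K * norm v"
  using onorm[of A] onorm_pos_le[of A] assms linear_conv_bounded_linear by metis

lemma lexp_summable:
  fixes A :: "'a::euclidean_space \<Rightarrow> 'a"
  assumes "linear A" shows "summable (\<lambda>n. (1 / fact n) *\<^sub>R (A ^^ n) v)"
proof -
  obtain K where K: "K \<ge> 0" "\<And>v. norm (A v) \<le> K * norm v" by (rule linear_bound[OF assms]) (rule that)
  show ?thesis
  proof (rule summable_comparison_test)
    show "\<exists>N. \<forall>n\<ge>N. norm ((1 / fact n) *\<^sub>R (A ^^ n) v) \<le> K ^ n / fact n * norm v"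
      using lexp_term_bound[OF K(2,1)] by blast
    show "summable (\<lambda>n. K ^ n / fact n * norm v)" using exp_sums_real sums_summable by blast
  qed
qed

lemma lexp_sums: "linear A \<Longrightarrow> (\<lambda>n. (1 / fact n) *\<^sub>R (A ^^ n) v) sums lexp A v"
  unfolding lexp_def by (rule summable_sums[OF lexp_summable])

lemma funpow_linear: "linear A \<Longrightarrow> linear (A ^^ n)"
  for A :: "'a::real_vector \<Rightarrow> 'a"
proof (induction n)
  case 0 show ?case by (rule linearI) simp_all
next
  case (Suc n)
  then show ?case using linear_compose[of "A ^^ n" A] by (simp add: o_def)
qed

lemma lexp_linear:
  assumes A: "linear A" shows "linear (lexp A)"
proof (rule linearI)
  fix u v r
  have "(\<lambda>n. (1 / fact n) *\<^sub>R (A ^^ n) (u + v)) sums (lexp A u + lexp A v)"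
    using sums_add[OF lexp_sums[OF A, of u] lexp_sums[OF A, of v]]
    by (simp add: linear_add[OF funpow_linear[OF A]] scaleR_add_right)
  thus "lexp A (u + v) = lexp A u + lexp A v" using lexp_sums[OF A] sums_unique2 by blast
  have "(\<lambda>n. (1 / fact n) *\<^sub>R (A ^^ n) (r *\<^sub>R u)) sums (r *\<^sub>R lexp A u)"
    using sums_scaleR_right[OF lexp_sums[OF A, of u], of r]
    by (simp add: linear_scale[OF funpow_linear[OF A]] mult.commute)
  thus "lexp A (r *\<^sub>R u) = r *\<^sub>R lexp A u" using lexp_sums[OF A] sums_unique2 by blast
qed

lemma lexp_fixed:
  assumes A: "linear A" and "A v = 0" shows "lexp A v = v"
proof -
  have "(A ^^ n) v = (if n = 0 then v else 0)" for n
    by (induction n) (use assms linear_0 in auto)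
  hence "(\<lambda>n. (1 / fact n) *\<^sub>R (A ^^ n) v) = (\<lambda>n. if n = 0 then v else 0)" by auto
  moreover have "\<dots> sums v" using sums_If_finite_set[of "{0::nat}" "\<lambda>_. v"] by simp
  ultimately show ?thesis using lexp_sums[OF A, of v] sums_unique2 by metis
qed

lemma lexp_remainder:
  assumes A: "linear A" and K: "\<And>v. norm (A v) \<le> K * norm v" "K \<ge> 0"
  shows "norm (lexp A v - v - A v) \<le> K\<^sup>2 * (exp K * norm v)"
proof -
  let ?f = "\<lambda>n. (1 / fact n) *\<^sub>R (A ^^ n) v"
  have "lexp A v = (\<Sum>n. ?f (n + 2)) + (\<Sum>i<2. ?f i)"
    unfolding lexp_def by (rule suminf_split_initial_segment[OF lexp_summable[OF A]])
  also have "(\<Sum>i<2. ?f i) = v + A v" by (simp add: numeral_2_eq_2)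
  finally have eq: "lexp A v - v - A v = (\<Sum>n. ?f (n + 2))" by simp
  have b: "norm (?f (n + 2)) \<le> K\<^sup>2 * (K ^ n / fact n * norm v)" for n
  proof -
    have "norm (?f (n + 2)) \<le> K ^ (n + 2) / fact (n + 2) * norm v" by (rule lexp_term_bound[OF K])
    also have "\<dots> \<le> K ^ (n + 2) / fact n * norm v"
      using K(2) by (intro mult_right_mono divide_left_mono fact_mono) auto
    finally show ?thesis by (simp add: power_add power2_eq_square mult_ac)
  qed
  have s: "(\<lambda>n. K\<^sup>2 * (K ^ n / fact n * norm v)) sums (K\<^sup>2 * (exp K * norm v))"
    by (rule sums_mult[OF exp_sums_real])
  have "norm (\<Sum>n. ?f (n + 2)) \<le> (\<Sum>n. K\<^sup>2 * (K ^ n / fact n * norm v))"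
    by (rule norm_suminf_le[OF b sums_summable[OF s]])
  thus ?thesis unfolding eq using sums_unique[OF s] by simp
qed

lemma funpow_scaleR:
  fixes A :: "'a::real_vector \<Rightarrow> 'a"
  assumes A: "linear A" shows "((\<lambda>w. t *\<^sub>R A w) ^^ n) v = t ^ n *\<^sub>R (A ^^ n) v"
  by (induction n) (simp_all add: linear_scale[OF A] mult.commute)

text \<open>Each coordinate of the curve is a power series in \<open>t\<close>, differentiated term
  by term.\<close>

lemma lexp_flow:
  fixes A :: "'a::euclidean_space \<Rightarrow> 'a"
  assumes A: "linear A"
  shows "((\<lambda>t. lexp (\<lambda>w. t *\<^sub>R A w) v) has_vector_derivative A (lexp (\<lambda>w. t *\<^sub>R A w) v)) (at t)"
proof -
  have lin: "linear (\<lambda>w. s *\<^sub>R A w)" for s using linear_compose_scale_right[OF A] .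
  have ss: "(\<lambda>n. (s ^ n / fact n) *\<^sub>R (A ^^ n) v) sums lexp (\<lambda>w. s *\<^sub>R A w) v" for s
    using lexp_sums[OF lin, of s v] by (simp add: funpow_scaleR[OF A])
  show ?thesis
    unfolding has_vector_derivative_def
  proof (subst has_derivative_componentwise_within, intro ballI)
    fix b :: 'a assume "b \<in> Basis"
    define c where "c = (\<lambda>n. inner ((A ^^ n) v) b / fact n)"
    have cs: "(\<lambda>n. c n * s ^ n) sums inner (lexp (\<lambda>w. s *\<^sub>R A w) v) b" for s
      using bounded_linear.sums[OF bounded_linear_inner_left ss[of s], of b] by (simp add: c_def mult.commute)
    have eq: "(\<lambda>s. inner (lexp (\<lambda>w. s *\<^sub>R A w) v) b) = (\<lambda>s. \<Sum>n. c n * s ^ n)"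
      using cs sums_unique by blast
    have "bounded_linear A" using A linear_conv_bounded_linear by blast
    from bounded_linear.sums[OF bounded_linear_inner_left bounded_linear.sums[OF this ss[of t]], of b]
    have "(\<lambda>n. diffs c n * t ^ n) sums inner (A (lexp (\<lambda>w. t *\<^sub>R A w) v)) b"
      by (simp add: diffs_def c_def linear_scale[OF A] mult.commute)
    hence d: "(\<Sum>n. diffs c n * t ^ n) = inner (A (lexp (\<lambda>w. t *\<^sub>R A w) v)) b"
      by (rule sums_unique[symmetric])
    have "((\<lambda>s. \<Sum>n. c n * s ^ n) has_field_derivative (\<Sum>n. diffs c n * t ^ n)) (at t)"
      by (rule termdiffs_strong_converges_everywhere) (use cs sums_summable in blast)
    thus "((\<lambda>s. inner (lexp (\<lambda>w. s *\<^sub>R A w) v) b) has_derivative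
        (\<lambda>s. inner (s *\<^sub>R A (lexp (\<lambda>w. t *\<^sub>R A w) v)) b)) (at t)"
      unfolding eq d has_field_derivative_def inner_scaleR_left
      by (rule has_derivative_eq_rhs) (simp add: fun_eq_iff)
  qed
qed

lemma lexp_zero: "lexp (\<lambda>w. 0) v = v"
  by (rule lexp_fixed) (simp_all add: linear_zero)

lemma skew_inner_zero: "(\<And>u v. inner (A u) v = - inner u (A v)) \<Longrightarrow> inner u (A u) = (0::real)"
  by (metis add.inverse_inverse inner_commute neg_equal_zero)

text \<open>The derivative of the squared norm pairs \<open>\<phi> t\<close> with
  \<open>A (\<phi> t)\<close>. Besides isometry this yields uniqueness for the linear
  equation.\<close>

lemma skew_flow_norm:
  fixes \<phi> :: "real \<Rightarrow> 'a::euclidean_space"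
  assumes skew: "\<And>u v. inner (A u) v = - inner u (A v)"
    and \<phi>: "\<And>t. (\<phi> has_vector_derivative A (\<phi> t)) (at t)"
  shows "inner (\<phi> t) (\<phi> t) = inner (\<phi> 0) (\<phi> 0)"
proof -
  have "((\<lambda>t. inner (\<phi> t) (\<phi> t)) has_vector_derivative 0) (at t)" for t
    using bounded_bilinear.has_vector_derivative[OF bounded_bilinear_inner \<phi> \<phi>, of t]
      skew_inner_zero[of A "\<phi> t", OF skew] by (simp add: inner_commute)
  hence "((\<lambda>t. inner (\<phi> t) (\<phi> t)) has_real_derivative 0) (at t)" for t
    by (simp add: has_real_derivative_iff_has_vector_derivative)
  thus ?thesis by (rule DERIV_isconst_all[rule_format]) 
qed

lemma lexp_isometry:
  assumes A: "linear A" and skew: "\<And>u v. inner (A u) v = - inner u (A v)"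
  shows "inner (lexp A v) (lexp A v) = inner v v"
  using skew_flow_norm[OF skew lexp_flow[OF A, of v], of 1] by (simp add: lexp_zero)

text \<open>The defect \<open>G\<close> solves the same linear equation and starts at zero, so
  conservation of its norm keeps it zero. This is what turns skew derivations into
  automorphisms.\<close>

lemma lexp_bilinear:
  assumes A: "linear A" and skew: "\<And>u v. inner (A u) v = - inner u (A v)"
    and b: "bilinear b" and deriv: "\<And>u v. A (b u v) = b (A u) v + b u (A v)"
  shows "lexp A (b u v) = b (lexp A u) (lexp A v)"
proof -
  define G where "G = (\<lambda>t. b (lexp (\<lambda>w. t *\<^sub>R A w) u) (lexp (\<lambda>w. t *\<^sub>R A w) v) - lexp (\<lambda>w. t *\<^sub>R A w) (b u v))"
  have "bounded_bilinear b" using b bilinear_conv_bounded_bilinear by blast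
  note d = bounded_bilinear.has_vector_derivative[OF this lexp_flow[OF A, of u] lexp_flow[OF A, of v]]
  have "(G has_vector_derivative A (G t)) (at t)" for t
    using has_vector_derivative_diff[OF d lexp_flow[OF A, of "b u v"], of t]
    by (simp add: G_def linear_diff[OF A] deriv add.commute)
  from skew_flow_norm[OF skew this, of 1] have "inner (G 1) (G 1) = inner (G 0) (G 0)" .
  moreover have "G 0 = 0" by (simp add: G_def lexp_zero)
  ultimately have "G 1 = 0" by simp
  thus ?thesis by (simp add: G_def)
qed

lemma bilinear_bound:
  fixes \<alpha> :: "'a::euclidean_space \<Rightarrow> 'b::euclidean_space \<Rightarrow> 'c::euclidean_space"
  assumes "bilinear \<alpha>" obtains K where "K \<ge> 0" "\<And>d v. norm (\<alpha> d v) \<le> K * norm d * norm v"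
proof -
  have "bounded_bilinear \<alpha>" using assms bilinear_conv_bounded_bilinear by blast
  from bounded_bilinear.nonneg_bounded[OF this] that show thesis
    by (metis mult.commute mult.left_commute)
qed

text \<open>On the unit ball the maps \<open>\<alpha> d\<close> share the bound \<open>K\<close>, so
  the exponential series converges uniformly.\<close>

lemma lexp_continuous_param:
  fixes \<alpha> :: "'b::euclidean_space \<Rightarrow> 'a::euclidean_space \<Rightarrow> 'a"
  assumes \<alpha>: "bilinear \<alpha>"
  shows "continuous_on (ball 0 1) (\<lambda>d. lexp (\<alpha> d) v)"
proof -
  obtain K where K: "K \<ge> 0" "\<And>d v. norm (\<alpha> d v) \<le> K * norm d * norm v" by (rule bilinear_bound[OF \<alpha>]) (rule that)
  have bb: "bounded_bilinear \<alpha>" using \<alpha> bilinear_conv_bounded_bilinear by blast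
  have c: "continuous_on (ball 0 1) (\<lambda>d. (\<alpha> d ^^ n) v)" for n
  proof (induction n)
    case (Suc n)
    have "continuous_on (ball 0 1) (\<lambda>d. \<alpha> d ((\<alpha> d ^^ n) v))"
      by (rule bounded_bilinear.continuous_on[OF bb continuous_on_id Suc])
    thus ?case by simp
  qed simp
  have "uniform_limit (ball 0 1) (\<lambda>n d. \<Sum>i<n. (1 / fact i) *\<^sub>R (\<alpha> d ^^ i) v)
      (\<lambda>d. \<Sum>i. (1 / fact i) *\<^sub>R (\<alpha> d ^^ i) v) sequentially"
  proof (rule Weierstrass_m_test[where M = "\<lambda>n. K ^ n / fact n * norm v"])
    fix n and d :: 'b assume d: "d \<in> ball 0 1"
    have "norm (\<alpha> d w) \<le> K * norm w" for w
    proof -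
      have "K * norm d * norm w \<le> K * 1 * norm w"
        using d K(1) by (intro mult_right_mono mult_left_mono) auto
      with K(2)[of d w] show ?thesis by simp
    qed
    thus "norm ((1 / fact n) *\<^sub>R (\<alpha> d ^^ n) v) \<le> K ^ n / fact n * norm v"
      by (rule lexp_term_bound) (rule K(1))
  next
    show "summable (\<lambda>n. K ^ n / fact n * norm v)" using exp_sums_real sums_summable by blast
  qed
  thus ?thesis unfolding lexp_def
    by (rule uniform_limit_theorem[rotated]) (auto intro!: always_eventually continuous_intros c)
qed

lemma lexp_derivative_param:
  fixes \<alpha> :: "'b::euclidean_space \<Rightarrow> 'a::euclidean_space \<Rightarrow> 'a"
  assumes \<alpha>: "bilinear \<alpha>"
  shows "((\<lambda>d. lexp (\<alpha> d) v) has_derivative (\<lambda>d. \<alpha> d v)) (at 0)"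
proof -
  obtain K where K: "K \<ge> 0" "\<And>d v. norm (\<alpha> d v) \<le> K * norm d * norm v" by (rule bilinear_bound[OF \<alpha>]) (rule that)
  have bb: "bounded_bilinear \<alpha>" using \<alpha> bilinear_conv_bounded_bilinear by blast
  have \<alpha>0: "\<alpha> 0 = (\<lambda>w. 0)" using bilinear_lzero[OF \<alpha>] by auto
  have r: "norm (lexp (\<alpha> d) v - v - \<alpha> d v) \<le> (K * norm d)\<^sup>2 * (exp (K * norm d) * norm v)" for d
  proof (rule lexp_remainder)
    show "linear (\<alpha> d)" using \<alpha> by (simp add: bilinear_def)
  qed (use K in auto)
  show ?thesis
  proof (rule has_derivativeI)
    show "bounded_linear (\<lambda>d. \<alpha> d v)" by (rule bounded_bilinear.bounded_linear_left[OF bb])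
    have "isCont (\<lambda>d::'b. norm d * (K\<^sup>2 * (exp (K * norm d) * norm v))) 0"
      by (intro continuous_intros)
    hence t: "((\<lambda>d::'b. norm d * (K\<^sup>2 * (exp (K * norm d) * norm v))) \<longlongrightarrow> 0) (at 0)"
      by (simp add: isCont_def)
    have le: "norm (((lexp (\<alpha> d) v - lexp (\<alpha> 0) v) - \<alpha> (d - 0) v) /\<^sub>R norm (d - 0))
        \<le> norm d * (K\<^sup>2 * (exp (K * norm d) * norm v))" if "d \<noteq> 0" for d
    proof -
      have "norm (((lexp (\<alpha> d) v - lexp (\<alpha> 0) v) - \<alpha> (d - 0) v) /\<^sub>R norm (d - 0))
         = norm (lexp (\<alpha> d) v - v - \<alpha> d v) / norm d"
        by (simp add: \<alpha>0 lexp_zero divide_inverse mult.commute)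
      also have "\<dots> \<le> (K * norm d)\<^sup>2 * (exp (K * norm d) * norm v) / norm d"
        by (rule divide_right_mono[OF r]) simp
      also have "\<dots> = norm d * (K\<^sup>2 * (exp (K * norm d) * norm v))"
        using that by (simp add: power2_eq_square)
      finally show ?thesis .
    qed
    show "((\<lambda>d. ((lexp (\<alpha> d) v - lexp (\<alpha> 0) v) - \<alpha> (d - 0) v) /\<^sub>R norm (d - 0)) \<longlongrightarrow> 0) (at 0)"
      by (rule Lim_null_comparison[OF _ t]) (use le in \<open>auto simp: eventually_at_filter\<close>)
  qed
qed

lemma orthonormal_projection:
  fixes T :: "'a::euclidean_space set"
  assumes "subspace T"
  obtains B where "finite B" "B \<subseteq> T" "\<And>d. d \<in> T \<Longrightarrow> (\<Sum>b\<in>B. inner d b *\<^sub>R b) = d"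
    "\<And>d w. w \<in> T \<Longrightarrow> inner (d - (\<Sum>b\<in>B. inner d b *\<^sub>R b)) w = 0"
proof -
  obtain B where B: "B \<subseteq> T" "pairwise orthogonal B" "\<And>x. x \<in> B \<Longrightarrow> norm x = 1" "independent B" "span B = T"
    using orthonormal_basis_subspace[OF assms] by metis
  have fin: "finite B" using B(4) independent_imp_finite by blast
  define p where "p = (\<lambda>d. \<Sum>b\<in>B. inner d b *\<^sub>R b)"
  have pb: "inner (p d) c = inner d c" if c: "c \<in> B" for d c
  proof -
    have "inner (p d) c = (\<Sum>b\<in>B. if b = c then inner d c else 0)"
      unfolding p_def inner_sum_left
    proof (rule sum.cong[OF refl])
      fix b assume b: "b \<in> B"
      show "inner (inner d b *\<^sub>R b) c = (if b = c then inner d c else 0)"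
        using B(2,3) b c by (auto simp: pairwise_def orthogonal_def dot_square_norm)
    qed
    thus ?thesis using fin c by simp
  qed
  have orth: "inner (d - p d) w = 0" if "w \<in> T" for d w
  proof -
    have "w \<in> span B" using that B(5) by simp
    thus ?thesis
      by (induction rule: span_induct_alt) (auto simp: inner_add_right inner_diff_left pb)
  qed
  have pT: "p d \<in> T" for d unfolding p_def using B(1) assms
    by (intro subspace_sum subspace_scale) auto
  have "p d = d" if "d \<in> T" for d
  proof -
    have "d - p d \<in> T" using that pT assms by (simp add: subspace_diff)
    from orth[OF this, of d] show ?thesis by simp
  qed
  with that[OF fin B(1)] orth show thesis unfolding p_def by blast
qed

text \<open>The map \<open>d \<mapsto> exp (\<alpha> d) x - exp (\<beta> d) a\<close> stays in \<open>x - a + T\<close>, where its derivative at \<open>0\<close>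
  is the projection onto \<open>T\<close>; adding the orthogonal component of \<open>d\<close> makes the derivative the identity.\<close>

lemma lexp_difference_open:
  fixes x a :: "'a::euclidean_space"
  assumes T: "subspace T" and \<epsilon>: "\<epsilon> > 0"
    and add: "\<And>A B. A \<in> D \<Longrightarrow> B \<in> D \<Longrightarrow> (\<lambda>v. A v + B v) \<in> D"
    and scale: "\<And>A r. A \<in> D \<Longrightarrow> (\<lambda>v. r *\<^sub>R A v) \<in> D" and zero: "(\<lambda>v. 0) \<in> D"
    and lin: "\<And>A. A \<in> D \<Longrightarrow> linear A"
    and iso: "\<And>A v. A \<in> D \<Longrightarrow> norm (lexp A v) = norm v"
    and T_eq: "\<And>d. d \<in> T \<Longrightarrow> \<exists>A\<in>D. \<exists>B\<in>D. d = A x - B a"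
    and T_sub: "\<And>A B. A \<in> D \<Longrightarrow> B \<in> D \<Longrightarrow> lexp A x - lexp B a - (x - a) \<in> T"
  obtains \<delta> where "\<delta> > 0"
    "\<And>z. z - (x - a) \<in> T \<Longrightarrow> norm (z - (x - a)) < \<delta> \<Longrightarrow>
       \<exists>A\<in>D. \<exists>B\<in>D. lexp A x - lexp B a = z \<and> norm (lexp A x - lexp B x) < \<epsilon>"
proof -
  obtain B where B: "finite B" "B \<subseteq> T" "\<And>d. d \<in> T \<Longrightarrow> (\<Sum>b\<in>B. inner d b *\<^sub>R b) = d"
    "\<And>d w. w \<in> T \<Longrightarrow> inner (d - (\<Sum>b\<in>B. inner d b *\<^sub>R b)) w = 0"
    by (rule orthonormal_projection[OF T]) (rule that)
  have "\<forall>b\<in>B. \<exists>P Q. P \<in> D \<and> Q \<in> D \<and> b = P x - Q a" using T_eq B(2) by blast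
  then obtain P Q where PQ: "\<And>b. b \<in> B \<Longrightarrow> P b \<in> D \<and> Q b \<in> D \<and> b = P b x - Q b a" by metis
  \<comment> \<open>Choosing \<open>P\<close> and \<open>Q\<close> only on an orthonormal basis and
    extending linearly makes \<open>\<alpha> d\<close> and \<open>\<beta> d\<close> linear in
    \<open>d\<close>, with \<open>\<alpha> d x - \<beta> d a\<close> equal to the projection of
    \<open>d\<close> onto \<open>T\<close>.\<close>
  define \<alpha> \<beta> \<pi> where "\<alpha> = (\<lambda>d v. \<Sum>b\<in>B. inner d b *\<^sub>R P b v)" and "\<beta> = (\<lambda>d v. \<Sum>b\<in>B. inner d b *\<^sub>R Q b v)"
    and "\<pi> = (\<lambda>d. \<Sum>b\<in>B. inner d b *\<^sub>R b)"
  have sumD: "(\<lambda>v. \<Sum>b\<in>C. inner d b *\<^sub>R R b v) \<in> D" if "\<And>b. b \<in> B \<Longrightarrow> R b \<in> D" "C \<subseteq> B" for R d C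
    using finite_subset[OF that(2) B(1)] that(2)
  proof (induction C rule: finite_induct)
    case empty show ?case by (simp add: zero)
  next
    case (insert c C)
    then show ?case using add[OF scale[OF that(1)[of c]], of "\<lambda>v. \<Sum>b\<in>C. inner d b *\<^sub>R R b v"] by simp
  qed
  have D: "\<alpha> d \<in> D" "\<beta> d \<in> D" for d
    unfolding \<alpha>_def \<beta>_def using PQ by (auto intro!: sumD)
  have bil: "bilinear (\<lambda>d v. \<Sum>b\<in>B. inner d b *\<^sub>R R b v)" if R: "\<And>b. b \<in> B \<Longrightarrow> linear (R b)" for R :: "'a \<Rightarrow> 'a \<Rightarrow> 'a"
    unfolding bilinear_def
    by (auto intro!: linearI simp: linear_add[OF R] linear_scale[OF R] inner_add_left algebra_simps
        sum.distrib scaleR_sum_right)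
  have ba: "bilinear \<alpha>" and bb: "bilinear \<beta>" unfolding \<alpha>_def \<beta>_def
    using PQ lin by (auto intro!: bil)
  have ab: "\<alpha> d x - \<beta> d a = \<pi> d" for d
    unfolding \<alpha>_def \<beta>_def \<pi>_def sum_subtractf[symmetric] scaleR_diff_right[symmetric]
    using PQ by (intro sum.cong refl) metis
  have \<pi>l: "bounded_linear \<pi>"
    unfolding \<pi>_def by (intro bounded_linear_sum bounded_linear_scaleR_const bounded_linear_inner_left)
  define f where "f = (\<lambda>d. lexp (\<alpha> d) x - lexp (\<beta> d) a + (d - \<pi> d))"
  have "\<alpha> 0 = (\<lambda>v. 0)" "\<beta> 0 = (\<lambda>v. 0)" using bilinear_lzero[OF ba] bilinear_lzero[OF bb] by auto
  hence f0: "f 0 = x - a" and g0: "lexp (\<alpha> 0) x - lexp (\<beta> 0) x = 0"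
    using linear_0[OF bounded_linear.linear[OF \<pi>l]] by (simp_all add: f_def lexp_zero)
  have cf: "continuous_on (ball 0 1) f" unfolding f_def
    by (intro continuous_intros lexp_continuous_param ba bb linear_continuous_on \<pi>l)
  have cg: "continuous_on (ball 0 1) (\<lambda>d. lexp (\<alpha> d) x - lexp (\<beta> d) x)"
    by (intro continuous_intros lexp_continuous_param ba bb)
  have "(f has_derivative (\<lambda>d. \<alpha> d x - \<beta> d a + (d - \<pi> d))) (at 0)" unfolding f_def
    by (intro has_derivative_add has_derivative_diff lexp_derivative_param ba bb
        has_derivative_ident bounded_linear_imp_has_derivative \<pi>l)
  hence df: "(f has_derivative id) (at 0)" by (simp add: ab id_def)
  have "((\<lambda>d. norm (lexp (\<alpha> d) x - lexp (\<beta> d) x)) \<longlongrightarrow> norm (lexp (\<alpha> 0) x - lexp (\<beta> 0) x)) (at 0)"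
    using cg by (intro tendsto_norm) (simp add: continuous_on_eq_continuous_at isCont_def)
  hence "\<forall>\<^sub>F d in at 0. norm (lexp (\<alpha> d) x - lexp (\<beta> d) x) < \<epsilon>"
    using \<epsilon> g0 by (intro order_tendstoD(2)) auto
  then obtain r where r: "r > 0" "\<And>d. d \<noteq> 0 \<Longrightarrow> norm d < r \<Longrightarrow> norm (lexp (\<alpha> d) x - lexp (\<beta> d) x) < \<epsilon>"
    unfolding eventually_at by auto
  define s where "s = min (r / 2) (1 / 2)"
  have s: "s > 0" "s < r" "s < 1" using r(1) by (auto simp: s_def)
  \<comment> \<open>\<open>f\<close> is known to be continuous near 0 and differentiable at 0; this
    open mapping theorem asks for no more.\<close>
  have "f 0 \<in> interior (f ` cball 0 s)"
    by (rule sussmann_open_mapping[OF open_ball cf _ df, of "\<lambda>x. x"])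
      (use s in \<open>auto simp: bounded_linear_ident o_def id_def\<close>)
  then obtain \<delta> where \<delta>: "\<delta> > 0" "ball (x - a) \<delta> \<subseteq> f ` cball 0 s"
    unfolding f0 mem_interior by blast
  show thesis
  proof (rule that[OF \<delta>(1)])
    fix z assume z: "z - (x - a) \<in> T" "norm (z - (x - a)) < \<delta>"
    hence "z \<in> ball (x - a) \<delta>" by (simp add: dist_norm norm_minus_commute)
    then obtain d where d: "norm d \<le> s" "z = f d" using \<delta>(2) by auto
    \<comment> \<open>The right side lies in \<open>T\<close> while \<open>d - \<pi> d\<close> is
      orthogonal to \<open>T\<close>, so the correction vanishes.\<close>
    have "d - \<pi> d = (z - (x - a)) - (lexp (\<alpha> d) x - lexp (\<beta> d) a - (x - a))"
      unfolding d(2) f_def by simp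
    also have "\<dots> \<in> T" by (rule subspace_diff[OF T z(1) T_sub[OF D]])
    finally have "inner (d - \<pi> d) (d - \<pi> d) = 0" using B(4) unfolding \<pi>_def by blast
    hence "lexp (\<alpha> d) x - lexp (\<beta> d) a = z" using d(2) by (simp add: f_def)
    moreover have "norm (lexp (\<alpha> d) x - lexp (\<beta> d) x) < \<epsilon>"
      using r(2)[of d] d(1) s g0 \<epsilon> by (cases "d = 0") auto
    ultimately show "\<exists>A\<in>D. \<exists>B\<in>D. lexp A x - lexp B a = z \<and> norm (lexp A x - lexp B x) < \<epsilon>"
      using D by blast
  qed
qed

section \<open>Perturbations along the orbit\<close>

context simple_euclidean_jordan
begin

text \<open>By \<open>prim_iff\<close> an isometric automorphism preserves primitive idempotents and
  so carries an eigenframe to an eigenframe with the same coefficients.\<close>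

lemma eigvals_automorphism:
  assumes lin: "linear k" and mult: "\<And>u v. k (u \<odot> v) = k u \<odot> k v" and iso: "\<And>v. norm (k v) = norm v"
  shows "eigvals jp e (k x) = eigvals jp e x"
proof -
  have inj: "inj k"
    using iso linear_0[OF lin] by (metis lin linear_injective_0 norm_eq_zero)
  hence "surj k" using lin linear_injective_imp_surjective by blast
  then obtain v where v: "k v = e" by (metis surjD)
  have "k e = k e \<odot> k v" using v by simp
  also have "\<dots> = e" using mult[of e v] v by simp
  finally have ke: "k e = e" .
  obtain H \<xi> where d: "diag x H \<xi>" by (rule diag_exists)
  obtain es where es: "distinct es" "set es = H" "eigvals jp e x = map \<xi> es" by (rule diag_enumeration[OF d])
  have f: "frame H" using d by (simp add: diag_def)
  note F = frameD[OF f]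
  have inner: "inner (k h) (k h) = inner h h" for h using iso[of h] by (simp add: norm_eq_sqrt_inner)
  have injH: "inj_on k A" for A using inj inj_on_subset by blast
  have "frame (k ` H)"
    unfolding frame_def osys_def
  proof (intro conjI ballI impI)
    show "finite (k ` H)" using F(1) by simp
    show "\<Sum>(k ` H) = e" using F(7) ke by (simp add: sum.reindex[OF injH] linear_sum[OF lin, symmetric] o_def)
  next
    fix g assume "g \<in> k ` H"
    then obtain h where h: "h \<in> H" "g = k h" by blast
    have "g \<odot> g = g" using mult[of h h] F(4)[OF h(1)] h(2) by simp
    moreover have "inner g g = \<kappa>" unfolding h(2) inner using prim_norm[OF F(3)[OF h(1)]] .
    ultimately show "primitive_idempotent jp g" by (simp add: prim_iff)
    thus "g \<noteq> 0" "g \<odot> g = g" using primD by blast+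
  next
    fix g g' assume "g \<in> k ` H" "g' \<in> k ` H" "g \<noteq> g'"
    then obtain h h' where h: "h \<in> H" "h' \<in> H" "h \<noteq> h'" "g = k h" "g' = k h'" by blast
    thus "g \<odot> g' = 0" using F(6)[OF h(1-3)] mult[of h h'] linear_0[OF lin] by simp
  qed
  hence jf: "jordan_frame jp e (map k es)"
    using es injH by (simp add: jordan_frame_iff distinct_map)
  have "k x = (\<Sum>h\<in>H. \<xi> h *\<^sub>R k h)"
    by (subst diag_sum[OF d]) (simp add: linear_sum[OF lin] linear_scale[OF lin])
  also have "\<dots> = (\<Sum>i<length es. \<xi> (es ! i) *\<^sub>R k (es ! i))"
    by (rule sum.reindex_bij_betw[OF bij_betw_nth[OF es(1) refl es(2)[symmetric]], symmetric])
  also have "\<dots> = frame_sum (map \<xi> es) (map k es)" by (simp add: frame_sum_def)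
  finally show ?thesis
    using eigvals_eqI[OF jf, of "eigvals jp e x" "k x"] es(3) eigvals_sorted[of x] by simp
qed

text \<open>Skewness makes the exponentials isometries; vanishing on \<open>G\<close> makes them fix
  \<open>G\<close> and preserve \<open>W G\<close>.\<close>

definition ders :: "'a set \<Rightarrow> ('a \<Rightarrow> 'a) set" where
  "ders G = {A. linear A \<and> (\<forall>u v. A (u \<odot> v) = A u \<odot> v + u \<odot> A v) \<and>
     (\<forall>u v. inner (A u) v = - inner u (A v)) \<and> (\<forall>g\<in>G. A g = 0)}"

lemma ders_add: "A \<in> ders G \<Longrightarrow> B \<in> ders G \<Longrightarrow> (\<lambda>v. A v + B v) \<in> ders G"
  by (auto simp: ders_def jlin linear_compose_add inner_add_left inner_add_right)

lemma ders_scale: "A \<in> ders G \<Longrightarrow> (\<lambda>v. r *\<^sub>R A v) \<in> ders G"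
  by (auto simp: ders_def jlin linear_compose_scale_right scaleR_add_right)

lemma ders_zero: "(\<lambda>v. 0) \<in> ders G"
  by (auto simp: ders_def linear_zero)

lemma lexp_ders:
  assumes "A \<in> ders G"
  shows "linear (lexp A)" "lexp A (u \<odot> v) = lexp A u \<odot> lexp A v" "norm (lexp A v) = norm v"
    "inner (lexp A u) (lexp A v) = inner u v" "g \<in> G \<Longrightarrow> lexp A g = g"
proof -
  have A: "linear A" "\<And>u v. A (u \<odot> v) = A u \<odot> v + u \<odot> A v" "\<And>u v. inner (A u) v = - inner u (A v)"
    "\<And>g. g \<in> G \<Longrightarrow> A g = 0" using assms by (auto simp: ders_def)
  show l: "linear (lexp A)" by (rule lexp_linear[OF A(1)])
  show "lexp A (u \<odot> v) = lexp A u \<odot> lexp A v" by (rule lexp_bilinear[OF A(1,3) bilinear_jp A(2)])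
  have i: "inner (lexp A v) (lexp A v) = inner v v" for v by (rule lexp_isometry[OF A(1,3)])
  show "norm (lexp A v) = norm v" using i by (simp add: norm_eq_sqrt_inner)
  show "inner (lexp A u) (lexp A v) = inner u v"
    using i[of "u + v"] i[of u] i[of v]
    by (simp add: linear_add[OF l] inner_add_left inner_add_right inner_commute)
  show "g \<in> G \<Longrightarrow> lexp A g = g" by (rule lexp_fixed[OF A(1) A(4)])
qed

lemma W_iff: 
  assumes "osys G e"
  shows "x \<in> W G \<longleftrightarrow> (\<forall>g\<in>G. \<exists>x1\<in>V1 g. \<exists>x0\<in>V0 g. x = x1 + x0)"
  using assms W_peirce_eq by (auto simp: W_def osys_def)

lemma W_subspace: "subspace (W G)"
  by (auto simp: subspace_def W_def jlin)

lemma W_mult: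
  assumes G: "osys G e" and "x \<in> W G" "y \<in> W G" shows "x \<odot> y \<in> W G"
  unfolding W_iff[OF G]
proof
  fix g assume g: "g \<in> G"
  hence gg: "g \<odot> g = g" using G by (simp add: osys_def)
  obtain x1 x0 y1 y0 where xy: "x = x1 + x0" "y = y1 + y0" "x1 \<in> V1 g" "x0 \<in> V0 g" "y1 \<in> V1 g" "y0 \<in> V0 g"
    using assms g unfolding W_iff[OF G] by meson
  have "x1 \<odot> y0 = 0" "y1 \<odot> x0 = 0" using peirce_1_0[OF gg] xy by blast+
  hence "x \<odot> y = x1 \<odot> y1 + x0 \<odot> y0" using xy(1,2) jcom[of y1 x0] by (simp add: jlin)
  thus "\<exists>x1\<in>V1 g. \<exists>x0\<in>V0 g. x \<odot> y = x1 + x0"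
    using peirce_1_1[OF gg xy(3,5)] peirce_0_0[OF gg xy(4,6)] by blast
qed

lemma V1_W:
  assumes G: "osys G e" and g: "g \<in> G" and c: "g \<odot> c = c"
  shows "c \<in> W G" "\<And>h. h \<in> G \<Longrightarrow> h \<noteq> g \<Longrightarrow> h \<odot> c = 0"
proof -
  have gg: "g \<odot> g = g" using G g by (simp add: osys_def)
  show z: "h \<odot> c = 0" if "h \<in> G" "h \<noteq> g" for h
  proof -
    have "g \<odot> h = 0" using G g that by (auto simp: osys_def)
    hence "c \<odot> h = 0" using peirce_1_0[OF gg, of c h] c by (simp add: V1_def V0_def)
    thus ?thesis using jcom[of c h] by simp
  qed
  show "c \<in> W G"
    unfolding W_def
  proof (intro CollectI ballI)
    fix h assume "h \<in> G"
    thus "h \<odot> (h \<odot> c) = h \<odot> c" using z[of h] c by (cases "h = g") auto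
  qed
qed

text \<open>Multiplications by \<open>g\<close> and by elements of \<open>W G\<close> commute, so
  the commutator sends \<open>g\<close> to
  \<open>g \<odot> (u \<odot> w) - g \<odot> (w \<odot> u)\<close>.\<close>

lemma inder_ders:
  assumes G: "osys G e" and uw: "u \<in> W G" "w \<in> W G"
  shows "inder u w \<in> ders G"
proof -
  have "inder u w g = 0" if g: "g \<in> G" for g
  proof -
    have gg: "g \<odot> g = g" using G g by (simp add: osys_def)
    have com: "g \<odot> (x \<odot> v) = x \<odot> (g \<odot> v)" if x: "x \<in> W G" for x v
    proof -
      obtain x1 x0 where "x = x1 + x0" "x1 \<in> V1 g" "x0 \<in> V0 g" using x g unfolding W_iff[OF G] by meson
      thus ?thesis using Lc_commute[OF gg, of x1 v] Lc_commute[OF gg, of x0 v] by (simp add: jlin)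
    qed
    have "u \<odot> (w \<odot> g) = g \<odot> (u \<odot> w)" using com[OF uw(1), of w] jcom[of w g] by simp
    moreover have "w \<odot> (u \<odot> g) = g \<odot> (w \<odot> u)" using com[OF uw(2), of u] jcom[of u g] by simp
    ultimately show ?thesis using jcom[of u w] by (simp add: inder_def)
  qed
  thus ?thesis using inder_linear inder_derivation inder_skew by (simp add: ders_def)
qed

lemma ders_W:
  assumes A: "A \<in> ders G" and x: "x \<in> W G" shows "A x \<in> W G" "g \<in> G \<Longrightarrow> inner (A x) g = 0"
proof -
  have d: "A (g \<odot> v) = g \<odot> A v" if "g \<in> G" for g v using A that by (simp add: ders_def)
  show "A x \<in> W G" using x by (auto simp: W_def simp flip: d)
  show "g \<in> G \<Longrightarrow> inner (A x) g = 0" using A by (simp add: ders_def)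
qed

lemma lexp_ders_W:
  assumes A: "A \<in> ders G" and x: "x \<in> W G"
  shows "lexp A x \<in> W G" "g \<in> G \<Longrightarrow> inner (lexp A x) g = inner x g"
proof -
  have d: "g \<odot> lexp A v = lexp A (g \<odot> v)" if "g \<in> G" for g v
    using lexp_ders(2)[OF A, of g v] lexp_ders(5)[OF A that] by simp
  show "lexp A x \<in> W G" using x by (auto simp: W_def d)
  show "g \<in> G \<Longrightarrow> inner (lexp A x) g = inner x g" using lexp_ders(4,5)[OF A] by metis
qed

text \<open>An element \<open>r\<close> whose multiplication operator commutes with that of \<open>x\<close> on \<open>W G\<close> leads to a
  splitting of some \<open>g \<in> G\<close> by the spectral idempotent \<open>c\<close> of the largest eigenvalue \<open>M\<close> of \<open>g \<odot> r\<close>: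
  \<open>w = c \<odot> x\<close> satisfies \<open>r \<odot> w = M w\<close>, and since \<open>M\<close> is extreme this forces \<open>c \<odot> w = w\<close>.\<close>

lemma top_idempotent_commutes:
  assumes G: "osys G e" and g: "g \<in> G" and r: "r \<in> W G" and C: "osys C g"
    and \<mu>: "\<And>c. c \<in> C \<Longrightarrow> (g \<odot> r) \<odot> c = \<mu> c *\<^sub>R c" and M: "\<And>c. c \<in> C \<Longrightarrow> \<mu> c \<le> M"
    and x: "x \<in> W G" and com: "\<And>u. u \<in> W G \<Longrightarrow> x \<odot> (u \<odot> r) = r \<odot> (u \<odot> x)"
  defines "c \<equiv> \<Sum>{c\<in>C. \<mu> c = M}"
  shows "c \<odot> (c \<odot> x) = c \<odot> x" "(g - c) \<odot> ((g - c) \<odot> x) = (g - c) \<odot> x"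
proof -
  have gg: "g \<odot> g = g" using G g by (simp add: osys_def)
  have rW: "g \<odot> (g \<odot> r) = g \<odot> r" and xW: "g \<odot> (g \<odot> x) = g \<odot> x" using r x g by (auto simp: W_def)
  have fC: "finite C" using C by (simp add: osys_def)
  let ?C1 = "{c\<in>C. \<mu> c = M}"
  have gc: "g \<odot> b = b" if "b \<in> C" for b using osys_mult(1)[OF C that] .
  have gc1: "g \<odot> c = c" unfolding c_def jsum_right using gc by (intro sum.cong) auto
  have rc: "r \<odot> c = M *\<^sub>R c"
    unfolding c_def jsum_right scaleR_sum_right
  proof (rule sum.cong[OF refl])
    fix b assume b: "b \<in> ?C1"
    thus "r \<odot> b = M *\<^sub>R b" using W_restrict[OF gg rW gc, of b] \<mu>[of b] by simp
  qed
  define w where "w = c \<odot> x"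
  have wgx: "w = c \<odot> (g \<odot> x)"
    using W_restrict[OF gg xW gc1] jcom[of c x] jcom[of c "g \<odot> x"] by (simp add: w_def)
  have gw: "g \<odot> w = w"
    using peirce_1_1[OF gg, of c "g \<odot> x"] gc1 xW unfolding wgx V1_def by blast
  \<comment> \<open>The hypothesis at \<open>u = c\<close>: \<open>w\<close> inherits from
    \<open>c\<close> the eigenvalue \<open>M\<close> of \<open>r\<close>.\<close>
  have "r \<odot> w = x \<odot> (c \<odot> r)" using com[OF V1_W(1)[OF G g gc1]] by (simp add: w_def)
  also have "\<dots> = M *\<^sub>R w" using rc jcom[of c r] jcom[of x c] by (simp add: jlin w_def)
  finally have "(g \<odot> r) \<odot> w = M *\<^sub>R w" using W_restrict[OF gg rW gw] by simp
  moreover have "g \<odot> r = (\<Sum>b\<in>C. \<mu> b *\<^sub>R b)"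
  proof -
    have "g \<odot> r = (g \<odot> r) \<odot> \<Sum>C" using C rW jcom[of "g \<odot> r" g] by (simp add: osys_def)
    also have "\<dots> = (\<Sum>b\<in>C. \<mu> b *\<^sub>R b)" unfolding jsum_right by (intro sum.cong refl \<mu>)
    finally show ?thesis .
  qed
  moreover have gsum: "(\<Sum>b\<in>C. b \<odot> w) = w" using gw C by (simp add: osys_def flip: jsum_left)
  ultimately have "(\<Sum>b\<in>C. \<mu> b *\<^sub>R (b \<odot> w)) = (\<Sum>b\<in>C. M *\<^sub>R (b \<odot> w))"
    by (simp add: jsum_left jlin flip: scaleR_sum_right)
  hence "inner (\<Sum>b\<in>C. M *\<^sub>R (b \<odot> w) - \<mu> b *\<^sub>R (b \<odot> w)) w = 0" by (simp add: sum_subtractf)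
  hence s0: "(\<Sum>b\<in>C. (M - \<mu> b) * inner (b \<odot> w) w) = 0"
    by (simp add: inner_sum_left inner_diff_left left_diff_distrib)
  have bb: "b \<odot> b = b" if "b \<in> C" for b using C that by (simp add: osys_def)
  have "\<forall>b\<in>C. (M - \<mu> b) * inner (b \<odot> w) w = 0"
    using s0 fC idem_psd(1)[OF bb] M by (subst sum_nonneg_eq_0_iff[symmetric]) auto
  hence z: "b \<odot> w = 0" if "b \<in> C" "\<mu> b \<noteq> M" for b
    using that idem_psd(2)[OF bb[OF that(1)], of w] by auto
  have "c \<odot> w = (\<Sum>b\<in>?C1. b \<odot> w)" by (simp add: c_def jsum_left)
  also have "\<dots> = (\<Sum>b\<in>C. b \<odot> w)" using fC z by (intro sum.mono_neutral_left) auto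
  finally have cw: "c \<odot> w = w" using gsum by simp
  thus "c \<odot> (c \<odot> x) = c \<odot> x" by (simp add: w_def)
  have "c \<odot> (g \<odot> x) = w" "g \<odot> (c \<odot> x) = w" "c \<odot> (c \<odot> x) = w" using wgx gw cw by (simp_all add: w_def)
  thus "(g - c) \<odot> ((g - c) \<odot> x) = (g - c) \<odot> x" using xW by (simp add: jlin w_def)
qed

text \<open>Inner derivations turn the orthogonality to \<open>A x\<close> and \<open>A a\<close>
  into the identity \<open>com\<close>. If some \<open>g \<odot> r\<close> were not a multiple of
  \<open>g\<close>, its top spectral idempotent would split \<open>g\<close> and enlarge
  \<open>G\<close>. So \<open>r\<close> is a combination of \<open>G\<close>, and it is orthogonal
  to \<open>G\<close>.\<close>

lemma W_orthogonal_zero: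
  assumes G: "osys G e" and x: "x \<in> W G" and a: "a \<in> W G"
    and max: "\<And>H. osys H e \<Longrightarrow> x \<in> W H \<Longrightarrow> a \<in> W H \<Longrightarrow> card H \<le> card G"
    and r: "r \<in> W G" "\<And>g. g \<in> G \<Longrightarrow> inner r g = 0"
    and rx: "\<And>A. A \<in> ders G \<Longrightarrow> inner (A x) r = 0" and ra: "\<And>A. A \<in> ders G \<Longrightarrow> inner (A a) r = 0"
  shows "r = 0"
proof -
  have com: "v \<odot> (u \<odot> r) = r \<odot> (u \<odot> v)"
    if v: "v \<in> W G" "\<forall>A\<in>ders G. inner (A v) r = 0" and u: "u \<in> W G" for v u
  proof -
    \<comment> \<open>Using the element to be killed as a factor of the derivation turns the
      hypothesis into \<open>inner w w = 0\<close>.\<close>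
    define w where "w = v \<odot> (u \<odot> r) - r \<odot> (u \<odot> v)"
    have wW: "w \<in> W G" unfolding w_def using W_mult[OF G] v u r W_subspace[of G] by (simp add: subspace_diff)
    have "inner (inder u w v) r = 0" by (rule v(2)[rule_format, OF inder_ders[OF G u wW]])
    moreover have "inner (inder u w v) r = inner w w"
    proof -
      have "inner (u \<odot> (w \<odot> v)) r = inner (w \<odot> v) (u \<odot> r)" by (rule jassoc_inner)
      also have "\<dots> = inner w (v \<odot> (u \<odot> r))" using jassoc_inner[of v w "u \<odot> r"] jcom[of v w] by simp
      finally have 1: "inner (u \<odot> (w \<odot> v)) r = inner w (v \<odot> (u \<odot> r))" .
      have "inner (w \<odot> (u \<odot> v)) r = inner (u \<odot> v) (w \<odot> r)" by (rule jassoc_inner)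
      also have "\<dots> = inner (r \<odot> w) (u \<odot> v)" using jcom[of r w] by (simp add: inner_commute)
      also have "\<dots> = inner w (r \<odot> (u \<odot> v))" by (rule jassoc_inner)
      finally show ?thesis using 1 unfolding inder_def by (simp add: inner_diff_left) (simp add: w_def inner_diff_right)
    qed
    ultimately show ?thesis by (simp add: w_def)
  qed
  have scalar: "\<exists>\<rho>. g \<odot> r = \<rho> *\<^sub>R g" if g: "g \<in> G" for g
  proof (rule ccontr)
    assume ns: "\<not> ?thesis"
    have gg: "g \<odot> g = g" "g \<noteq> 0" using G g by (auto simp: osys_def)
    have rW: "g \<odot> (g \<odot> r) = g \<odot> r" using r g by (auto simp: W_def)
    obtain C \<mu> where C: "osys C g" and \<mu>: "\<And>c. c \<in> C \<Longrightarrow> (g \<odot> r) \<odot> c = \<mu> c *\<^sub>R c"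
      by (rule local_spectral[OF gg(1) rW]) (rule that)
    have fC: "finite C" "C \<noteq> {}" using C gg by (auto simp: osys_def)
    define M where "M = Max (\<mu> ` C)"
    have M: "\<And>c. c \<in> C \<Longrightarrow> \<mu> c \<le> M" using fC by (simp add: M_def)
    have "M \<in> \<mu> ` C" unfolding M_def using fC by (intro Max_in) auto
    then obtain b where b: "b \<in> C" "\<mu> b = M" by auto
    define C1 where "C1 = {c\<in>C. \<mu> c = M}"
    define c where "c = \<Sum>C1"
    have o1: "osys C1 c" unfolding c_def by (rule osys_subset[OF C]) (auto simp: C1_def)
    have "\<Sum>(C - C1) = g - c" using C fC by (simp add: sum_diff C1_def c_def osys_def)
    hence o2: "osys (C - C1) (g - c)" using osys_subset[OF C, of "C - C1"] by auto
    have c0: "c \<noteq> 0"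
    proof
      assume "c = 0"
      hence "b = 0" using osys_mult(1)[OF o1, of b] b by (simp add: C1_def)
      thus False using C b(1) unfolding osys_def by blast
    qed
    have d0: "g - c \<noteq> 0"
    proof
      assume gc: "g - c = 0"
      have "C - C1 = {}"
      proof (rule ccontr)
        assume "C - C1 \<noteq> {}"
        then obtain q where q: "q \<in> C - C1" by blast
        hence "q = 0" using osys_mult(1)[OF o2 q] gc by simp
        thus False using C q unfolding osys_def by blast
      qed
      hence all: "\<And>q. q \<in> C \<Longrightarrow> \<mu> q = M" by (auto simp: C1_def)
      have "g \<odot> r = (g \<odot> r) \<odot> \<Sum>C" using C rW jcom[of "g \<odot> r" g] by (simp add: osys_def)
      also have "\<dots> = (\<Sum>b\<in>C. M *\<^sub>R b)" unfolding jsum_right using \<mu> all by (intro sum.cong) auto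
      also have "\<dots> = M *\<^sub>R g" using C by (simp add: osys_def flip: scaleR_sum_right)
      finally show False using ns by blast
    qed
    have osp: "osys {c, g - c} g" "c \<noteq> g - c"
      using osys_split[OF osys_idem[OF o1] osys_idem[OF o2] c0 d0 gg(1)] by simp_all
    define H where "H = (G - {g}) \<union> {c, g - c}"
    have oH: "osys H e" and cH: "card H + 1 = card G + card {c, g - c}"
      using osys_replace[OF G g osp(1)] by (auto simp: H_def)
    have inH: "v \<in> W H" if v: "v \<in> W G" "\<forall>A\<in>ders G. inner (A v) r = 0" for v
    proof -
      note t = top_idempotent_commutes[OF G g r(1) C \<mu> M v(1) com[OF v], folded C1_def, folded c_def]
      show ?thesis unfolding W_def H_def using v(1) t by (auto simp: W_def)
    qed
    have "card H \<le> card G" using max[OF oH] inH x a rx ra by blast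
    with cH osp(2) show False by simp
  qed
  have "r = (\<Sum>g\<in>G. g \<odot> r)" using G by (simp add: osys_def flip: jsum_left)
  hence "inner r r = (\<Sum>g\<in>G. inner r (g \<odot> r))" by (metis inner_sum_right)
  also have "\<dots> = 0"
  proof (rule sum.neutral, rule ballI)
    fix g assume g: "g \<in> G"
    obtain \<rho> where "g \<odot> r = \<rho> *\<^sub>R g" using scalar[OF g] by blast
    thus "inner r (g \<odot> r) = 0" using r(2)[OF g] by simp
  qed
  finally show ?thesis by simp
qed

text \<open>The target is reached as \<open>lexp A x - lexp B a\<close>, with both points moved.
  Pulling back along the automorphism \<open>lexp B\<close> restores \<open>a\<close>, keeps all
  eigenvalues, and moves \<open>x\<close> by the norm of \<open>lexp A x - lexp B x\<close>.\<close>

lemma orbit_difference_open: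
  assumes G: "osys G e" and x: "x \<in> W G" and a: "a \<in> W G"
    and max: "\<And>H. osys H e \<Longrightarrow> x \<in> W H \<Longrightarrow> a \<in> W H \<Longrightarrow> card H \<le> card G" and \<epsilon>: "\<epsilon> > 0"
  obtains \<delta> where "\<delta> > 0"
    "\<And>z. z - (x - a) \<in> W G \<Longrightarrow> (\<And>g. g \<in> G \<Longrightarrow> inner (z - (x - a)) g = 0) \<Longrightarrow> norm (z - (x - a)) < \<delta> \<Longrightarrow>
       \<exists>x'. eigvals jp e x' = eigvals jp e x \<and> dist x' x < \<epsilon> \<and> eigvals jp e (x' - a) = eigvals jp e z"
proof -
  define T where "T = {d \<in> W G. \<forall>g\<in>G. inner d g = 0}"
  define T' where "T' = {A x - B a |A B. A \<in> ders G \<and> B \<in> ders G}"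
  have T: "subspace T" using W_subspace[of G] by (auto simp: T_def subspace_def inner_add_left)
  have T': "subspace T'"
    unfolding subspace_def
  proof (intro conjI ballI allI)
    show "0 \<in> T'" unfolding T'_def using ders_zero by force
  next
    fix p q assume "p \<in> T'" "q \<in> T'"
    then obtain A B A' B' where "A \<in> ders G" "B \<in> ders G" "A' \<in> ders G" "B' \<in> ders G"
      "p = A x - B a" "q = A' x - B' a" unfolding T'_def by blast
    thus "p + q \<in> T'" unfolding T'_def
      by (intro CollectI exI[of _ "\<lambda>v. A v + A' v"] exI[of _ "\<lambda>v. B v + B' v"]) (simp add: ders_add)
  next
    fix r p assume "p \<in> T'"
    then obtain A B where "A \<in> ders G" "B \<in> ders G" "p = A x - B a" unfolding T'_def by blast
    thus "r *\<^sub>R p \<in> T'" unfolding T'_def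
      by (intro CollectI exI[of _ "\<lambda>v. r *\<^sub>R A v"] exI[of _ "\<lambda>v. r *\<^sub>R B v"]) (simp add: ders_scale scaleR_diff_right)
  qed
  have sub: "T' \<subseteq> T"
  proof
    fix d assume "d \<in> T'"
    then obtain A B where AB: "A \<in> ders G" "B \<in> ders G" "d = A x - B a" unfolding T'_def by blast
    show "d \<in> T" unfolding T_def AB(3)
      using ders_W[OF AB(1) x] ders_W[OF AB(2) a] W_subspace[of G]
      by (auto simp: inner_diff_left subspace_diff)
  qed
  have T_eq: "\<exists>A\<in>ders G. \<exists>B\<in>ders G. d = A x - B a" if d: "d \<in> T" for d
  proof -
    obtain B where B: "finite B" "B \<subseteq> T'" "\<And>d. d \<in> T' \<Longrightarrow> (\<Sum>b\<in>B. inner d b *\<^sub>R b) = d"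
      "\<And>d w. w \<in> T' \<Longrightarrow> inner (d - (\<Sum>b\<in>B. inner d b *\<^sub>R b)) w = 0"
      by (rule orthonormal_projection[OF T']) (rule that)
    define p where "p = (\<Sum>b\<in>B. inner d b *\<^sub>R b)"
    have pT: "p \<in> T'" unfolding p_def using B(2) T' by (intro subspace_sum subspace_scale) auto
    have rT: "d - p \<in> T" using d pT sub T by (auto intro: subspace_diff)
    have orth: "inner w (d - p) = 0" if "w \<in> T'" for w
      using B(4)[OF that, of d] by (simp add: p_def inner_commute)
    \<comment> \<open>The part of \<open>d\<close> missed by first-order variations; maximality of
      \<open>G\<close> annihilates it.\<close>
    have "d - p = 0"
    proof (rule W_orthogonal_zero[OF G x a max])
      show "d - p \<in> W G" "\<And>g. g \<in> G \<Longrightarrow> inner (d - p) g = 0" using rT by (auto simp: T_def)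
      fix A assume A: "A \<in> ders G"
      have "A x \<in> T'" unfolding T'_def using A ders_zero by force
      thus "inner (A x) (d - p) = 0" by (rule orth)
      have "- A a \<in> T'" unfolding T'_def using A ders_zero by force
      from orth[OF this] show "inner (A a) (d - p) = 0" by simp
    qed
    hence "d \<in> T'" using pT by simp
    thus ?thesis unfolding T'_def by blast
  qed
  have iso: "norm (lexp A v) = norm v" if "A \<in> ders G" for A v by (rule lexp_ders(3)[OF that])
  have lin: "linear A" if "A \<in> ders G" for A using that by (simp add: ders_def)
  have T_sub: "lexp A x - lexp B a - (x - a) \<in> T" if A: "A \<in> ders G" and B: "B \<in> ders G" for A B
    unfolding T_def
  proof (intro CollectI conjI ballI)
    show "lexp A x - lexp B a - (x - a) \<in> W G"
      using lexp_ders_W(1)[OF A x] lexp_ders_W(1)[OF B a] x a W_subspace[of G]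
      by (simp add: subspace_diff)
    show "inner (lexp A x - lexp B a - (x - a)) g = 0" if "g \<in> G" for g
      using lexp_ders_W(2)[OF A x that] lexp_ders_W(2)[OF B a that] by (simp add: inner_diff_left)
  qed
  obtain \<delta> where \<delta>: "\<delta> > 0"
    "\<And>z. z - (x - a) \<in> T \<Longrightarrow> norm (z - (x - a)) < \<delta> \<Longrightarrow>
       \<exists>A\<in>ders G. \<exists>B\<in>ders G. lexp A x - lexp B a = z \<and> norm (lexp A x - lexp B x) < \<epsilon>"
    by (rule lexp_difference_open[of T \<epsilon> "ders G" x a, OF T \<epsilon>])
      (erule (1) ders_add | erule ders_scale | rule ders_zero | erule lin | erule iso | erule T_eq
        | erule (1) T_sub | rule that, assumption+)+
  show thesis
  proof (rule that[OF \<delta>(1)])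
    fix z assume "z - (x - a) \<in> W G" "\<And>g. g \<in> G \<Longrightarrow> inner (z - (x - a)) g = 0" "norm (z - (x - a)) < \<delta>"
    then obtain A B where A: "A \<in> ders G" and B: "B \<in> ders G" 
      and z: "lexp A x - lexp B a = z" "norm (lexp A x - lexp B x) < \<epsilon>"
      using \<delta>(2)[of z] by (auto simp: T_def)
    note LA = lexp_ders[OF A] and LB = lexp_ders[OF B]
    have "inj (lexp B)"
      using LB(1,3) linear_0[OF LB(1)] by (metis linear_injective_0 norm_eq_zero)
    hence "surj (lexp B)" using LB(1) linear_injective_imp_surjective by blast
    then obtain x' where x': "lexp B x' = lexp A x" by (metis surjD)
    have "eigvals jp e x' = eigvals jp e x"
      using eigvals_automorphism[OF LB(1-3), of x'] eigvals_automorphism[OF LA(1-3), of x] x' by simp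
    moreover have "dist x' x < \<epsilon>"
      using LB(3)[of "x' - x"] z(2) x' by (simp add: dist_norm linear_diff[OF LB(1)])
    moreover have "eigvals jp e (x' - a) = eigvals jp e z"
      using eigvals_automorphism[OF LB(1-3), of "x' - a"] x' z(1) by (simp add: linear_diff[OF LB(1)])
    ultimately show "\<exists>x'. eigvals jp e x' = eigvals jp e x \<and> dist x' x < \<epsilon> \<and> eigvals jp e (x' - a) = eigvals jp e z"
      by blast
  qed
qed

lemma eigvals_eigsum_cong: "eigvals jp e x = eigvals jp e y \<Longrightarrow> eigsum k x = eigsum k y \<and> inner x e = inner y e"
  by (simp add: eigsum_def flip: eigsum_rk)

lemma maj_cong:
  "eigvals jp e z = eigvals jp e z' \<Longrightarrow> eigvals jp e y = eigvals jp e y' \<Longrightarrow> maj z y \<longleftrightarrow> maj z' y'"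
  using eigvals_eigsum_cong[of z z'] eigvals_eigsum_cong[of y y'] by (simp add: maj_def)

lemma maj_trans: "maj x y \<Longrightarrow> maj y z \<Longrightarrow> maj x z"
  by (auto simp: maj_def intro: order_trans)

text \<open>The norm clause makes the majorization strict, since equal eigenvalues give equal
  norms.\<close>

definition descends :: "'a \<Rightarrow> 'a \<Rightarrow> bool" where
  "descends a x \<longleftrightarrow> (\<forall>\<epsilon>>0. \<exists>x'. eigvals jp e x' = eigvals jp e x \<and> dist x' x < \<epsilon> \<and>
     maj (x' - a) (x - a) \<and> inner (x' - a) (x' - a) < inner (x - a) (x - a))"

definition ascends :: "'a \<Rightarrow> 'a \<Rightarrow> bool" where
  "ascends a x \<longleftrightarrow> (\<forall>\<epsilon>>0. \<exists>x'. eigvals jp e x' = eigvals jp e x \<and> dist x' x < \<epsilon> \<and>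
     maj (x - a) (x' - a) \<and> inner (x - a) (x - a) < inner (x' - a) (x' - a))"

lemma transfer_diag:
  assumes y: "diag y H \<xi>" and h: "h \<in> H" "h' \<in> H" "h \<noteq> h'"
  shows "diag (y + t *\<^sub>R (h' - h)) H (\<xi>(h := \<xi> h - t, h' := \<xi> h' + t))"
proof -
  have f: "frame H" using y by (simp add: diag_def)
  note F = frameD[OF f]
  have "(y + t *\<^sub>R (h' - h)) \<odot> k = (\<xi>(h := \<xi> h - t, h' := \<xi> h' + t)) k *\<^sub>R k" if k: "k \<in> H" for k
    using y h k F(4)[OF k] F(6)[OF h(1) k] F(6)[OF h(2) k]
    by (auto simp: diag_def jlin algebra_simps)
  thus ?thesis using f by (simp add: diag_def)
qed

text \<open>Moving \<open>t\<close> from the entry at \<open>h\<close> to that at \<open>h'\<close>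
  changes the squared norm by \<open>2 * \<kappa> * (t * (t - (\<xi> h - \<xi> h')))\<close>, whose
  sign separates the two cases.\<close>

lemma transfer_maj:
  assumes y: "diag y H \<xi>" and h: "h \<in> H" "h' \<in> H" "h \<noteq> h'"
  shows "0 < t \<Longrightarrow> t < \<xi> h - \<xi> h' \<Longrightarrow> maj (y + t *\<^sub>R (h' - h)) y \<and>
      inner (y + t *\<^sub>R (h' - h)) (y + t *\<^sub>R (h' - h)) < inner y y"
    and "t < 0 \<Longrightarrow> \<xi> h' \<le> \<xi> h \<Longrightarrow> maj y (y + t *\<^sub>R (h' - h)) \<and>
      inner y y < inner (y + t *\<^sub>R (h' - h)) (y + t *\<^sub>R (h' - h))"
proof -
  have f: "frame H" using y by (simp add: diag_def)
  note F = frameD[OF f]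
  define z where "z = y + t *\<^sub>R (h' - h)"
  note z = transfer_diag[OF y h, of t, folded z_def]
  define R where "R = H - {h, h'}"
  have HR: "H = insert h (insert h' R)" "h \<notin> R" "h' \<notin> R" using h by (auto simp: R_def)
  have R: "\<And>k. k \<in> R \<Longrightarrow> (\<xi>(h := \<xi> h - t, h' := \<xi> h' + t)) k = \<xi> k" using HR by auto
  have ww: "inner (h' - h) (h' - h) = 2 * \<kappa>"
    using frame_inner[OF f] h by (simp add: inner_diff_left inner_diff_right)
  have yw: "inner y (h' - h) = (\<xi> h' - \<xi> h) * \<kappa>"
    using diag_inner[OF y] h by (simp add: inner_diff_right left_diff_distrib)
  have "inner (y + t *\<^sub>R w) (y + t *\<^sub>R w) = inner y y + 2 * t * inner y w + t * t * inner w w" for w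
    by (simp add: inner_add_left inner_add_right inner_commute[of w y] distrib_left)
  from this[of "h' - h"] have n: "inner z z = inner y y + 2 * \<kappa> * (t * (t - (\<xi> h - \<xi> h')))"
    unfolding ww yw z_def[symmetric] by (simp add: algebra_simps)
  {
    assume t: "0 < t" "t < \<xi> h - \<xi> h'"
    have "maj z y"
      by (rule T_transform_maj[OF y z HR h(3) HR h(3) R]) (use t h in auto)
    moreover have "2 * \<kappa> * (t * (t - (\<xi> h - \<xi> h'))) < 0"
      using t kappa_pos by (intro mult_pos_neg) auto
    ultimately show "maj z y \<and> inner z z < inner y y" using n by simp
  }
  {
    assume t: "t < 0" "\<xi> h' \<le> \<xi> h"
    have "maj y z"
      by (rule T_transform_maj[OF z y HR h(3) HR h(3) R[symmetric]]) (use t h in auto)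
    moreover have "2 * \<kappa> * (t * (t - (\<xi> h - \<xi> h'))) > 0"
      using t kappa_pos by (intro mult_pos_pos mult_neg_neg) auto
    ultimately show "maj y z \<and> inner y y < inner z z" using n by simp
  }
qed

lemma common_frame_or_moves:
  "(\<exists>H \<xi> \<alpha>. diag x H \<xi> \<and> diag a H \<alpha>) \<or> (descends a x \<and> ascends a x)"
proof -
  define P where "P = (\<lambda>G. osys G e \<and> x \<in> W G \<and> a \<in> W G)"
  have "P {e}" using unit_nonzero by (auto simp: P_def osys_def W_def)
  moreover have "\<forall>C. P C \<longrightarrow> card C < Suc DIM('a)"
    using osys_card by (auto simp: P_def less_Suc_eq_le)
  ultimately obtain G where G: "P G" and max: "\<And>D. P D \<Longrightarrow> card D \<le> card G"
    using ex_has_greatest_nat[of P "{e}" card "Suc DIM('a)"] by blast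
  have oG: "osys G e" and xG: "x \<in> W G" and aG: "a \<in> W G" using G by (auto simp: P_def)
  define y where "y = x - a"
  have yG: "y \<in> W G" unfolding y_def using xG aG W_subspace[of G] by (simp add: subspace_diff)
  have under: "k \<odot> v = (g \<odot> k) \<odot> v" if "g \<odot> v = v" "k \<in> W G" "g \<in> G" for g k v
    using W_restrict[of g k v] that oG by (auto simp: W_def osys_def)
  show ?thesis
  proof (cases "\<forall>g\<in>G. \<exists>\<eta>. g \<odot> y = \<eta> *\<^sub>R g")
    \<comment> \<open>Here \<open>y\<close> is a scalar on each block, so a frame refining
      \<open>G\<close> and diagonalizing \<open>x\<close> also diagonalizes \<open>y\<close>, and
      therefore \<open>a\<close>.\<close>
    case True
    then obtain \<eta> where \<eta>: "\<And>g. g \<in> G \<Longrightarrow> g \<odot> y = \<eta> g *\<^sub>R g" by metis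
    obtain H \<xi> where H: "osys H e" "\<And>h. h \<in> H \<Longrightarrow> primitive_idempotent jp h"
      "\<And>h. h \<in> H \<Longrightarrow> x \<odot> h = \<xi> h *\<^sub>R h" "\<And>h. h \<in> H \<Longrightarrow> \<exists>g\<in>G. g \<odot> h = h"
      by (rule refine_diag[OF oG xG]) (rule that)
    have f: "frame H" using H by (simp add: frame_def)
    have "\<exists>\<nu>. y \<odot> h = \<nu> *\<^sub>R h" if h: "h \<in> H" for h
    proof -
      obtain g where g: "g \<in> G" "g \<odot> h = h" using H(4)[OF h] by blast
      have "y \<odot> h = \<eta> g *\<^sub>R h" using under[OF g(2) yG g(1)] \<eta>[OF g(1)] g(2) by (simp add: jlin)
      thus ?thesis by blast
    qed
    then obtain \<nu> where \<nu>: "\<And>h. h \<in> H \<Longrightarrow> y \<odot> h = \<nu> h *\<^sub>R h" by metis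
    have "a \<odot> h = (\<xi> h - \<nu> h) *\<^sub>R h" if h: "h \<in> H" for h
    proof -
      have "a \<odot> h = x \<odot> h - y \<odot> h" by (simp add: y_def jlin)
      thus ?thesis using H(3)[OF h] \<nu>[OF h] by (simp add: scaleR_diff_left)
    qed
    hence "diag x H \<xi>" "diag a H (\<lambda>h. \<xi> h - \<nu> h)" using f H(3) by (auto simp: diag_def)
    thus ?thesis by blast
  next
    case False
    then obtain g where g: "g \<in> G" and ns: "\<And>\<eta>. g \<odot> y \<noteq> \<eta> *\<^sub>R g" by blast
    obtain H \<xi> where H: "osys H e" "\<And>h. h \<in> H \<Longrightarrow> primitive_idempotent jp h"
      "\<And>h. h \<in> H \<Longrightarrow> y \<odot> h = \<xi> h *\<^sub>R h" "\<And>h. h \<in> H \<Longrightarrow> \<exists>g\<in>G. g \<odot> h = h"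
      by (rule refine_diag[OF oG yG]) (rule that)
    have f: "frame H" using H by (simp add: frame_def)
    note F = frameD[OF f]
    have yd: "diag y H \<xi>" using f H(3) by (simp add: diag_def)
    have gh: "g \<odot> h = h \<or> g \<odot> h = 0" if h: "h \<in> H" for h
    proof -
      obtain k where k: "k \<in> G" "k \<odot> h = h" using H(4)[OF h] by blast
      show ?thesis using V1_W(2)[OF oG k g] k by (cases "g = k") auto
    qed
    \<comment> \<open>If all eigenvalues under \<open>g\<close> agreed, \<open>y\<close> would be a
      scalar on that block.\<close>
    have "\<exists>h h'. h \<in> H \<and> h' \<in> H \<and> g \<odot> h = h \<and> g \<odot> h' = h' \<and> \<xi> h' < \<xi> h"
    proof (rule ccontr)
      assume none: "\<not> ?thesis"
      define K where "K = {h\<in>H. g \<odot> h = h}"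
      have eqK: "\<xi> h = \<xi> h'" if "h \<in> K" "h' \<in> K" for h h'
      proof -
        have "\<not> \<xi> h' < \<xi> h" "\<not> \<xi> h < \<xi> h'" using none that unfolding K_def by blast+
        thus ?thesis by simp
      qed
      have "\<exists>\<rho>. \<forall>h\<in>K. \<xi> h = \<rho>" using eqK by blast
      then obtain \<rho> where \<rho>: "\<And>h. h \<in> K \<Longrightarrow> \<xi> h = \<rho>" by blast
      have sumK: "(\<Sum>h\<in>H. c h *\<^sub>R (g \<odot> h)) = (\<Sum>h\<in>K. c h *\<^sub>R h)" for c
      proof -
        have "(\<Sum>h\<in>H. c h *\<^sub>R (g \<odot> h)) = (\<Sum>h\<in>K. c h *\<^sub>R (g \<odot> h))"
        proof (rule sum.mono_neutral_right)
          show "\<forall>h\<in>H - K. c h *\<^sub>R (g \<odot> h) = 0" using gh unfolding K_def by fastforce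
        qed (use F(1) in \<open>auto simp: K_def\<close>)
        also have "\<dots> = (\<Sum>h\<in>K. c h *\<^sub>R h)" by (rule sum.cong) (auto simp: K_def)
        finally show ?thesis .
      qed
      have "g = (\<Sum>h\<in>H. 1 *\<^sub>R (g \<odot> h))" using F(7) by (simp flip: jsum_right)
      hence gK: "g = (\<Sum>h\<in>K. 1 *\<^sub>R h)" unfolding sumK .
      have "g \<odot> y = (\<Sum>h\<in>H. \<xi> h *\<^sub>R (g \<odot> h))"
        by (subst diag_sum[OF yd]) (simp add: jsum_right jlin)
      also have "\<dots> = (\<Sum>h\<in>K. \<rho> *\<^sub>R h)" unfolding sumK using \<rho> by simp
      also have "\<dots> = \<rho> *\<^sub>R g" by (subst gK) (simp add: scaleR_sum_right)
      finally show False using ns by blast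
    qed
    then obtain h h' where h: "h \<in> H" "h' \<in> H" "g \<odot> h = h" "g \<odot> h' = h'" "\<xi> h' < \<xi> h" by blast
    have ne: "h \<noteq> h'" using h(5) by auto
    have dW: "h' - h \<in> W G" using V1_W(1)[OF oG g h(3)] V1_W(1)[OF oG g h(4)] W_subspace[of G] by (simp add: subspace_diff)
    \<comment> \<open>For \<open>k = g\<close> this rests on the common norm: both members pair with
      \<open>g\<close> to \<kappa>.\<close>
    have d0: "inner (h' - h) k = 0" if k: "k \<in> G" for k
    proof (cases "k = g")
      case True
      have "inner q g = \<kappa>" if "q \<in> H" "g \<odot> q = q" for q
      proof -
        have "inner q g = inner q q"
          using jassoc_inner[of q q g] F(4)[OF that(1)] that(2) jcom[of q g] by simp
        thus ?thesis using frame_inner[OF f that(1) that(1)] by simp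
      qed
      thus ?thesis using True h by (simp add: inner_diff_left)
    next
      case False
      have "inner q k = 0" if "g \<odot> q = q" for q
        using jassoc_inner[of k q e] V1_W(2)[OF oG g that k False] by simp
      thus ?thesis using h by (simp add: inner_diff_left)
    qed
    define \<Delta> where "\<Delta> = \<xi> h - \<xi> h'"
    \<comment> \<open>One \<open>s\<close> serves both signs: \<open>s\<close> yields the descent,
      \<open>- s\<close> the ascent.\<close>
    have moves: "\<exists>s. 0 < s \<and> s < \<Delta> \<and> (\<forall>t. \<bar>t\<bar> = s \<longrightarrow> (\<exists>x'. eigvals jp e x' = eigvals jp e x \<and> dist x' x < \<epsilon> \<and>
          eigvals jp e (x' - a) = eigvals jp e (y + t *\<^sub>R (h' - h))))" if \<epsilon>: "\<epsilon> > 0" for \<epsilon>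
    proof -
      obtain \<delta> where \<delta>: "\<delta> > 0"
        "\<And>z. z - y \<in> W G \<Longrightarrow> (\<And>g. g \<in> G \<Longrightarrow> inner (z - y) g = 0) \<Longrightarrow> norm (z - y) < \<delta> \<Longrightarrow>
           \<exists>x'. eigvals jp e x' = eigvals jp e x \<and> dist x' x < \<epsilon> \<and> eigvals jp e (x' - a) = eigvals jp e z"
        unfolding y_def using orbit_difference_open[OF oG xG aG max \<epsilon>] unfolding P_def by blast
      \<comment> \<open>The first bound keeps the two entries from passing each other, the second
        keeps the target within \<delta>.\<close>
      define s where "s = min (\<Delta> / 2) (\<delta> / (2 * (norm (h' - h) + 1)))"
      have np: "norm (h' - h) + 1 > 0" by (simp add: add_nonneg_pos)
      have \<Delta>: "\<Delta> > 0" using h(5) by (simp add: \<Delta>_def)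
      have "s \<le> \<Delta> / 2" unfolding s_def by (rule min.cobounded1)
      moreover have "0 < s" using \<Delta> \<delta>(1) np by (simp add: s_def)
      ultimately have s: "0 < s" "s < \<Delta>" using \<Delta> by simp_all
      have "s * norm (h' - h) < \<delta>"
      proof -
        have half: "(\<delta> / (2 * n)) * n = \<delta> / 2" if "n > 0" for n :: real
          using that by (simp add: field_simps)
        have "s * norm (h' - h) \<le> s * (norm (h' - h) + 1)" using s by (intro mult_left_mono) auto
        also have "\<dots> \<le> (\<delta> / (2 * (norm (h' - h) + 1))) * (norm (h' - h) + 1)"
          unfolding s_def using np by (intro mult_right_mono min.cobounded2) simp
        also have "\<dots> = \<delta> / 2" by (rule half[OF np])
        finally show ?thesis using \<delta>(1) by simp
      qed
      hence "\<exists>x'. eigvals jp e x' = eigvals jp e x \<and> dist x' x < \<epsilon> \<and>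
          eigvals jp e (x' - a) = eigvals jp e (y + t *\<^sub>R (h' - h))" if "\<bar>t\<bar> = s" for t
        using \<delta>(2)[of "y + t *\<^sub>R (h' - h)"] dW d0 W_subspace[of G] that by (simp add: subspace_scale)
      with s show ?thesis by blast
    qed
    have "descends a x"
      unfolding descends_def
    proof (intro allI impI)
      fix \<epsilon> :: real assume "\<epsilon> > 0"
      then obtain s x' where s: "0 < s" "s < \<Delta>" and x': "eigvals jp e x' = eigvals jp e x" "dist x' x < \<epsilon>"
        "eigvals jp e (x' - a) = eigvals jp e (y + s *\<^sub>R (h' - h))" using moves by (metis abs_of_pos)
      have "maj (x' - a) (x - a)" "inner (x' - a) (x' - a) < inner (x - a) (x - a)"
        using transfer_maj(1)[OF yd h(1,2) ne s(1)] s(2) maj_cong[OF x'(3) refl, of y] eigvals_norm[OF x'(3)]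
        by (auto simp: \<Delta>_def y_def)
      with x' show "\<exists>x'. eigvals jp e x' = eigvals jp e x \<and> dist x' x < \<epsilon> \<and>
        maj (x' - a) (x - a) \<and> inner (x' - a) (x' - a) < inner (x - a) (x - a)" by blast
    qed
    moreover have "ascends a x"
      unfolding ascends_def
    proof (intro allI impI)
      fix \<epsilon> :: real assume "\<epsilon> > 0"
      then obtain s where s: "0 < s" "s < \<Delta>" "\<And>t. \<bar>t\<bar> = s \<Longrightarrow> (\<exists>x'. eigvals jp e x' = eigvals jp e x \<and> dist x' x < \<epsilon> \<and>
          eigvals jp e (x' - a) = eigvals jp e (y + t *\<^sub>R (h' - h)))" using moves by blast
      have "\<bar>- s\<bar> = s" using s(1) by simp
      from s(3)[OF this] obtain x' where x': "eigvals jp e x' = eigvals jp e x" "dist x' x < \<epsilon>"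
        "eigvals jp e (x' - a) = eigvals jp e (y + (- s) *\<^sub>R (h' - h))" by blast
      have "maj (x - a) (x' - a)" "inner (x - a) (x - a) < inner (x' - a) (x' - a)"
        using transfer_maj(2)[OF yd h(1,2) ne, of "- s"] s(1) h(5) maj_cong[OF refl x'(3), of y] eigvals_norm[OF x'(3)]
        by (auto simp: y_def)
      with x' show "\<exists>x'. eigvals jp e x' = eigvals jp e x \<and> dist x' x < \<epsilon> \<and>
        maj (x - a) (x' - a) \<and> inner (x - a) (x - a) < inner (x' - a) (x' - a)" by blast
    qed
    ultimately show ?thesis by blast
  qed
qed

lemma commute_or_descends: "strongly_operator_commute jp e a x \<or> descends a x"
proof (cases "\<exists>H \<xi> \<alpha>. diag x H \<xi> \<and> diag a H \<alpha>")
  case True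
  then obtain H \<xi> \<alpha> where d: "diag x H \<xi>" "diag a H \<alpha>" by blast
  show ?thesis
  proof (cases "\<forall>i\<in>H. \<forall>j\<in>H. (\<xi> i - \<xi> j) * (\<alpha> i - \<alpha> j) \<ge> 0")
    case True
    thus ?thesis using strongly_operator_commuteI[OF d(2,1)] by blast
  next
    case False
    then obtain i j where ij: "i \<in> H" "j \<in> H" "(\<xi> i - \<xi> j) * (\<alpha> i - \<alpha> j) < 0" by force
    have "descends a x"
      unfolding descends_def
    proof (intro allI impI)
      fix \<epsilon> :: real assume \<epsilon>: "\<epsilon> > 0"
      have nz: "(\<xi> i - \<xi> j) * (\<alpha> i - \<alpha> j) \<noteq> 0" by (rule less_imp_neq[OF ij(3)])
      show "\<exists>x'. eigvals jp e x' = eigvals jp e x \<and> dist x' x < \<epsilon> \<and>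
        maj (x' - a) (x - a) \<and> inner (x' - a) (x' - a) < inner (x - a) (x - a)"
        by (rule rotation_perturbation[OF d ij(1,2) nz \<epsilon>]) (use ij(3) in blast)
    qed
    thus ?thesis ..
  qed
next
  case False
  thus ?thesis using common_frame_or_moves by blast
qed

lemma commute_or_ascends: "strongly_operator_commute jp e (- a) x \<or> ascends a x"
proof (cases "\<exists>H \<xi> \<alpha>. diag x H \<xi> \<and> diag a H \<alpha>")
  case True
  then obtain H \<xi> \<alpha> where d: "diag x H \<xi>" "diag a H \<alpha>" by blast
  show ?thesis
  proof (cases "\<forall>i\<in>H. \<forall>j\<in>H. (\<xi> i - \<xi> j) * (\<alpha> i - \<alpha> j) \<le> 0")
    case True
    have "diag (- a) H (\<lambda>h. - \<alpha> h)" using d(2) by (simp add: diag_def jlin)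
    moreover have "(\<xi> i - \<xi> j) * (- \<alpha> i - - \<alpha> j) \<ge> 0" if "i \<in> H" "j \<in> H" for i j
    proof -
      have "(\<xi> i - \<xi> j) * (- \<alpha> i - - \<alpha> j) = - ((\<xi> i - \<xi> j) * (\<alpha> i - \<alpha> j))" by (simp add: algebra_simps)
      thus ?thesis using True that by simp
    qed
    ultimately show ?thesis using strongly_operator_commuteI[OF _ d(1)] by blast
  next
    case False
    then obtain i j where ij: "i \<in> H" "j \<in> H" "(\<xi> i - \<xi> j) * (\<alpha> i - \<alpha> j) > 0" by force
    have "ascends a x"
      unfolding ascends_def
    proof (intro allI impI)
      fix \<epsilon> :: real assume \<epsilon>: "\<epsilon> > 0"
      have nz: "(\<xi> i - \<xi> j) * (\<alpha> i - \<alpha> j) \<noteq> 0" by (rule less_imp_neq[OF ij(3), symmetric])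
      show "\<exists>x'. eigvals jp e x' = eigvals jp e x \<and> dist x' x < \<epsilon> \<and>
        maj (x - a) (x' - a) \<and> inner (x - a) (x - a) < inner (x' - a) (x' - a)"
        by (rule rotation_perturbation[OF d ij(1,2) nz \<epsilon>]) (use ij(3) in blast)
    qed
    thus ?thesis ..
  qed
next
  case False
  thus ?thesis using common_frame_or_moves by blast
qed

section \<open>Commuting pairs and extremality on the whole orbit\<close>

lemma commuting_lists:
  assumes "strongly_operator_commute jp e a x"
  obtains es \<xi> \<alpha> where "distinct es" "eigvals jp e x = map \<xi> es" "eigvals jp e a = map \<alpha> es"
    "diag x (set es) \<xi>" "diag a (set es) \<alpha>"
proof -
  obtain es where es: "jordan_frame jp e es" "length es = rk"
    "a = frame_sum (eigvals jp e a) es" "x = frame_sum (eigvals jp e x) es"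
    by (rule strongly_operator_commuteD[OF assms])
  have d: "distinct es" and f: "frame (set es)" using es(1) by (auto simp: jordan_frame_iff)
  obtain \<xi> where \<xi>: "eigvals jp e x = map \<xi> es" using list_function[OF d] eigvals_length es(2) by metis
  obtain \<alpha> where \<alpha>: "eigvals jp e a = map \<alpha> es" using list_function[OF d] eigvals_length es(2) by metis
  have "diag x (set es) \<xi>" "diag a (set es) \<alpha>"
    using diagI[OF f, of \<xi>] diagI[OF f, of \<alpha>] es(3,4) frame_sum_map[OF d] unfolding \<xi> \<alpha> by metis+
  with that[OF d \<xi> \<alpha>] show thesis by blast
qed

text \<open>The eigenvalues of the difference depend only on those of \<open>x\<close> and
  \<open>a\<close>. A difference of sorted lists need not be sorted, hence the multisets.\<close>

lemma commuting_diff: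
  assumes "strongly_operator_commute jp e a x"
  shows "mset (eigvals jp e (x - a)) = mset (map2 (-) (eigvals jp e x) (eigvals jp e a))"
proof -
  obtain es \<xi> \<alpha> where es: "distinct es" "eigvals jp e x = map \<xi> es" "eigvals jp e a = map \<alpha> es"
    "diag x (set es) \<xi>" "diag a (set es) \<alpha>" by (rule commuting_lists[OF assms])
  have "diag (x - a) (set es) (\<lambda>h. \<xi> h - \<alpha> h)"
    using es(4,5) by (simp add: diag_def jlin scaleR_diff_left)
  from eigvals_mset[OF this] show ?thesis
    using es(1-3) by (simp add: mset_set_set map2_map_map)
qed

text \<open>The equality case of \<open>eigsum_subadd\<close>: a common frame sorted for both
  elements is sorted for the sum.\<close>

lemma commuting_sum:
  assumes "strongly_operator_commute jp e a x"
  shows "eigsum k (x + a) = eigsum k x + eigsum k a"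
proof -
  obtain es \<xi> \<alpha> where es: "distinct es" "eigvals jp e x = map \<xi> es" "eigvals jp e a = map \<alpha> es"
    "diag x (set es) \<xi>" "diag a (set es) \<alpha>" by (rule commuting_lists[OF assms])
  have d: "diag (x + a) (set es) (\<lambda>h. \<xi> h + \<alpha> h)"
    using es(4,5) by (simp add: diag_def jlin scaleR_add_left)
  have "sorted_wrt (\<lambda>g h. \<xi> g \<ge> \<xi> h) es" "sorted_wrt (\<lambda>g h. \<alpha> g \<ge> \<alpha> h) es"
    using eigvals_sorted[of x] eigvals_sorted[of a] es(2,3) by (simp_all add: sorted_wrt_map)
  hence "sorted_wrt (\<lambda>g h. \<xi> g + \<alpha> g \<ge> \<xi> h + \<alpha> h) es"
    by (auto simp: sorted_wrt_iff_nth_less intro: add_mono)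
  from eigvals_diag[OF d es(1) refl this] show ?thesis
    unfolding eigsum_def es(2,3) by (simp add: take_map sum_list_addf)
qed

lemma bounded_orbit: "bounded (eigval_orbit jp e b)"
proof -
  have "norm x \<le> norm b" if "x \<in> eigval_orbit jp e b" for x
    using that eigvals_norm[of x b] by (simp add: eigval_orbit_def norm_eq_sqrt_inner)
  thus ?thesis unfolding bounded_iff by blast
qed

lemma commuting_majorized_by_orbit:
  assumes xb: "xb \<in> eigval_orbit jp e b" and c: "strongly_operator_commute jp e a xb"
    and x: "x \<in> eigval_orbit jp e b"
  shows "maj (xb - a) (x - a)"
proof -
  \<comment> \<open>Building the majorization into the set keeps the unknown minimizer comparable
    with \<open>x\<close>; descents respect it by transitivity.\<close>
  define M where "M = eigval_orbit jp e b \<inter> {x'. maj (x' - a) (x - a)}"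
  have "compact M" unfolding M_def compact_eq_bounded_closed
    using bounded_orbit closed_orbit closed_maj by (auto intro: bounded_subset closed_Int)
  moreover have "x \<in> M" using x by (simp add: M_def maj_def)
  moreover have "continuous_on M (\<lambda>x'. inner (x' - a) (x' - a))" by (intro continuous_intros)
  ultimately obtain x' where x': "x' \<in> M"
    and min: "\<And>z. z \<in> M \<Longrightarrow> inner (x' - a) (x' - a) \<le> inner (z - a) (z - a)"
    using continuous_attains_inf[of M "\<lambda>x'. inner (x' - a) (x' - a)"] by blast
  have "\<not> descends a x'"
  proof
    assume "descends a x'"
    then obtain z where z: "eigvals jp e z = eigvals jp e x'" "maj (z - a) (x' - a)"
      "inner (z - a) (z - a) < inner (x' - a) (x' - a)"
      unfolding descends_def using zero_less_one by blast
    have "z \<in> M" using z(1,2) x' maj_trans by (auto simp: M_def eigval_orbit_def)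
    from min[OF this] z(3) show False by simp
  qed
  hence "strongly_operator_commute jp e a x'" using commute_or_descends by blast
  from commuting_diff[OF this] commuting_diff[OF c]
  have "eigvals jp e (x' - a) = eigvals jp e (xb - a)"
    using x' xb by (intro eigvals_cong_mset) (simp add: M_def eigval_orbit_def)
  from maj_cong[OF this refl] x' show ?thesis by (auto simp: M_def)
qed

text \<open>Subadditivity bounds the partial sums of \<open>x - a\<close> by those of
  \<open>xb\<close> plus those of \<open>- a\<close>, and commutation attains this bound at
  \<open>xb - a\<close>.\<close>

lemma orbit_majorized_by_commuting:
  assumes xb: "xb \<in> eigval_orbit jp e b" and c: "strongly_operator_commute jp e (- a) xb"
    and x: "x \<in> eigval_orbit jp e b"
  shows "maj (x - a) (xb - a)"
proof -
  have ev: "eigvals jp e x = eigvals jp e xb" using x xb by (simp add: eigval_orbit_def)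
  have "eigsum k (x - a) \<le> eigsum k (xb - a)" if "k \<le> rk" for k
    using eigsum_subadd[OF that, of x "- a"] commuting_sum[OF c, of k] eigvals_eigsum_cong[OF ev, of k] by simp
  moreover have "inner (x - a) e = inner (xb - a) e"
    using eigvals_eigsum_cong[OF ev] by (simp add: inner_diff_left)
  ultimately show ?thesis by (simp add: maj_def)
qed

end

theorem theorem6p1:
  fixes jp :: "'a::euclidean_space \<Rightarrow> 'a \<Rightarrow> 'a"
    and e a b :: 'a
    and F :: "'a \<Rightarrow> real"
  assumes "simple_eja jp e"
    and "strictly_schur_convex_spectral jp e F"
  shows "(\<forall>xb. local_minimizer (\<lambda>x. F (x - a)) (eigval_orbit jp e b) xb \<longrightarrow>
            strongly_operator_commute jp e a xb)
       \<and> (\<forall>xb. local_maximizer (\<lambda>x. F (x - a)) (eigval_orbit jp e b) xb \<longrightarrow>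
            strongly_operator_commute jp e (- a) xb)
       \<and> (\<forall>xb. local_minimizer (\<lambda>x. F (x - a)) (eigval_orbit jp e b) xb \<longrightarrow>
            global_minimizer (\<lambda>x. F (x - a)) (eigval_orbit jp e b) xb)
       \<and> (\<forall>xb. local_maximizer (\<lambda>x. F (x - a)) (eigval_orbit jp e b) xb \<longrightarrow>
            global_maximizer (\<lambda>x. F (x - a)) (eigval_orbit jp e b) xb)"
proof -
  have "euclidean_jordan_algebra UNIV jp e" using assms(1) by (simp add: simple_eja_def)
  then interpret simple_euclidean_jordan jp e
    by (simp add: simple_euclidean_jordan_def simple_euclidean_jordan_axioms_def eja_def assms(1))
  obtain f where F: "\<And>x. F x = f (eigvals jp e x)" and f: "strictly_schur_convex rk f"
    using assms(2) unfolding strictly_schur_convex_spectral_def spectral_function_of_def by blast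
  have F_le: "F z \<le> F y" if "maj z y" for z y
    using f maj_majorized[OF that] eigvals_length unfolding F strictly_schur_convex_def by blast
  \<comment> \<open>Unequal norms exclude equal eigenvalues, so the strict half of Schur convexity
    applies.\<close>
  have F_less: "F z < F y" if m: "maj z y" and n: "inner z z \<noteq> inner y y" for z y
  proof -
    have "decreasing_rearr (eigvals jp e z) \<noteq> decreasing_rearr (eigvals jp e y)"
      using n eigvals_norm[of z y] by (auto simp: decreasing_rearr_eigvals)
    thus ?thesis
      using f maj_majorized[OF m] eigvals_length unfolding F strictly_schur_convex_def by blast
  qed
  have min: "strongly_operator_commute jp e a xb"
    if lm: "local_minimizer (\<lambda>x. F (x - a)) (eigval_orbit jp e b) xb" for xb
  proof (rule ccontr)
    assume "\<not> ?thesis"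
    hence d: "descends a xb" using commute_or_descends by blast
    obtain U where U: "xb \<in> eigval_orbit jp e b" "open U" "xb \<in> U"
      "\<And>x. x \<in> eigval_orbit jp e b \<inter> U \<Longrightarrow> F (xb - a) \<le> F (x - a)"
      using lm unfolding local_minimizer_def by blast
    obtain \<epsilon> where "\<epsilon> > 0" "ball xb \<epsilon> \<subseteq> U" using U(2,3) open_contains_ball by blast
    with d obtain x where x: "eigvals jp e x = eigvals jp e xb" "dist x xb < \<epsilon>" "maj (x - a) (xb - a)"
      "inner (x - a) (x - a) < inner (xb - a) (xb - a)" unfolding descends_def by blast
    have "x \<in> eigval_orbit jp e b \<inter> U"
      using x(1,2) U(1) \<open>ball xb \<epsilon> \<subseteq> U\<close> by (auto simp: eigval_orbit_def dist_commute subset_iff)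
    from U(4)[OF this] F_less[OF x(3)] x(4) show False by simp
  qed
  have max: "strongly_operator_commute jp e (- a) xb"
    if lm: "local_maximizer (\<lambda>x. F (x - a)) (eigval_orbit jp e b) xb" for xb
  proof (rule ccontr)
    assume "\<not> ?thesis"
    hence d: "ascends a xb" using commute_or_ascends by blast
    obtain U where U: "xb \<in> eigval_orbit jp e b" "open U" "xb \<in> U"
      "\<And>x. x \<in> eigval_orbit jp e b \<inter> U \<Longrightarrow> F (x - a) \<le> F (xb - a)"
      using lm unfolding local_maximizer_def by blast
    obtain \<epsilon> where "\<epsilon> > 0" "ball xb \<epsilon> \<subseteq> U" using U(2,3) open_contains_ball by blast
    with d obtain x where x: "eigvals jp e x = eigvals jp e xb" "dist x xb < \<epsilon>" "maj (xb - a) (x - a)"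
      "inner (xb - a) (xb - a) < inner (x - a) (x - a)" unfolding ascends_def by blast
    have "x \<in> eigval_orbit jp e b \<inter> U"
      using x(1,2) U(1) \<open>ball xb \<epsilon> \<subseteq> U\<close> by (auto simp: eigval_orbit_def dist_commute subset_iff)
    from U(4)[OF this] F_less[OF x(3)] x(4) show False by simp
  qed
  show ?thesis
  proof (intro conjI allI impI)
    fix xb assume lm: "local_minimizer (\<lambda>x. F (x - a)) (eigval_orbit jp e b) xb"
    show "strongly_operator_commute jp e a xb" by (rule min[OF lm])
    show "global_minimizer (\<lambda>x. F (x - a)) (eigval_orbit jp e b) xb"
      using lm commuting_majorized_by_orbit[OF _ min[OF lm]] F_le
      unfolding global_minimizer_def local_minimizer_def by blast
  next
    fix xb assume lm: "local_maximizer (\<lambda>x. F (x - a)) (eigval_orbit jp e b) xb"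
    show "strongly_operator_commute jp e (- a) xb" by (rule max[OF lm])
    show "global_maximizer (\<lambda>x. F (x - a)) (eigval_orbit jp e b) xb"
      using lm orbit_majorized_by_commuting[OF _ max[OF lm]] F_le
      unfolding global_maximizer_def local_maximizer_def by blast
  qed
qed

end
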